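(* Fix an even integer $\gamma\ge2$, an integer $c\ge1$, and reals $p>1$, $\gamma'\ge1$, $\alpha\in(1/2+2^{-p},1)$ with $\gamma'<\left(\frac{\gamma}{2^p+1+\alpha\gamma}\right)^{1/p}$. There is a randomized algorithm which, for $m$ large enough, on input a $\gamma$-$\mathrm{NCP}_2$ instance $(G,\mathbf{t},k)$ with $G\in\mathbb{F}_2^{m\times n}$, $\mathbf{t}\in\mathbb{F}_2^m$, $k\in\mathbb{Z}^+$, outputs in time $\mathrm{poly}(m)$ an instance $(B_{\mathrm{final}},k')$ of $\gamma'$-$\mathrm{SVP}_p$, with $B_{\mathrm{final}}$ an integer matrix with $M$ rows and $k'=(2^pk+\alpha\gamma k+1)^{1/p}<(\gamma k)^{1/p}$, such that with probability at least $0.9$: if $(G,\mathbf{t},k)$ is a YES instance of $\gamma$-$\mathrm{NCP}_2$, then $(B_{\mathrm{final}},k')$ is a YES instance of $\gamma'$-$\mathrm{SVP}_p$; and if $(G,\mathbf{t},k)$ is a NO instance, then $(B_{\mathrm{final}},k')$ is a NO instance of $\gamma'$-$\mathrm{SVP}_p$ such that every nonzero $\mathbf{w}\in\mathcal{L}(B_{\mathrm{final}})$ satisfies at least one of: (a) $\|\mathbf{w}\|_0>(\gamma'k')^p$; (b) $\mathbf{w}\in2\mathbb{Z}^{M}$ and $\|\mathbf{w}\|_0>(\gamma'k')^p/2^p$; (c) $\mathbf{w}\in2\mathbb{Z}^{M}$ and $\|\mathbf{w}\|_p>(\gamma'k')^{c+3p/2}$.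
   Context: For $G\in\mathbb{F}_2^{m\times n}$, $\mathcal{C}(G)=\{G\mathbf{x}:\mathbf{x}\in\mathbb{F}_2^n\}$; $\|\mathbf{v}\|_0$ is the number of nonzero coordinates; $\mathrm{dist}(\mathbf{t},\mathcal{C})=\min_{\mathbf{c}\in\mathcal{C}}\|\mathbf{t}-\mathbf{c}\|_0$. $\gamma$-$\mathrm{NCP}_2$: given $(G,\mathbf{t},k)$, YES if $\mathrm{dist}(\mathbf{t},\mathcal{C}(G))\le k$, NO if $\mathrm{dist}(\mathbf{t},\mathcal{C}(G))>\gamma k$. $\mathcal{L}(B)=\{B\mathbf{x}:\mathbf{x}\in\mathbb{Z}^n\}$, $\lambda_1^{(p)}$ is the $\ell_p$ norm of a shortest nonzero lattice vector; $\gamma$-$\mathrm{SVP}_p$: given $(B,k)$, YES if $\lambda_1^{(p)}(\mathcal{L}(B))\le k$, NO if $\lambda_1^{(p)}(\mathcal{L}(B))>\gamma k$; in this statement the distance bound $k'$ is allowed to be a positive real number.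
   Formalization: The running time is polynomial in the maximum of m, n and the bit length of k (poly(m) alone is impossible when n or k is huge), and the algorithm writes the integer k to represent the real number k', which is a fixed function of k. *)

theory Defs
  imports
    "HOL-Probability.Probability_Mass_Function"
    "HOL-Computational_Algebra.Polynomial"
    "HOL-Library.Z2"
    "HOL-Library.Log_Nat"
    "Jordan_Normal_Form.Matrix"
begin

section \<open>Codes and the nearest codeword problem\<close>

definition hamming_wt :: "'a::zero Matrix.vec \<Rightarrow> nat" where
  "hamming_wt v = card {i. i < dim_vec v \<and> vec_index v i \<noteq> 0}"

definition lin_code :: "bit Matrix.mat \<Rightarrow> bit Matrix.vec set" where
  "lin_code G = {G *\<^sub>v x | x. x \<in> carrier_vec (dim_col G)}"

definition code_dist :: "bit Matrix.vec \<Rightarrow> bit Matrix.vec set \<Rightarrow> nat" where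
  "code_dist t C = Min ((\<lambda>c. hamming_wt (t - c)) ` C)"

definition ncp_yes :: "bit Matrix.mat \<Rightarrow> bit Matrix.vec \<Rightarrow> nat \<Rightarrow> bool" where
  "ncp_yes G t k \<longleftrightarrow> code_dist t (lin_code G) \<le> k"

definition ncp_no :: "real \<Rightarrow> bit Matrix.mat \<Rightarrow> bit Matrix.vec \<Rightarrow> nat \<Rightarrow> bool" where
  "ncp_no \<gamma> G t k \<longleftrightarrow> real (code_dist t (lin_code G)) > \<gamma> * real k"


section \<open>Lattices and the shortest vector problem\<close>

definition lp_norm :: "real \<Rightarrow> int Matrix.vec \<Rightarrow> real" where
  "lp_norm p w = (\<Sum>i<dim_vec w. \<bar>real_of_int (vec_index w i)\<bar> powr p) powr (1 / p)"

definition int_lattice :: "int Matrix.mat \<Rightarrow> int Matrix.vec set" where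
  "int_lattice B = {B *\<^sub>v x | x. x \<in> carrier_vec (dim_col B)}"

definition nonzero_lattice_vecs :: "int Matrix.mat \<Rightarrow> int Matrix.vec set" where
  "nonzero_lattice_vecs B = int_lattice B - {0\<^sub>v (dim_row B)}"

text \<open>The columns of \<open>B\<close> need not be independent, but \<open>\<lambda>\<^sub>1\<close> only makes sense if the lattice is
  nonzero. The infimum is then a minimum, see \<open>lambda1_attained\<close> below.\<close>

definition svp_instance :: "int Matrix.mat \<Rightarrow> real \<Rightarrow> bool" where
  "svp_instance B k \<longleftrightarrow> nonzero_lattice_vecs B \<noteq> {} \<and> k > 0"

definition lambda1 :: "real \<Rightarrow> int Matrix.mat \<Rightarrow> real" where
  "lambda1 p B = Inf (lp_norm p ` nonzero_lattice_vecs B)"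

definition svp_yes :: "real \<Rightarrow> int Matrix.mat \<Rightarrow> real \<Rightarrow> bool" where
  "svp_yes p B k \<longleftrightarrow> svp_instance B k \<and> lambda1 p B \<le> k"

definition svp_no :: "real \<Rightarrow> real \<Rightarrow> int Matrix.mat \<Rightarrow> real \<Rightarrow> bool" where
  "svp_no p \<gamma> B k \<longleftrightarrow> svp_instance B k \<and> lambda1 p B > \<gamma> * k"

definition even_vec :: "int Matrix.vec \<Rightarrow> bool" where
  "even_vec w \<longleftrightarrow> (\<forall>i<dim_vec w. even (vec_index w i))"

lemma abs_le_lp_norm:
  assumes "p > 0" "i < dim_vec w"
  shows "\<bar>real_of_int (vec_index w i)\<bar> \<le> lp_norm p w"
proof -
  have "\<bar>real_of_int (vec_index w i)\<bar> powr p
      \<le> (\<Sum>i<dim_vec w. \<bar>real_of_int (vec_index w i)\<bar> powr p)"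
    using assms by (intro member_le_sum) auto
  then have "(\<bar>real_of_int (vec_index w i)\<bar> powr p) powr (1 / p) \<le> lp_norm p w"
    unfolding lp_norm_def using assms by (intro powr_mono2) auto
  then show ?thesis using assms by (simp add: powr_powr)
qed

lemma finite_bounded_int_vecs:
  "finite {w :: int Matrix.vec. dim_vec w = M \<and> (\<forall>i<M. \<bar>vec_index w i\<bar> \<le> K)}"
proof (rule finite_imageD)
  have "list_of_vec ` {w. dim_vec w = M \<and> (\<forall>i<M. \<bar>vec_index w i\<bar> \<le> K)}
      \<subseteq> {xs. set xs \<subseteq> {-K..K} \<and> length xs = M}"
    by (fastforce simp: in_set_conv_nth)
  then show "finite (list_of_vec ` {w. dim_vec w = M \<and> (\<forall>i<M. \<bar>vec_index w i\<bar> \<le> K)})"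
    by (rule finite_subset) (simp add: finite_lists_length_eq)
  show "inj_on list_of_vec {w :: int Matrix.vec. dim_vec w = M \<and> (\<forall>i<M. \<bar>vec_index w i\<bar> \<le> K)}"
    by (metis (mono_tags, lifting) inj_onI vec_list)
qed

lemma lambda1_attained:
  assumes "p > 0" and "nonzero_lattice_vecs B \<noteq> {}"
  shows "\<exists>w\<in>nonzero_lattice_vecs B. lp_norm p w = lambda1 p B
           \<and> (\<forall>v\<in>nonzero_lattice_vecs B. lp_norm p w \<le> lp_norm p v)"
proof -
  let ?L = "nonzero_lattice_vecs B"
  from assms obtain u where u: "u \<in> ?L" by auto
  define S where "S = {w\<in>?L. lp_norm p w \<le> lp_norm p u}"
  have dim: "dim_vec w = dim_row B" if "w \<in> ?L" for w
    using that by (auto simp: nonzero_lattice_vecs_def int_lattice_def)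
  have "\<bar>vec_index w i\<bar> \<le> \<lfloor>lp_norm p u\<rfloor>" if "w \<in> S" "i < dim_row B" for w i
    using abs_le_lp_norm[of p i w] assms(1) that dim[of w] unfolding S_def
    by (simp add: le_floor_iff)
  then have "S \<subseteq> {w. dim_vec w = dim_row B \<and> (\<forall>i<dim_row B. \<bar>vec_index w i\<bar> \<le> \<lfloor>lp_norm p u\<rfloor>)}"
    using dim unfolding S_def by auto
  then have fin: "finite S" using finite_bounded_int_vecs by (rule finite_subset)
  moreover have "S \<noteq> {}" using u unfolding S_def by auto
  ultimately obtain w where w: "w \<in> S" and least: "\<forall>v\<in>S. lp_norm p w \<le> lp_norm p v"
    using arg_min_if_finite(1)[of S "lp_norm p"] arg_min_least[of S _ "lp_norm p"] by blast
  have all: "lp_norm p w \<le> lp_norm p v" if "v \<in> ?L" for v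
  proof (cases "v \<in> S")
    case False
    then show ?thesis using that w unfolding S_def by auto
  qed (use least in auto)
  have "lambda1 p B = lp_norm p w"
    unfolding lambda1_def by (rule cInf_eq_minimum) (use w all S_def in auto)
  then show ?thesis using w all unfolding S_def by auto
qed


section \<open>Randomized algorithms\<close>

text \<open>
  The model of computation is a random access machine with logarithmic cost, with the control
  flow of a while language. A program uses finitely many integer arrays, named by natural numbers
  and initially zero; it reads a list of integers, writes a list of integers and flips coins.
  Evaluating an expression costs the bit length of the value of each of its subexpressions
  (so array addresses are paid for), and every executed instruction costs at least 1. The time is
  thus polynomially related to the running time of a multitape Turing machine.
\<close>

datatype exp =
    Lit int
  | Cell nat exp
  | Add exp exp
  | Sub exp exp
  | Mul exp exp
  | Div exp exp
  | Mod exp exp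
  | Less exp exp
  | Eq exp exp

datatype com =
    Skip
  | Assign nat exp exp
  | Read nat exp
  | Flip nat exp
  | Write exp
  | Seq com com
  | Cond exp com com
  | While exp com

type_synonym store = "nat \<Rightarrow> int \<Rightarrow> int"

fun val :: "exp \<Rightarrow> store \<Rightarrow> int" where
  "val (Lit i) s = i"
| "val (Cell a e) s = s a (val e s)"
| "val (Add e f) s = val e s + val f s"
| "val (Sub e f) s = val e s - val f s"
| "val (Mul e f) s = val e s * val f s"
| "val (Div e f) s = val e s div val f s"
| "val (Mod e f) s = val e s mod val f s"
| "val (Less e f) s = of_bool (val e s < val f s)"
| "val (Eq e f) s = of_bool (val e s = val f s)"

definition bit_len :: "int \<Rightarrow> nat" where
  "bit_len i = Suc (floorlog 2 (nat \<bar>i\<bar>))"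

fun cost :: "exp \<Rightarrow> store \<Rightarrow> nat" where
  "cost (Lit i) s = bit_len i"
| "cost (Cell a e) s = cost e s + bit_len (val (Cell a e) s)"
| "cost (Add e f) s = cost e s + cost f s + bit_len (val (Add e f) s)"
| "cost (Sub e f) s = cost e s + cost f s + bit_len (val (Sub e f) s)"
| "cost (Mul e f) s = cost e s + cost f s + bit_len (val (Mul e f) s)"
| "cost (Div e f) s = cost e s + cost f s + bit_len (val (Div e f) s)"
| "cost (Mod e f) s = cost e s + cost f s + bit_len (val (Mod e f) s)"
| "cost (Less e f) s = cost e s + cost f s + bit_len (val (Less e f) s)"
| "cost (Eq e f) s = cost e s + cost f s + bit_len (val (Eq e f) s)"

definition update :: "store \<Rightarrow> nat \<Rightarrow> int \<Rightarrow> int \<Rightarrow> store" where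
  "update s a i v = s(a := (s a)(i := v))"

text \<open>Configurations consist of the store, the unread input, the unused coin flips and the output
  written so far. \<open>exec c \<sigma> t \<sigma>'\<close> means that \<open>c\<close> started in \<open>\<sigma>\<close> terminates in \<open>\<sigma>'\<close> after time \<open>t\<close>.
  There is no transition for reading past the end of the input.\<close>

type_synonym config = "store \<times> int list \<times> bool list \<times> int list"

inductive exec :: "com \<Rightarrow> config \<Rightarrow> nat \<Rightarrow> config \<Rightarrow> bool" where
  Skip: "exec Skip \<sigma> 1 \<sigma>"
| Assign: "exec (Assign a e f) (s, xs, r, ys) (1 + cost e s + cost f s)
             (update s a (val e s) (val f s), xs, r, ys)"
| Read: "exec (Read a e) (s, x # xs, r, ys) (1 + cost e s + bit_len x)
             (update s a (val e s) x, xs, r, ys)"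
| Flip: "exec (Flip a e) (s, xs, b # r, ys) (1 + cost e s)
             (update s a (val e s) (of_bool b), xs, r, ys)"
| Write: "exec (Write e) (s, xs, r, ys) (1 + cost e s) (s, xs, r, ys @ [val e s])"
| Seq: "exec c1 \<sigma> t1 \<sigma>1 \<Longrightarrow> exec c2 \<sigma>1 t2 \<sigma>2 \<Longrightarrow> exec (Seq c1 c2) \<sigma> (1 + t1 + t2) \<sigma>2"
| CondTrue: "val e s \<noteq> 0 \<Longrightarrow> exec c1 (s, \<rho>) t \<sigma> \<Longrightarrow> exec (Cond e c1 c2) (s, \<rho>) (1 + cost e s + t) \<sigma>"
| CondFalse: "val e s = 0 \<Longrightarrow> exec c2 (s, \<rho>) t \<sigma> \<Longrightarrow> exec (Cond e c1 c2) (s, \<rho>) (1 + cost e s + t) \<sigma>"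
| WhileFalse: "val e s = 0 \<Longrightarrow> exec (While e c) (s, \<rho>) (1 + cost e s) (s, \<rho>)"
| WhileTrue: "val e s \<noteq> 0 \<Longrightarrow> exec c (s, \<rho>) t1 \<sigma>1 \<Longrightarrow> exec (While e c) \<sigma>1 t2 \<sigma>2
             \<Longrightarrow> exec (While e c) (s, \<rho>) (1 + cost e s + t1 + t2) \<sigma>2"

lemma exec_deterministic:
  "exec c \<sigma> t \<sigma>1 \<Longrightarrow> exec c \<sigma> t' \<sigma>2 \<Longrightarrow> t' = t \<and> \<sigma>2 = \<sigma>1"
proof (induction arbitrary: t' \<sigma>2 rule: exec.induct)
  case Skip
  then show ?case by cases auto
next
  case Assign
  then show ?case by cases auto
next
  case Read
  then show ?case by cases auto
next
  case Flip
  then show ?case by cases auto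
next
  case Write
  then show ?case by cases auto
next
  case Seq
  from Seq.prems show ?case by cases (use Seq.IH in blast)
next
  case CondTrue
  from CondTrue.prems show ?case by cases (use CondTrue.IH CondTrue.hyps in blast)+
next
  case CondFalse
  from CondFalse.prems show ?case by cases (use CondFalse.IH CondFalse.hyps in blast)+
next
  case WhileFalse
  from WhileFalse.prems show ?case by cases (use WhileFalse.hyps in simp_all)
next
  case WhileTrue
  from WhileTrue.prems show ?case by cases (use WhileTrue.IH WhileTrue.hyps in blast)+
qed

text \<open>\<open>outputs_within c T xs r ys\<close>: on input \<open>xs\<close> and coin flips \<open>r\<close>, the program \<open>c\<close> halts with output
  \<open>ys\<close> in time at most \<open>T\<close>. Since every flip takes time, \<open>T\<close> coin flips are always enough, so that
  the behaviour of a program with worst-case running time \<open>T\<close> is that on a uniformly random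
  element of \<open>coins T\<close>.\<close>

definition outputs_within :: "com \<Rightarrow> nat \<Rightarrow> int list \<Rightarrow> bool list \<Rightarrow> int list \<Rightarrow> bool" where
  "outputs_within c T xs r ys \<longleftrightarrow>
     (\<exists>t s xs' r'. t \<le> T \<and> exec c ((\<lambda>_ _. 0), xs, r, []) t (s, xs', r', ys))"

definition coins :: "nat \<Rightarrow> bool list set" where
  "coins T = {r. length r = T}"

text \<open>The input length of \<open>(G, t, k)\<close> is polynomial in \<open>max m (max n (bit_len k))\<close>, which is just \<open>m\<close> in
  the usual case where \<open>n \<le> m\<close> and \<open>k\<close> has at most \<open>m\<close> bits. A bound in terms of \<open>m\<close> alone is
  impossible, as an algorithm has to read all columns of \<open>G\<close>.\<close>

definition encode_ncp :: "bit Matrix.mat \<Rightarrow> bit Matrix.vec \<Rightarrow> nat \<Rightarrow> int list" where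
  "encode_ncp G t k =
     int (dim_row G) # int (dim_col G) # int k #
       map (\<lambda>b. of_bool (b = 1)) (concat (mat_to_list G) @ list_of_vec t)"

text \<open>The distance bound of the SVP instance is a real number with no finite representation in
  general. It is a fixed function of a positive integer \<open>\<kappa>\<close>, which is output in its place.\<close>

definition encode_svp :: "int Matrix.mat \<Rightarrow> nat \<Rightarrow> int list" where
  "encode_svp B \<kappa> = int (dim_row B) # int (dim_col B) # int \<kappa> # concat (mat_to_list B)"

end

theory Submission
  imports Defs
begin

text \<open>
  The reduction follows Khot. Put \<open>d = \<gamma> k\<close>. A lattice vector consists of the integer lift of a
  vector \<open>2 (G x + j t)\<close>, a word \<open>z\<close> in a coset of a BCH code of distance \<open>d\<close> and the multiplier
  \<open>j\<close>, subject to one linear condition modulo \<open>2\<^sup>K\<close> with random coefficients. The coset is that of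
  a random word of weight \<open>r < \<alpha> d\<close>, so that it contains about \<open>N powr (r - d / 2)\<close> words of weight
  \<open>r\<close> for a code of length \<open>N\<close>. In a YES instance each of them gives a vector of norm at most \<open>k'\<close>,
  and by the second moment method one of them satisfies the random condition. In a NO instance a
  vector with odd \<open>j\<close> or with some odd entry of \<open>z\<close> has more than \<open>(\<gamma>' k') powr p\<close> nonzero entries.
  The remaining vectors are even, and those which are sparse with small entries number at most
  \<open>N powr (d / 2 powr p)\<close> up to lower order factors; since \<open>\<alpha> > 1 / 2 + 2 powr (- p)\<close> the random condition
  can be chosen to remove all of them. Using a power of two as modulus lets coin flips sample the
  coefficients exactly; the entries of a vector then cost a factor of at most their absolute value in
  the probability of being removed.
\<close>

section \<open>Nimbers and BCH codes\<close>

text \<open>The promise of NCP says nothing about the minimum distance of \<open>G\<close>, so with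
  multiplier 0 a sparse codeword \<open>G x\<close> may show up in the lattice. Doubling this block
  makes such vectors even and leaves them to the random condition; the price is the term
  \<open>2 powr p * k\<close> in \<open>k'\<close>. The multiplier is kept as a coordinate of its
  own. It costs the summand 1 in \<open>k'\<close>, but it equals 1 in all vectors wanted for a YES
  instance, so each of them satisfies the condition with probability exactly \<open>1 / Q\<close>,
  and two of them with probability at most \<open>1 / Q ^ 2\<close>. The lower order factors, such
  as \<open>r ^ r\<close> or the number of values of an entry, are powers of \<open>E\<close> with
  exponent linear in \<open>d\<close>, where \<open>E\<close> is the least power of two that is at
  least \<open>m\<close>. They are paid for by the length \<open>N \<ge> E ^ C\<close> of the code:
  for a large constant \<open>C\<close> it is still polynomial in \<open>m\<close>, while
  \<open>N powr (\<epsilon> * d)\<close> exceeds all of them. Here \<epsilon> is the gap between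
  \<open>1 / 2 + 2 powr (- p)\<close> and a rational \<beta> below \<alpha>, and the weight
  \<open>r\<close> is \<open>\<beta> * d\<close> rounded down.\<close>

text \<open>
  If \<open>c\<close> is not of the form \<open>a\<^sup>2 + a\<close> in a field of characteristic two, then adjoining \<open>x\<close> with
  \<open>x\<^sup>2 = x + c\<close> gives a field in which \<open>c x\<close> is not of this form. Starting with the bits and \<open>c = 1\<close>,
  this tower yields the fields of order \<open>2 ^ 2 ^ i\<close> without any search for irreducible polynomials. The pair
  \<open>a + b x\<close> is the number \<open>a + b 2\<^sup>n\<close>, so that addition is \<open>xor\<close> and each field contains the previous ones.
\<close>

locale binary_field =
  fixes n :: nat and mul :: "nat \<Rightarrow> nat \<Rightarrow> nat" and c :: nat
  assumes n_pos: "0 < n"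
    and closed: "a < 2 ^ n \<Longrightarrow> b < 2 ^ n \<Longrightarrow> mul a b < 2 ^ n"
    and comm: "a < 2 ^ n \<Longrightarrow> b < 2 ^ n \<Longrightarrow> mul a b = mul b a"
    and assoc: "a < 2 ^ n \<Longrightarrow> b < 2 ^ n \<Longrightarrow> d < 2 ^ n \<Longrightarrow> mul (mul a b) d = mul a (mul b d)"
    and distrib: "a < 2 ^ n \<Longrightarrow> b < 2 ^ n \<Longrightarrow> d < 2 ^ n \<Longrightarrow> mul a (xor b d) = xor (mul a b) (mul a d)"
    and one: "a < 2 ^ n \<Longrightarrow> mul 1 a = a"
    and inverse: "0 < a \<Longrightarrow> a < 2 ^ n \<Longrightarrow> \<exists>b < 2 ^ n. mul a b = 1"
    and c_less: "c < 2 ^ n"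
    and no_root: "a < 2 ^ n \<Longrightarrow> xor (mul a a) a \<noteq> c"

lemma xor_less_exp: "a < 2 ^ n \<Longrightarrow> b < 2 ^ n \<Longrightarrow> xor a b < (2 ^ n :: nat)"
  by (metis take_bit_nat_eq_self_iff take_bit_xor)

lemma xor_cancel_left: "xor a (xor a b) = (b :: nat)"
  by (metis xor.assoc xor_self_eq xor.left_neutral)

lemma xor_eq_0_iff_eq: "xor a b = 0 \<longleftrightarrow> a = (b :: nat)"
  by (metis xor_cancel_left xor.right_neutral xor_self_eq)

lemma xor_mod_exp: "xor a b mod 2 ^ n = xor (a mod 2 ^ n) (b mod 2 ^ n :: nat)"
  by (metis take_bit_eq_mod take_bit_xor)

lemma xor_div_exp: "xor a b div 2 ^ n = xor (a div 2 ^ n) (b div 2 ^ n :: nat)"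
  by (metis drop_bit_eq_div drop_bit_xor)

definition quad_mul :: "nat \<Rightarrow> nat \<Rightarrow> (nat \<Rightarrow> nat \<Rightarrow> nat) \<Rightarrow> nat \<Rightarrow> nat \<Rightarrow> nat" where
  "quad_mul N c mul x y =
     xor (mul (x mod N) (y mod N)) (mul c (mul (x div N) (y div N)))
     + N * xor (mul (x div N) (y div N)) (xor (mul (x mod N) (y div N)) (mul (x div N) (y mod N)))"

context binary_field
begin

lemma zero [simp]: "a < 2 ^ n \<Longrightarrow> mul a 0 = 0"
  by (metis distrib xor_self_eq zero_less_power zero_less_numeral)

lemma zero' [simp]: "a < 2 ^ n \<Longrightarrow> mul 0 a = 0"
  by (metis comm zero zero_less_power zero_less_numeral)

lemma one': "a < 2 ^ n \<Longrightarrow> mul a 1 = a"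
  using comm[of a 1] one[of a] one_less_power[of "2::nat" n] n_pos by simp

lemmas one_simps [simp] = one[simplified] one'[simplified]

lemma distrib': "a < 2 ^ n \<Longrightarrow> b < 2 ^ n \<Longrightarrow> d < 2 ^ n \<Longrightarrow> mul (xor b d) a = xor (mul b a) (mul d a)"
  by (simp add: comm[of _ a] xor_less_exp distrib)

lemma left_comm: "a < 2 ^ n \<Longrightarrow> b < 2 ^ n \<Longrightarrow> d < 2 ^ n \<Longrightarrow> mul a (mul b d) = mul b (mul a d)"
  by (metis assoc comm)

lemmas ring_simps = closed xor_less_exp c_less assoc comm left_comm distrib distrib'
  xor.assoc xor.commute xor.left_commute xor_cancel_left xor_self_eq

abbreviation "ext \<equiv> quad_mul (2 ^ n) c mul"

lemma pair_less: "a < 2 ^ n \<Longrightarrow> b < 2 ^ n \<Longrightarrow> a + 2 ^ n * b < (2::nat) ^ (2 * n)"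
proof -
  assume "a < 2 ^ n" "b < 2 ^ n"
  then have "a + 2 ^ n * b < 2 ^ n * (b + 1)" by simp
  also have "\<dots> \<le> 2 ^ n * 2 ^ n" using \<open>b < 2 ^ n\<close> by (intro mult_le_mono2) simp
  finally show ?thesis by (simp add: mult_2 power_add)
qed

lemma hi_less: "x < 2 ^ (2 * n) \<Longrightarrow> x div 2 ^ n < (2::nat) ^ n"
  by (simp add: less_mult_imp_div_less mult_2 power_add)

lemma lo_less: "x mod 2 ^ n < (2::nat) ^ n" by simp

lemma ext_less: "x < 2 ^ (2 * n) \<Longrightarrow> y < 2 ^ (2 * n) \<Longrightarrow> ext x y < 2 ^ (2 * n)"
  unfolding quad_mul_def by (intro pair_less xor_less_exp closed hi_less lo_less c_less)

lemma ext_mod: "x < 2 ^ (2 * n) \<Longrightarrow> y < 2 ^ (2 * n) \<Longrightarrow>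
   ext x y mod 2 ^ n = xor (mul (x mod 2 ^ n) (y mod 2 ^ n)) (mul c (mul (x div 2 ^ n) (y div 2 ^ n)))"
  unfolding quad_mul_def by (simp add: xor_less_exp closed hi_less c_less)

lemma ext_div: "x < 2 ^ (2 * n) \<Longrightarrow> y < 2 ^ (2 * n) \<Longrightarrow>
   ext x y div 2 ^ n = xor (mul (x div 2 ^ n) (y div 2 ^ n))
      (xor (mul (x mod 2 ^ n) (y div 2 ^ n)) (mul (x div 2 ^ n) (y mod 2 ^ n)))"
  unfolding quad_mul_def by (simp add: xor_less_exp closed hi_less c_less)

lemma pair_eqI: "x mod 2 ^ n = y mod 2 ^ n \<Longrightarrow> x div 2 ^ n = y div 2 ^ n \<Longrightarrow> x = (y::nat)"
  by (metis div_mult_mod_eq)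

text \<open>The expression is the norm of \<open>a + b x\<close> over the smaller field. If
  \<open>b\<close> is invertible, dividing by its square turns a vanishing norm into
  \<open>u * u + u = c\<close> for \<open>u = a / b\<close>, which \<open>no_root\<close>
  excludes.\<close>

lemma norm_nonzero:
  assumes a: "a < 2 ^ n" and b: "b < 2 ^ n" and nz: "a \<noteq> 0 \<or> b \<noteq> 0"
  shows "xor (mul a a) (xor (mul a b) (mul c (mul b b))) \<noteq> 0" (is "?n \<noteq> 0")
proof
  assume n0: "?n = 0"
  show False
  proof (cases "b = 0")
    case True
    then have "mul a a = 0" using n0 a b by (simp add: c_less)
    moreover obtain v where "v < 2 ^ n" "mul a v = 1" using inverse a nz True by auto
    ultimately have "a = 0" using a by (metis assoc one' zero')
    then show False using nz True by simp
  next
    case False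
    then obtain v where v: "v < 2 ^ n" "mul b v = 1" using inverse b by auto
    define u where "u = mul a v"
    have u: "u < 2 ^ n" using a v closed u_def by simp
    have one_less: "1 < (2::nat) ^ n" using False b by (cases n) auto
    have "mul (mul v v) (mul a a) = mul u u" unfolding u_def using a b v by (simp add: ring_simps)
    moreover have "mul (mul v v) (mul a b) = mul u (mul b v)"
      unfolding u_def using a b v(1) by (simp add: ring_simps)
    moreover have "mul (mul v v) (mul c (mul b b)) = mul c (mul (mul b v) (mul b v))"
      using a b v(1) by (simp add: ring_simps)
    ultimately have "mul (mul v v) ?n = xor (mul u u) (xor u c)"
      using a b v u one_less by (simp add: distrib closed xor_less_exp c_less)
    moreover have "mul (mul v v) ?n = 0" using n0 v closed by simp
    ultimately have "xor (mul u u) u = c" by (metis xor.assoc xor_eq_0_iff_eq)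
    then show False using no_root u by blast
  qed
qed

text \<open>Commutativity, associativity and distributivity of \<open>ext\<close>, digit by digit.
  Variables stand in place of the \<open>mod\<close> and \<open>div\<close> terms, so that the
  permutative rewriting with \<open>ring_simps\<close> works on atoms.\<close>

lemma ext_identities:
  assumes "a < 2 ^ n" "a' < 2 ^ n" "b < 2 ^ n" "b' < 2 ^ n" "d < 2 ^ n" "d' < 2 ^ n"
  defines "lo \<equiv> \<lambda>a a' b b'. xor (mul a b) (mul c (mul a' b'))"
    and "hi \<equiv> \<lambda>a a' b b'. xor (mul a' b') (xor (mul a b') (mul a' b))"
  shows "lo a a' b b' = lo b b' a a'" "hi a a' b b' = hi b b' a a'"
    and "lo (lo a a' b b') (hi a a' b b') d d' = lo a a' (lo b b' d d') (hi b b' d d')"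
    and "hi (lo a a' b b') (hi a a' b b') d d' = hi a a' (lo b b' d d') (hi b b' d d')"
    and "lo a a' (xor b d) (xor b' d') = xor (lo a a' b b') (lo a a' d d')"
    and "hi a a' (xor b d) (xor b' d') = xor (hi a a' b b') (hi a a' d d')"
  unfolding lo_def hi_def using assms(1-6) by (simp_all add: ring_simps)

text \<open>The second root of the quadratic equation is \<open>x + 1\<close>, so the conjugate of
  \<open>a + b x\<close> is \<open>(a + b) + b x\<close>. Its product with \<open>a + b x\<close> is
  the norm; scaled by the inverse \<open>v\<close> of the norm it becomes the inverse.\<close>

lemma inverse_identities:
  assumes "a < 2 ^ n" "b < 2 ^ n" "v < 2 ^ n"
  shows "xor (mul a (mul v (xor a b))) (mul c (mul b (mul v b)))
      = mul (xor (mul a a) (xor (mul a b) (mul c (mul b b)))) v"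
    and "xor (mul b (mul v b)) (xor (mul a (mul v b)) (mul b (mul v (xor a b)))) = 0"
  using assms by (simp_all add: ring_simps)

lemma quad_ext: "binary_field (2 * n) ext (c * 2 ^ n)"
proof
  fix a b d :: nat
  assume a: "a < 2 ^ (2 * n)"
  note [simp] = hi_less[OF a] ext_mod ext_div xor_mod_exp xor_div_exp ext_less xor_less_exp
  {
    assume b: "b < 2 ^ (2 * n)"
    note [simp] = hi_less[OF b]
    show "ext a b < 2 ^ (2 * n)" using a b by (rule ext_less)
    show "ext a b = ext b a"
      by (rule pair_eqI; simp only: a b ext_mod ext_div;
          rule ext_identities(1,2)[OF lo_less hi_less[OF a] lo_less hi_less[OF b] lo_less hi_less[OF a]])
    assume d: "d < 2 ^ (2 * n)"
    note [simp] = hi_less[OF d]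
    show "ext (ext a b) d = ext a (ext b d)"
      by (rule pair_eqI; simp only: a b d ext_mod ext_div ext_less; rule ext_identities; simp)
    show "ext a (xor b d) = xor (ext a b) (ext a d)"
      by (rule pair_eqI; simp only: a b d ext_mod ext_div xor_less_exp xor_mod_exp xor_div_exp;
          rule ext_identities; simp)
  }
  have "1 < (2::nat) ^ n" using n_pos one_less_power[of "2::nat" n] by simp
  then show "ext 1 a = a" using a n_pos by (simp add: quad_mul_def c_less)
  \<comment> \<open>Squaring in characteristic two cancels the mixed products. The high digit of
    \<open>a * a + a\<close> is therefore \<open>b * b + b\<close> with \<open>b\<close> the high
    digit of \<open>a\<close>, and \<open>no_root\<close> of the smaller field keeps it away from
    \<open>c\<close>.\<close>
  show "xor (ext a a) a \<noteq> c * 2 ^ n"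
  proof
    assume "xor (ext a a) a = c * 2 ^ n"
    then have "xor (ext a a) a div 2 ^ n = c" by simp
    then show False using a no_root[of "a div 2 ^ n"] comm[of "a div 2 ^ n" "a mod 2 ^ n"]
      by (simp add: xor.assoc)
  qed
next
  show "0 < 2 * n" using n_pos by simp
  show "c * 2 ^ n < 2 ^ (2 * n)" using c_less by (simp add: mult_2 power_add)
next
  fix x :: nat
  assume x0: "0 < x" and x: "x < 2 ^ (2 * n)"
  let ?a = "x mod 2 ^ n" and ?b = "x div 2 ^ n"
  have b: "?b < 2 ^ n" using x by (rule hi_less)
  have "?a \<noteq> 0 \<or> ?b \<noteq> 0" using x0 by (metis div_mult_mod_eq mult_0 add_0 less_irrefl)
  then have nz: "xor (mul ?a ?a) (xor (mul ?a ?b) (mul c (mul ?b ?b))) \<noteq> 0" (is "?n \<noteq> 0")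
    using b by (intro norm_nonzero) auto
  have nl: "?n < 2 ^ n" using b by (intro xor_less_exp closed c_less) auto
  obtain v where v: "v < 2 ^ n" "mul ?n v = 1" using inverse nz nl by blast
  let ?y = "mul v (xor ?a ?b) + 2 ^ n * mul v ?b"
  have y: "?y < 2 ^ (2 * n)" using b v by (intro pair_less closed xor_less_exp) auto
  have ym: "?y mod 2 ^ n = mul v (xor ?a ?b)" and yd: "?y div 2 ^ n = mul v ?b"
    using b v by (simp_all add: closed xor_less_exp)
  have "ext x ?y mod 2 ^ n = mul ?n v"
    unfolding ext_mod[OF x y] ym yd using inverse_identities[OF lo_less b v(1)] by simp
  moreover have "ext x ?y div 2 ^ n = 0"
    unfolding ext_div[OF x y] ym yd using inverse_identities[OF lo_less b v(1)] by simp
  ultimately have "ext x ?y = 1" using v(2)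
    by (metis div_mult_mod_eq mult_0 add_0)
  then show "\<exists>y < 2 ^ (2 * n). ext x y = 1" using y by blast
qed

end

text \<open>Conway's nim multiplication: the element adjoined at level \<open>i\<close> is
  \<open>F = 2 ^ 2 ^ i\<close>, with \<open>F * F = F + F / 2\<close>. The constant
  \<open>F / 2\<close>, a single top bit, is what the rule \<open>c * 2 ^ n\<close> of
  \<open>quad_ext\<close> produces from 1.\<close>

primrec nim_mul :: "nat \<Rightarrow> nat \<Rightarrow> nat \<Rightarrow> nat" where
  "nim_mul 0 = (*)"
| "nim_mul (Suc i) = quad_mul (2 ^ 2 ^ i) (2 ^ 2 ^ i div 2) (nim_mul i)"

lemma binary_field_nim_mul: "binary_field (2 ^ i) (nim_mul i) (2 ^ 2 ^ i div 2)"
proof (induction i)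
  case 0
  have *: "a < 2 \<longleftrightarrow> a = 0 \<or> a = 1" for a :: nat by auto
  show ?case by unfold_locales (auto simp: *)
next
  case (Suc i)
  interpret binary_field "2 ^ i" "nim_mul i" "2 ^ 2 ^ i div 2" by (rule Suc)
  obtain k where k: "(2::nat) ^ i = Suc k" by (metis not0_implies_Suc power_not_zero zero_neq_numeral)
  have "2 ^ Suc i = Suc k + Suc k" using k by simp
  then have "(2::nat) ^ 2 ^ i div 2 * 2 ^ 2 ^ i = 2 ^ 2 ^ Suc i div 2" by (simp only: k power_add) simp
  then show ?case using quad_ext by (simp only: power_Suc nim_mul.simps)
qed

lemma nim_mul_Suc: "x < 2 ^ 2 ^ i \<Longrightarrow> y < 2 ^ 2 ^ i \<Longrightarrow> nim_mul (Suc i) x y = nim_mul i x y"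
proof -
  interpret binary_field "2 ^ i" "nim_mul i" "2 ^ 2 ^ i div 2" by (rule binary_field_nim_mul)
  assume "x < 2 ^ 2 ^ i" "y < 2 ^ 2 ^ i"
  then show ?thesis by (simp add: quad_mul_def closed c_less)
qed

lemma two_exp_mono: "i \<le> j \<Longrightarrow> x < 2 ^ 2 ^ i \<Longrightarrow> x < (2::nat) ^ 2 ^ j"
  by (erule order.strict_trans2) (intro power_increasing; simp)

lemma nim_mul_level: "i \<le> j \<Longrightarrow> x < 2 ^ 2 ^ i \<Longrightarrow> y < 2 ^ 2 ^ i \<Longrightarrow> nim_mul j x y = nim_mul i x y"
proof (induction j rule: dec_induct)
  case (step j)
  have "nim_mul (Suc j) x y = nim_mul j x y"
    using step by (intro nim_mul_Suc two_exp_mono[of i j])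
  then show ?case using step by simp
qed (rule refl)

text \<open>The union of the tower as one type. All fields of order \<open>2 ^ 2 ^ i\<close> lie
  inside a single \<open>idom\<close>, so that \<open>sum\<close>, \<open>prod\<close> and powers
  can be used for codes of any length.\<close>

datatype nim = Nim (nim_nat: nat)

lemma less_two_exp: "x < (2::nat) ^ 2 ^ x"
  by (rule less_trans[OF less_exp less_exp])

instantiation nim :: idom
begin

definition "0 = Nim 0"
definition "1 = Nim 1"
definition "x + y = Nim (xor (nim_nat x) (nim_nat y))"
definition "x - y = Nim (xor (nim_nat x) (nim_nat y))"
definition "- x = (x :: nim)"
text \<open>The sum of the two numbers serves as a level at which both fit, since
  \<open>x < 2 ^ 2 ^ x\<close>. By \<open>nim_mul_level\<close> every other sufficient level yields
  the same product.\<close>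

definition "x * y = Nim (nim_mul (nim_nat x + nim_nat y) (nim_nat x) (nim_nat y))"

lemma nim_times_level:
  "nim_nat x < 2 ^ 2 ^ i \<Longrightarrow> nim_nat y < 2 ^ 2 ^ i \<Longrightarrow> x * y = Nim (nim_mul i (nim_nat x) (nim_nat y))"
proof -
  assume *: "nim_nat x < 2 ^ 2 ^ i" "nim_nat y < 2 ^ 2 ^ i"
  have **: "nim_nat x < 2 ^ 2 ^ (nim_nat x + nim_nat y)" "nim_nat y < 2 ^ 2 ^ (nim_nat x + nim_nat y)"
    using less_two_exp two_exp_mono by (meson le_add1 le_add2)+
  show ?thesis unfolding times_nim_def
    using * ** nim_mul_level[of "nim_nat x + nim_nat y" i] nim_mul_level[of i "nim_nat x + nim_nat y"]
    by (metis nat_le_linear)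
qed

instance
proof
  fix x y z :: nim
  define i where "i = nim_nat x + nim_nat y + nim_nat z"
  interpret binary_field "2 ^ i" "nim_mul i" "2 ^ 2 ^ i div 2" by (rule binary_field_nim_mul)
  have x: "nim_nat x < 2 ^ 2 ^ i" and y: "nim_nat y < 2 ^ 2 ^ i" and z: "nim_nat z < 2 ^ 2 ^ i"
    unfolding i_def by (meson less_two_exp two_exp_mono le_add1 le_add2 le_trans)+
  note * = nim_times_level[of _ i] x y z closed xor_less_exp plus_nim_def
  show "x * y * z = x * (y * z)" by (simp add: * assoc)
  show "x * y = y * x" by (simp add: * comm)
  show "(x + y) * z = x * z + y * z" by (simp add: * distrib')
  have "Suc 0 < 2 ^ 2 ^ i" using one_less_power[of "2::nat" "2 ^ i"] by simp
  then show "1 * x = x" by (simp add: * one_nim_def)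
  show "x * (y + z) = x * y + x * z" by (simp add: * distrib)
  show "0 * x = 0" "x * 0 = 0" using x by (simp_all add: * zero_nim_def)
  show "x \<noteq> 0 \<Longrightarrow> y \<noteq> 0 \<Longrightarrow> x * y \<noteq> 0"
  proof
    assume nz: "x \<noteq> 0" "y \<noteq> 0" "x * y = 0"
    then obtain v where v: "v < 2 ^ 2 ^ i" "nim_mul i (nim_nat x) v = 1"
      using inverse[of "nim_nat x"] x by (metis gr0I nim.collapse zero_nim_def)
    have "nim_mul i (nim_nat x) (nim_nat y) = 0" using nz(3) by (simp add: * zero_nim_def)
    then have "nim_mul i (nim_mul i (nim_nat x) v) (nim_nat y) = 0"
      using v x y by (metis assoc comm zero)
    then have "nim_nat y = 0" using v y by simp
    then show False using nz by (metis nim.collapse zero_nim_def)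
  qed
qed (auto simp: plus_nim_def minus_nim_def uminus_nim_def zero_nim_def one_nim_def xor.assoc
      xor.commute xor.left_commute)

end

lemma nim_char2: "x + x = (0 :: nim)"
  by (simp add: plus_nim_def zero_nim_def)

text \<open>This turns an equation in the field into parity conditions on integers, which a lattice
  basis can express by columns for the modulus 2.\<close>

lemma bit_nim_sum: "finite S \<Longrightarrow> bit (nim_nat (\<Sum>a\<in>S. f a)) b \<longleftrightarrow> odd (\<Sum>a\<in>S. nim_nat (f a) div 2 ^ b mod 2)"
proof (induction S rule: finite_induct)
  case empty
  then show ?case by (simp add: zero_nim_def)
next
  case (insert a S)
  have "bit (nim_nat (f a + sum f S)) b \<longleftrightarrow> bit (nim_nat (f a)) b \<noteq> bit (nim_nat (sum f S)) b"
    by (simp add: plus_nim_def bit_xor_iff)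
  then show ?case using insert by (simp add: bit_iff_odd)
qed

lemma nim_sum_square: "(\<Sum>a\<in>S. f a)\<^sup>2 = (\<Sum>a\<in>S. (f a)\<^sup>2 :: nim)"
proof (induction S rule: infinite_finite_induct)
  case (insert a S)
  have "2 = (0 :: nim)" using nim_char2[of 1] by simp
  then show ?case using insert by (simp add: power2_sum)
qed auto

text \<open>Squaring is additive, so the odd power sums and the parity (exponent 0 at
  \<open>t = 0\<close>) force all power sums up to exponent \<open>2 * h - 2\<close> to vanish. Then
  every polynomial of degree at most \<open>2 * h - 2\<close> has zero sum over \<open>S\<close>.
  The product of \<open>X - b\<close> over all \<open>b\<close> in \<open>S\<close> except one point
  \<open>s\<close> is such a polynomial, yet on \<open>S\<close> it is nonzero only at
  \<open>s\<close>. This interpolation takes the place of a Vandermonde determinant.\<close>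

theorem BCH_distance:
  fixes S :: "nim set"
  assumes fin: "finite S" and ne: "S \<noteq> {}" and card: "card S < 2 * h"
    and syn: "\<And>t. t < h \<Longrightarrow> (\<Sum>a\<in>S. a ^ (2 * t - 1)) = 0"
  shows False
proof -
  have pow: "(\<Sum>a\<in>S. a ^ j) = 0" if "j + 1 < 2 * h" for j
    using that
  proof (induction j rule: less_induct)
    case (less j)
    show ?case
    proof (cases "even j \<and> j \<noteq> 0")
      case True
      then obtain i where i: "j = 2 * i" "i < j" by (auto elim: evenE)
      then have "(\<Sum>a\<in>S. a ^ i) = 0" using less by simp
      then have "(\<Sum>a\<in>S. (a ^ i)\<^sup>2) = 0" using nim_sum_square[of "\<lambda>a. a ^ i" S] by simp
      then show ?thesis using i by (simp add: power_mult[symmetric] mult.commute)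
    next
      case False
      then have "\<exists>t < h. j = 2 * t - 1"
      proof (cases "j = 0")
        case False
        with \<open>\<not> (even j \<and> j \<noteq> 0)\<close> obtain i where "j = 2 * i + 1" by (auto elim: oddE)
        then show ?thesis using less.prems by (intro exI[of _ "i + 1"]) auto
      qed (use less.prems in \<open>auto intro!: exI[of _ 0]\<close>)
      then show ?thesis using syn by auto
    qed
  qed
  \<comment> \<open>The extra factor \<open>a ^ j\<close> makes the induction on \<open>T\<close>
    work: a further factor \<open>a - b\<close> yields the case \<open>j + 1\<close> minus
    \<open>b\<close> times the case \<open>j\<close>.\<close>
  have prod0: "(\<Sum>a\<in>S. a ^ j * (\<Prod>b\<in>T. a - b)) = 0" if "finite T" "j + card T + 1 < 2 * h" for T j
    using that
  proof (induction T arbitrary: j rule: finite_induct)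
    case empty
    then show ?case using pow by simp
  next
    case (insert b T)
    have "(\<Sum>a\<in>S. a ^ j * (\<Prod>b\<in>insert b T. a - b))
        = (\<Sum>a\<in>S. a ^ Suc j * (\<Prod>b\<in>T. a - b) - b * (a ^ j * (\<Prod>b\<in>T. a - b)))"
      using insert.hyps by (intro sum.cong) (auto simp: algebra_simps)
    also have "\<dots> = 0"
      unfolding sum_subtractf sum_distrib_left[symmetric]
      using insert.IH[of "Suc j"] insert.IH[of j] insert.prems insert.hyps by simp
    finally show ?case .
  qed
  obtain s where s: "s \<in> S" using ne by auto
  have "(\<Sum>a\<in>S. a ^ 0 * (\<Prod>b\<in>S - {s}. a - b)) = 0"
    using fin s card card_gt_0_iff[of S] by (intro prod0) (auto simp: card_Diff_singleton)
  moreover have "(\<Sum>a\<in>S. a ^ 0 * (\<Prod>b\<in>S - {s}. a - b)) = (\<Prod>b\<in>S - {s}. s - b)"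
    using fin s by (subst sum.remove[of _ s]) (auto intro!: sum.neutral prod_zero)
  ultimately show False using fin by (simp add: prod_zero_iff)
qed

section \<open>Unit-cost execution\<close>

text \<open>Every step costs 1 here, provided that no assigned value exceeds \<open>2 ^ w\<close> in absolute value. Then all
  cells stay that small, which bounds the values of all expressions and hence the logarithmic cost.\<close>

inductive steps :: "nat \<Rightarrow> com \<Rightarrow> config \<Rightarrow> nat \<Rightarrow> config \<Rightarrow> bool" for w where
  "steps w Skip \<sigma> 1 \<sigma>"
| "\<bar>val f s\<bar> \<le> 2 ^ w \<Longrightarrow>
     steps w (Assign a e f) (s, xs, r, ys) 1 (update s a (val e s) (val f s), xs, r, ys)"
| "\<bar>x\<bar> \<le> 2 ^ w \<Longrightarrow>
     steps w (Read a e) (s, x # xs, r, ys) 1 (update s a (val e s) x, xs, r, ys)"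
| "steps w (Flip a e) (s, xs, b # r, ys) 1 (update s a (val e s) (of_bool b), xs, r, ys)"
| "steps w (Write e) (s, xs, r, ys) 1 (s, xs, r, ys @ [val e s])"
| "steps w c1 \<sigma> t1 \<sigma>1 \<Longrightarrow> steps w c2 \<sigma>1 t2 \<sigma>2 \<Longrightarrow> steps w (Seq c1 c2) \<sigma> (1 + t1 + t2) \<sigma>2"
| "val e s \<noteq> 0 \<Longrightarrow> steps w c1 (s, \<rho>) t \<sigma> \<Longrightarrow> steps w (Cond e c1 c2) (s, \<rho>) (1 + t) \<sigma>"
| "val e s = 0 \<Longrightarrow> steps w c2 (s, \<rho>) t \<sigma> \<Longrightarrow> steps w (Cond e c1 c2) (s, \<rho>) (1 + t) \<sigma>"
| "val e s = 0 \<Longrightarrow> steps w (While e c) (s, \<rho>) 1 (s, \<rho>)"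
| "val e s \<noteq> 0 \<Longrightarrow> steps w c (s, \<rho>) t1 \<sigma>1 \<Longrightarrow> steps w (While e c) \<sigma>1 t2 \<sigma>2
     \<Longrightarrow> steps w (While e c) (s, \<rho>) (1 + t1 + t2) \<sigma>2"

text \<open>A literal counts with its bit length, so that \<open>2 ^ (w * exp_size e)\<close> bounds
  the value of every expression over cells of at most \<open>w\<close> bits.\<close>

fun exp_size :: "exp \<Rightarrow> nat" where
  "exp_size (Lit i) = bit_len i"
| "exp_size (Cell a e) = 1 + exp_size e"
| "exp_size (Add e f) = 1 + exp_size e + exp_size f"
| "exp_size (Sub e f) = 1 + exp_size e + exp_size f"
| "exp_size (Mul e f) = 1 + exp_size e + exp_size f"
| "exp_size (Div e f) = 1 + exp_size e + exp_size f"
| "exp_size (Mod e f) = 1 + exp_size e + exp_size f"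
| "exp_size (Less e f) = 1 + exp_size e + exp_size f"
| "exp_size (Eq e f) = 1 + exp_size e + exp_size f"

fun com_size :: "com \<Rightarrow> nat" where
  "com_size Skip = 1"
| "com_size (Assign a e f) = exp_size e + exp_size f"
| "com_size (Read a e) = exp_size e"
| "com_size (Flip a e) = exp_size e"
| "com_size (Write e) = exp_size e"
| "com_size (Seq c d) = com_size c + com_size d"
| "com_size (Cond e c d) = exp_size e + com_size c + com_size d"
| "com_size (While e c) = exp_size e + com_size c"

lemma bit_len_le: "\<bar>x\<bar> \<le> 2 ^ a \<Longrightarrow> bit_len x \<le> a + 2"
proof -
  assume "\<bar>x\<bar> \<le> 2 ^ a"
  then have "nat \<bar>x\<bar> \<le> 2 ^ a" by (simp add: nat_le_iff)
  also have "\<dots> < 2 ^ Suc a" by simp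
  finally have "nat \<bar>x\<bar> < 2 ^ Suc a" .
  then have "floorlog 2 (nat \<bar>x\<bar>) \<le> Suc a" by (intro floorlog_leI) auto
  then show ?thesis by (simp add: bit_len_def)
qed

lemma abs_le_bit_len: "\<bar>x\<bar> \<le> 2 ^ bit_len x"
proof (cases "x = 0")
  case False
  then have "nat \<bar>x\<bar> < 2 ^ floorlog 2 (nat \<bar>x\<bar>)"
    using floorlog_bounds[of "nat \<bar>x\<bar>" 2] by simp
  then have "\<bar>x\<bar> < 2 ^ floorlog 2 (nat \<bar>x\<bar>)" by (simp add: nat_less_iff)
  also have "\<dots> \<le> 2 ^ bit_len x" unfolding bit_len_def by simp
  finally show ?thesis by simp
qed simp

text \<open>The strict inequality \<open>a + b < n\<close> pays for the factor 2 of a sum. It is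
  available because every operator adds 1 to \<open>exp_size\<close>.\<close>

lemma abs_add_le_exp:
  fixes x y :: int
  assumes "\<bar>x\<bar> \<le> 2 ^ a" "\<bar>y\<bar> \<le> 2 ^ b" "a + b < n"
  shows "\<bar>x\<bar> + \<bar>y\<bar> \<le> 2 ^ n"
proof -
  have "(2::int) ^ a \<le> 2 ^ (a + b)" "(2::int) ^ b \<le> 2 ^ (a + b)" by (intro power_increasing; simp)+
  then have "\<bar>x\<bar> + \<bar>y\<bar> \<le> 2 * 2 ^ (a + b)" using assms(1,2) by linarith
  then have "\<bar>x\<bar> + \<bar>y\<bar> \<le> 2 ^ Suc (a + b)" by simp
  also have "\<dots> \<le> 2 ^ n" using assms(3) by (intro power_increasing) auto
  finally show ?thesis .
qed

lemma abs_mult_le_exp: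
  fixes x y :: int
  assumes "\<bar>x\<bar> \<le> 2 ^ a" "\<bar>y\<bar> \<le> 2 ^ b" "a + b < n"
  shows "\<bar>x * y\<bar> \<le> 2 ^ n"
proof -
  have "\<bar>x * y\<bar> \<le> 2 ^ (a + b)" using assms by (simp add: abs_mult power_add mult_mono)
  also have "\<dots> \<le> 2 ^ n" using assms(3) by (intro power_increasing) auto
  finally show ?thesis .
qed

lemma abs_div_le: "\<bar>x div y\<bar> \<le> \<bar>x :: int\<bar>"
proof -
  have pos: "\<bar>x div y\<bar> \<le> \<bar>x\<bar>" if y: "y > 0" for x y :: int
  proof (cases "x \<ge> 0")
    case True
    then show ?thesis using y zdiv_mono2[of x 1 y] pos_imp_zdiv_nonneg_iff[of y x] by simp
  next
    case False
    then have "x div 1 \<le> x div y" using y by (intro zdiv_mono2_neg) auto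
    then show ?thesis using False y pos_imp_zdiv_neg_iff[of y x] by simp
  qed
  show ?thesis
  proof (cases y "0::int" rule: linorder_cases)
    case less
    have "x div y = (- x) div (- y)" by simp
    then show ?thesis using pos[of "- y" "- x"] less by simp
  qed (use pos in auto)
qed

lemma abs_val_le:
  assumes w: "w \<ge> 1" and s: "\<And>a i. \<bar>s a i\<bar> \<le> 2 ^ w"
  shows "\<bar>val e s\<bar> \<le> 2 ^ (w * exp_size e)"
proof -
  have add: "w * a + w * b < w * (1 + a + b)" for a b using w by (simp add: algebra_simps)
  show ?thesis
  proof (induction e)
    case (Lit i)
    have "(2::int) ^ bit_len i \<le> 2 ^ (w * bit_len i)" using w by (intro power_increasing) auto
    then show ?case using abs_le_bit_len[of i] by (simp only: val.simps exp_size.simps)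
  next
    case (Cell a e)
    have "(2::int) ^ w \<le> 2 ^ (w * (1 + exp_size e))" by (intro power_increasing) auto
    then show ?case unfolding val.simps exp_size.simps using order_trans[OF s] by blast
  next
    case (Add e f)
    then show ?case using abs_add_le_exp[OF Add add] by simp
  next
    case (Sub e f)
    then show ?case using abs_add_le_exp[OF Sub add] by simp
  next
    case (Mul e f)
    then show ?case using abs_mult_le_exp[OF Mul add] by simp
  next
    case (Div e f)
    then show ?case using abs_add_le_exp[OF Div add] abs_div_le[of "val e s" "val f s"] by simp
  next
    case (Mod e f)
    have "\<bar>val e s mod val f s\<bar> \<le> \<bar>val e s\<bar> + \<bar>val f s\<bar>"
      by (cases "val f s" "0::int" rule: linorder_cases) (smt (verit) pos_mod_bound pos_mod_sign neg_mod_bound neg_mod_sign mod_by_0)+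
    then show ?case using abs_add_le_exp[OF Mod add] by simp
  qed (use one_le_power[of "2::int"] in simp_all)
qed

text \<open>There are at most \<open>exp_size e\<close> subexpressions, and the value of each has at
  most \<open>w * exp_size e + 2\<close> bits.\<close>

lemma cost_le:
  assumes w: "w \<ge> 1" and s: "\<And>a i. \<bar>s a i\<bar> \<le> 2 ^ w"
  shows "cost e s \<le> exp_size e * (w * exp_size e + 2)"
proof -
  have bl: "bit_len (val e s) \<le> w * exp_size e + 2" for e
    using abs_val_le[OF assms] by (rule bit_len_le)
  have bin: "x + y + z \<le> (1 + a + b) * (w * (1 + a + b) + 2)"
    if "x \<le> a * (w * a + 2)" "y \<le> b * (w * b + 2)" "z \<le> w * (1 + a + b) + 2" for x y z a b
  proof -
    have "a * (w * a + 2) \<le> a * (w * (1 + a + b) + 2)" "b * (w * b + 2) \<le> b * (w * (1 + a + b) + 2)"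
      by (intro mult_le_mono order.refl add_le_mono1; simp)+
    then show ?thesis using that by (simp add: algebra_simps)
  qed
  show ?thesis
  proof (induction e)
    case (Lit i)
    have "bit_len i * 1 \<le> bit_len i * (w * bit_len i + 2)" by (intro mult_le_mono2) simp
    then show ?case by simp
  next
    case (Cell a e)
    then show ?case using bin[OF Cell, of 0 0 "bit_len (val (Cell a e) s)"] bl[of "Cell a e"] by simp
  next
    case (Add e f)
    show ?case using bin[OF Add bl[of "Add e f", simplified exp_size.simps]] by simp
  next
    case (Sub e f)
    show ?case using bin[OF Sub bl[of "Sub e f", simplified exp_size.simps]] by simp
  next
    case (Mul e f)
    show ?case using bin[OF Mul bl[of "Mul e f", simplified exp_size.simps]] by simp
  next
    case (Div e f)
    show ?case using bin[OF Div bl[of "Div e f", simplified exp_size.simps]] by simp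
  next
    case (Mod e f)
    show ?case using bin[OF Mod bl[of "Mod e f", simplified exp_size.simps]] by simp
  next
    case (Less e f)
    show ?case using bin[OF Less bl[of "Less e f", simplified exp_size.simps]] by simp
  next
    case (Eq e f)
    show ?case using bin[OF Eq bl[of "Eq e f", simplified exp_size.simps]] by simp
  qed
qed

text \<open>Bounds the logarithmic cost of one unit step: two expressions of size at most
  \<open>z\<close> for an assignment, \<open>w + 2\<close> bits for a number that is read, and 1 for
  the step itself.\<close>

definition unit_time :: "nat \<Rightarrow> nat \<Rightarrow> nat" where
  "unit_time w z = 2 * z * (w * z + 2) + w + 3"

lemma steps_imp_exec:
  assumes "steps w c \<sigma> n \<sigma>'" "w \<ge> 1" "\<And>a i. \<bar>fst \<sigma> a i\<bar> \<le> 2 ^ w" "com_size c \<le> z"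
  shows "\<exists>t \<le> n * unit_time w z. exec c \<sigma> t \<sigma>' \<and> (\<forall>a i. \<bar>fst \<sigma>' a i\<bar> \<le> 2 ^ w)"
proof -
  define P where "P = z * (w * z + 2)"
  have cost: "cost e s \<le> P" if "\<And>a i. \<bar>s a i\<bar> \<le> 2 ^ w" "exp_size e \<le> z" for e s
  proof -
    have "exp_size e * (w * exp_size e + 2) \<le> P" unfolding P_def
      using that(2) by (intro mult_le_mono add_le_mono) auto
    then show ?thesis using cost_le[OF assms(2), of s e] that(1) by fastforce
  qed
  have unit: "unit_time w z = P + P + w + 3"
    by (simp add: unit_time_def P_def)
  show ?thesis
    using assms(1,3,4)
  proof (induction rule: steps.induct)
    case (1 \<sigma>)
    then show ?case using exec.Skip[of \<sigma>] by (intro exI[of _ 1]) (auto simp: unit_time_def)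
  next
    case (2 f s a e xs r ys)
    then have "1 + cost e s + cost f s \<le> 1 * unit_time w z"
      using cost[of s e] cost[of s f] by (simp add: unit)
    then show ?case using 2 exec.Assign by (fastforce simp: update_def)
  next
    case (3 x a e s xs r ys)
    then have "1 + cost e s + bit_len x \<le> 1 * unit_time w z"
      using cost[of s e] bit_len_le[of x w] by (simp add: unit)
    then show ?case using 3 exec.Read by (fastforce simp: update_def)
  next
    case (4 a e s xs b r ys)
    then have "1 + cost e s \<le> 1 * unit_time w z"
      using cost[of s e] by (simp add: unit)
    moreover have "\<bar>of_bool b\<bar> \<le> (2::int) ^ w" by (cases b) simp_all
    then have "\<forall>a' i. \<bar>fst (update s a (val e s) (of_bool b), xs, r, ys) a' i\<bar> \<le> 2 ^ w"
      using 4 by (simp add: update_def)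
    ultimately show ?case using exec.Flip by blast
  next
    case (5 e s xs r ys)
    then have "1 + cost e s \<le> 1 * unit_time w z"
      using cost[of s e] by (simp add: unit)
    then show ?case using 5 exec.Write by fastforce
  next
    case (6 c1 \<sigma> t1 \<sigma>1 c2 t2 \<sigma>2)
    then obtain u1 u2 where u: "u1 \<le> t1 * unit_time w z" "exec c1 \<sigma> u1 \<sigma>1"
      "u2 \<le> t2 * unit_time w z" "exec c2 \<sigma>1 u2 \<sigma>2" "\<forall>a i. \<bar>fst \<sigma>2 a i\<bar> \<le> 2 ^ w"
      by fastforce
    have "1 \<le> unit_time w z" by (simp add: unit_time_def)
    then have "1 + u1 + u2 \<le> (1 + t1 + t2) * unit_time w z" using u by (simp add: algebra_simps)
    then show ?case using u exec.Seq by blast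
  next
    case (7 e s c1 \<rho> t \<sigma> c2)
    then obtain u where u: "u \<le> t * unit_time w z" "exec c1 (s, \<rho>) u \<sigma>" "\<forall>a i. \<bar>fst \<sigma> a i\<bar> \<le> 2 ^ w"
      by fastforce
    have "1 + cost e s \<le> unit_time w z" using cost[of s e] 7 by (simp add: unit)
    then have "1 + cost e s + u \<le> (1 + t) * unit_time w z" using u by (simp add: algebra_simps)
    then show ?case using u exec.CondTrue 7(1) by blast
  next
    case (8 e s c2 \<rho> t \<sigma> c1)
    then obtain u where u: "u \<le> t * unit_time w z" "exec c2 (s, \<rho>) u \<sigma>" "\<forall>a i. \<bar>fst \<sigma> a i\<bar> \<le> 2 ^ w"
      by fastforce
    have "1 + cost e s \<le> unit_time w z" using cost[of s e] 8 by (simp add: unit)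
    then have "1 + cost e s + u \<le> (1 + t) * unit_time w z" using u by (simp add: algebra_simps)
    then show ?case using u exec.CondFalse 8(1) by blast
  next
    case (9 e s c \<rho>)
    then have "1 + cost e s \<le> 1 * unit_time w z" using cost[of s e] by (simp add: unit)
    then show ?case using 9(2) exec.WhileFalse[OF 9(1)] by blast
  next
    case (10 e s c \<rho> t1 \<sigma>1 t2 \<sigma>2)
    then obtain u1 u2 where u: "u1 \<le> t1 * unit_time w z" "exec c (s, \<rho>) u1 \<sigma>1"
      "u2 \<le> t2 * unit_time w z" "exec (While e c) \<sigma>1 u2 \<sigma>2" "\<forall>a i. \<bar>fst \<sigma>2 a i\<bar> \<le> 2 ^ w"
      by fastforce
    have "1 + cost e s \<le> unit_time w z" using cost[of s e] 10 by (simp add: unit)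
    then have "1 + cost e s + u1 + u2 \<le> (1 + t1 + t2) * unit_time w z" using u by (simp add: algebra_simps)
    then show ?case using u exec.WhileTrue 10(1) by blast
  qed
qed

text \<open>Total correctness with a time bound. The postcondition sees store, input, coins and
  output and may itself be a \<open>runs\<close> statement; nesting in this way chains
  programs.\<close>

definition runs :: "nat \<Rightarrow> com \<Rightarrow> store \<Rightarrow> int list \<Rightarrow> bool list \<Rightarrow> int list \<Rightarrow> nat
    \<Rightarrow> (store \<Rightarrow> int list \<Rightarrow> bool list \<Rightarrow> int list \<Rightarrow> bool) \<Rightarrow> bool" where
  "runs w c s xs r ys T Q \<longleftrightarrow>
     (\<exists>n \<le> T. \<exists>s' xs' r' ys'. steps w c (s, xs, r, ys) n (s', xs', r', ys') \<and> Q s' xs' r' ys')"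

lemma runs_mono:
  "runs w c s xs r ys T Q \<Longrightarrow> T \<le> T' \<Longrightarrow> (\<And>s' xs' r' ys'. Q s' xs' r' ys' \<Longrightarrow> Q' s' xs' r' ys')
    \<Longrightarrow> runs w c s xs r ys T' Q'"
  unfolding runs_def by (meson le_trans)

lemma runs_Assign:
  "\<bar>val f s\<bar> \<le> 2 ^ w \<Longrightarrow> Q (update s a (val e s) (val f s)) xs r ys \<Longrightarrow> 1 \<le> T
    \<Longrightarrow> runs w (Assign a e f) s xs r ys T Q"
  unfolding runs_def using steps.intros(2) by blast

lemma runs_Read:
  "\<bar>x\<bar> \<le> 2 ^ w \<Longrightarrow> Q (update s a (val e s) x) xs r ys \<Longrightarrow> 1 \<le> T
    \<Longrightarrow> runs w (Read a e) s (x # xs) r ys T Q"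
  unfolding runs_def using steps.intros(3) by blast

lemma runs_Flip:
  "Q (update s a (val e s) (of_bool b)) xs r ys \<Longrightarrow> 1 \<le> T \<Longrightarrow> runs w (Flip a e) s xs (b # r) ys T Q"
  unfolding runs_def using steps.intros(4) by blast

lemma runs_Write:
  "Q s xs r (ys @ [val e s]) \<Longrightarrow> 1 \<le> T \<Longrightarrow> runs w (Write e) s xs r ys T Q"
  unfolding runs_def using steps.intros(5) by blast

lemma runs_Seq:
  assumes "runs w c1 s xs r ys T1 (\<lambda>s' xs' r' ys'. runs w c2 s' xs' r' ys' T2 Q)" "1 + T1 + T2 \<le> T"
  shows "runs w (Seq c1 c2) s xs r ys T Q"
proof -
  obtain n1 s1 xs1 r1 ys1 where 1: "n1 \<le> T1" "steps w c1 (s, xs, r, ys) n1 (s1, xs1, r1, ys1)"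
    "runs w c2 s1 xs1 r1 ys1 T2 Q" using assms(1) unfolding runs_def by blast
  then obtain n2 s2 xs2 r2 ys2 where 2: "n2 \<le> T2" "steps w c2 (s1, xs1, r1, ys1) n2 (s2, xs2, r2, ys2)"
    "Q s2 xs2 r2 ys2" unfolding runs_def by blast
  have "1 + n1 + n2 \<le> T" using assms(2) 1(1) 2(1) by simp
  then show ?thesis unfolding runs_def using steps.intros(6)[OF 1(2) 2(2)] 2(3) by blast
qed

lemma runs_Cond:
  assumes "val e s \<noteq> 0 \<Longrightarrow> runs w c1 s xs r ys T1 Q" "val e s = 0 \<Longrightarrow> runs w c2 s xs r ys T1 Q"
    "1 + T1 \<le> T"
  shows "runs w (Cond e c1 c2) s xs r ys T Q"
proof (cases "val e s = 0")
  case True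
  then obtain n s' xs' r' ys' where 1: "n \<le> T1" "steps w c2 (s, xs, r, ys) n (s', xs', r', ys')"
    "Q s' xs' r' ys'" using assms(2) unfolding runs_def by blast
  have "1 + n \<le> T" using 1 assms(3) by simp
  then show ?thesis unfolding runs_def using steps.intros(8)[OF True 1(2)] 1(3) by blast
next
  case False
  then obtain n s' xs' r' ys' where 1: "n \<le> T1" "steps w c1 (s, xs, r, ys) n (s', xs', r', ys')"
    "Q s' xs' r' ys'" using assms(1) unfolding runs_def by blast
  have "1 + n \<le> T" using 1 assms(3) by simp
  then show ?thesis unfolding runs_def using steps.intros(7)[OF False 1(2)] 1(3) by blast
qed

lemma runs_While:
  assumes I: "I 0 s xs r ys"
    and step: "\<And>i s xs r ys. i < n \<Longrightarrow> I i s xs r ys \<Longrightarrow> val e s \<noteq> 0 \<and> runs w c s xs r ys k (I (Suc i))"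
    and fin: "\<And>s xs r ys. I n s xs r ys \<Longrightarrow> val e s = 0 \<and> Q s xs r ys"
    and T: "n * (k + 1) + 1 \<le> T"
  shows "runs w (While e c) s xs r ys T Q"
proof -
  have "runs w (While e c) s xs r ys ((n - i) * (k + 1) + 1) Q" if "i \<le> n" "I i s xs r ys" for i s xs r ys
    using that
  proof (induction "n - i" arbitrary: i s xs r ys)
    case 0
    then have "I n s xs r ys" by simp
    then have "val e s = 0" "Q s xs r ys" using fin by auto
    then show ?case unfolding runs_def using steps.intros(9) by fastforce
  next
    case (Suc j)
    then have "i < n" by simp
    from step[OF this Suc(4)] obtain n1 s1 xs1 r1 ys1 where 1: "val e s \<noteq> 0" "n1 \<le> k"
      "steps w c (s, xs, r, ys) n1 (s1, xs1, r1, ys1)" "I (Suc i) s1 xs1 r1 ys1" unfolding runs_def by blast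
    have "runs w (While e c) s1 xs1 r1 ys1 ((n - Suc i) * (k + 1) + 1) Q"
      using Suc.hyps 1(4) \<open>i < n\<close> by (intro Suc.hyps(1)) auto
    then obtain n2 s2 xs2 r2 ys2 where 2: "n2 \<le> (n - Suc i) * (k + 1) + 1"
      "steps w (While e c) (s1, xs1, r1, ys1) n2 (s2, xs2, r2, ys2)" "Q s2 xs2 r2 ys2"
      unfolding runs_def by blast
    have "n - i = Suc (n - Suc i)" using \<open>i < n\<close> by simp
    then have "1 + n1 + n2 \<le> (n - i) * (k + 1) + 1" using 1(2) 2(1) by simp
    then show ?case unfolding runs_def using steps.intros(10)[OF 1(1,3) 2(2)] 2(3) by blast
  qed
  from this[OF _ I] show ?thesis by (rule runs_mono) (use T in auto)
qed

section \<open>Scalar variables and counting loops\<close>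

abbreviation "Var v \<equiv> Cell v (Lit 0)"

definition Set_var :: "nat \<Rightarrow> exp \<Rightarrow> com" where
  "Set_var v e = Assign v (Lit 0) e"

definition For :: "nat \<Rightarrow> exp \<Rightarrow> com \<Rightarrow> com" where
  "For v b c = Seq (Set_var v (Lit 0)) (While (Less (Var v) b) (Seq c (Set_var v (Add (Var v) (Lit 1)))))"

lemma runs_Set_var:
  "\<bar>val f s\<bar> \<le> 2 ^ w \<Longrightarrow> Q (update s a 0 (val f s)) xs r ys \<Longrightarrow> 1 \<le> T
    \<Longrightarrow> runs w (Set_var a f) s xs r ys T Q"
  unfolding Set_var_def by (rule runs_Assign) auto

text \<open>The invariant for \<open>Suc i\<close> refers to the store after the increment, and the
  body must leave the counter at \<open>i\<close>. The bound is evaluated anew before each round,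
  hence has to keep its value \<open>n\<close> under the invariant. The 3 per round is one step each
  for the loop, the sequence and the increment.\<close>

lemma runs_For:
  assumes I0: "I 0 (update s v 0 0) xs r ys"
    and bound: "\<And>i s xs r ys. i \<le> n \<Longrightarrow> I i s xs r ys \<Longrightarrow> s v 0 = int i \<Longrightarrow> val b s = int n"
    and step: "\<And>i s xs r ys. i < n \<Longrightarrow> I i s xs r ys \<Longrightarrow> s v 0 = int i \<Longrightarrow>
        runs w c s xs r ys k (\<lambda>s' xs' r' ys'. s' v 0 = int i \<and> I (Suc i) (update s' v 0 (int (Suc i))) xs' r' ys')"
    and n: "int n \<le> 2 ^ w"
    and fin: "\<And>s xs r ys. I n s xs r ys \<Longrightarrow> s v 0 = int n \<Longrightarrow> Q s xs r ys"
    and T: "n * (k + 3) + 3 \<le> T"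
  shows "runs w (For v b c) s xs r ys T Q"
  unfolding For_def
proof (rule runs_Seq)
  show "runs w (Set_var v (Lit 0)) s xs r ys 1 (\<lambda>s' xs' r' ys'.
      runs w (While (Less (Var v) b) (Seq c (Set_var v (Add (Var v) (Lit 1))))) s' xs' r' ys' (n * (k + 3) + 1) Q)"
  proof (rule runs_Set_var)
    show "runs w (While (Less (Var v) b) (Seq c (Set_var v (Add (Var v) (Lit 1)))))
        (update s v 0 (val (Lit 0) s)) xs r ys (n * (k + 3) + 1) Q"
    proof (rule runs_While[where I = "\<lambda>i s xs r ys. I i s xs r ys \<and> s v 0 = int i" and n = n and k = "k + 2"])
      show "I 0 (update s v 0 (val (Lit 0) s)) xs r ys \<and> update s v 0 (val (Lit 0) s) v 0 = int 0"
        using I0 by (simp add: update_def)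
      fix i s xs r ys
      assume i: "i < n" and I: "I i s xs r ys \<and> s v 0 = int i"
      have "runs w (Seq c (Set_var v (Add (Var v) (Lit 1)))) s xs r ys (k + 2)
             (\<lambda>s xs r ys. I (Suc i) s xs r ys \<and> s v 0 = int (Suc i))"
      proof (rule runs_Seq[where ?T1.0 = k and ?T2.0 = 1])
        have "\<bar>int i + 1\<bar> \<le> 2 ^ w" using i n by linarith
        moreover have e: "int (Suc i) = int i + 1" by simp
        ultimately show "runs w c s xs r ys k (\<lambda>s' xs' r' ys'. runs w (Set_var v (Add (Var v) (Lit 1))) s' xs' r' ys' 1
            (\<lambda>s xs r ys. I (Suc i) s xs r ys \<and> s v 0 = int (Suc i)))"
          using I by (intro runs_mono[OF step[OF i]] runs_Set_var) (auto simp: update_def e simp del: of_nat_Suc)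
      qed simp
      then show "val (Less (Var v) b) s \<noteq> 0 \<and> runs w (Seq c (Set_var v (Add (Var v) (Lit 1)))) s xs r ys (k + 2)
             (\<lambda>s xs r ys. I (Suc i) s xs r ys \<and> s v 0 = int (Suc i))"
        using bound[of i s xs r ys] I i by simp
    next
      fix s xs r ys
      assume "I n s xs r ys \<and> s v 0 = int n"
      then show "val (Less (Var v) b) s = 0 \<and> Q s xs r ys" using bound[of n s xs r ys] fin by simp
    qed (simp add: algebra_simps)
  qed auto
  show "1 + 1 + (n * (k + 3) + 1) \<le> T" using T by simp
qed

section \<open>Random hashing\<close>

lemma card_le_fibres:
  assumes "finite B" "f ` A \<subseteq> B" "\<And>b. b \<in> B \<Longrightarrow> finite {a \<in> A. f a = b}"
    "\<And>b. b \<in> B \<Longrightarrow> card {a \<in> A. f a = b} \<le> c"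
  shows "card A \<le> c * card B"
proof -
  have "A = (\<Union>b\<in>B. {a \<in> A. f a = b})" using assms(2) by auto
  then have "card A \<le> (\<Sum>b\<in>B. card {a \<in> A. f a = b})"
    using card_UN_le[OF assms(1), of "\<lambda>b. {a \<in> A. f a = b}"] by simp
  also have "\<dots> \<le> (\<Sum>b\<in>B. c)" by (rule sum_mono) (rule assms(4))
  finally show ?thesis by (simp add: mult.commute)
qed

text \<open>For positive \<open>w\<close> the values \<open>x * w + b\<close> with
  \<open>x < Q\<close> lie in an interval of length \<open>Q * w\<close>, which contains
  \<open>w\<close> multiples of \<open>Q\<close>, and distinct \<open>x\<close> give distinct
  multiples. Nothing is assumed on common factors of \<open>w\<close> and \<open>Q\<close>.\<close>

lemma card_lin_cong_le:
  fixes w b :: int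
  assumes Q: "Q > 0" and w: "w \<noteq> 0"
  shows "card {x \<in> {..<Q}. int Q dvd int x * w + b} \<le> nat \<bar>w\<bar>"
proof -
  have pos: "card {x \<in> {..<Q}. int Q dvd int x * w + b} \<le> nat w" if w: "w > 0" for w b :: int
  proof -
    let ?S = "{x \<in> {..<Q}. int Q dvd int x * w + b}"
    \<comment> \<open>The quotient of \<open>b\<close> by \<open>Q\<close> rounded up, that is, the
      least \<open>t\<close> with \<open>b \<le> Q * t\<close>.\<close>
    define t0 where "t0 = - ((- b) div int Q)"
    have t0: "t0 \<le> t \<longleftrightarrow> b \<le> int Q * t" for t
    proof -
      define e where "e = (- b) div int Q"
      have e: "int Q * e \<le> - b" "- b < int Q * (e + 1)"
      proof -
        have "- b = int Q * e + (- b) mod int Q" unfolding e_def by (rule mult_div_mod_eq[symmetric])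
        moreover have "0 \<le> (- b) mod int Q" "(- b) mod int Q < int Q"
          using Q by (intro pos_mod_sign pos_mod_bound; simp)+
        ultimately show "int Q * e \<le> - b" "- b < int Q * (e + 1)" unfolding distrib_left by linarith+
      qed
      have "int Q * (- t) \<le> int Q * e" if "- t \<le> e" using that Q by (intro mult_left_mono) auto
      moreover have "int Q * (e + 1) \<le> int Q * (- t)" if "\<not> - t \<le> e" using that Q by (intro mult_left_mono) auto
      ultimately show ?thesis using e unfolding t0_def e_def[symmetric]
        by (cases "- t \<le> e") (auto simp: algebra_simps)
    qed
    have "inj_on (\<lambda>x. (int x * w + b) div int Q) ?S"
    proof (rule inj_onI, clarify)
      fix x y assume "int Q dvd int x * w + b" "int Q dvd int y * w + b"
        "(int x * w + b) div int Q = (int y * w + b) div int Q"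
      then have "int x * w + b = int y * w + b" by (metis dvd_mult_div_cancel)
      then show "x = y" using w by simp
    qed
    moreover have "(\<lambda>x. (int x * w + b) div int Q) ` ?S \<subseteq> {t0..<t0 + w}"
    proof clarsimp
      fix x assume x: "x < Q" and d: "int Q dvd int x * w + b"
      then obtain t where t: "int x * w + b = int Q * t" by (elim dvdE)
      have "b \<le> int Q * t" using w by (simp add: t[symmetric])
      moreover have "int x * w < int Q * w" using x w by simp
      then have "int Q * (t - w) < b" using t by (simp add: algebra_simps)
      ultimately show "t0 \<le> (int x * w + b) div int Q \<and> (int x * w + b) div int Q < t0 + w"
        using t0[of t] t0[of "t - w"] Q by (auto simp: t)
    qed
    ultimately have "card ?S \<le> card {t0..<t0 + w}" by (intro card_inj_on_le) auto
    then show ?thesis by simp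
  qed
  show ?thesis
  proof (cases "w > 0")
    case False
    have "int x * w + b = - (int x * (- w) + (- b))" for x by simp
    then have "int Q dvd int x * w + b \<longleftrightarrow> int Q dvd int x * (- w) + (- b)" for x
      by (metis dvd_minus_iff)
    then show ?thesis using pos[of "- w" "- b"] False w by simp
  qed (use pos in simp)
qed

lemma card_PiE_const: "finite S \<Longrightarrow> card (S \<rightarrow>\<^sub>E {..<Q::nat}) = Q ^ card S"
  by (simp add: card_PiE)

lemma sum_split_at:
  fixes f :: "nat \<Rightarrow> int"
  shows "i < V \<Longrightarrow> (\<Sum>k<V. f k) = f i + (\<Sum>k\<in>{..<V} - {i}. f k)"
  by (rule sum.remove) auto

definition hash :: "nat \<Rightarrow> (nat \<Rightarrow> int) \<Rightarrow> (nat \<Rightarrow> nat) \<Rightarrow> int" where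
  "hash V w a = (\<Sum>i<V. int (a i) * w i)"

text \<open>With all coefficients but the \<open>i\<close>-th fixed, the condition is a linear
  congruence for the remaining one.\<close>

lemma card_hash_zero_le:
  assumes Q: "Q > 0" and i: "i < V" "w i \<noteq> 0"
  shows "card {a \<in> {..<V} \<rightarrow>\<^sub>E {..<Q}. int Q dvd hash V w a} \<le> nat \<bar>w i\<bar> * Q ^ (V - 1)"
proof -
  let ?A = "{a \<in> {..<V} \<rightarrow>\<^sub>E {..<Q}. int Q dvd hash V w a}"
  let ?B = "({..<V} - {i}) \<rightarrow>\<^sub>E {..<Q}"
  let ?f = "\<lambda>a. restrict a ({..<V} - {i})"
  have fin: "finite ?A" by (simp add: finite_PiE)
  have "card ?A \<le> nat \<bar>w i\<bar> * card ?B"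
  proof (rule card_le_fibres[of _ ?f])
    show "finite ?B" by (simp add: finite_PiE)
    show "?f ` ?A \<subseteq> ?B" by (auto simp: PiE_def Pi_def)
    fix b assume "b \<in> ?B"
    show "finite {a \<in> ?A. ?f a = b}" by (rule finite_subset[OF _ fin]) auto
    define c where "c = (\<Sum>k\<in>{..<V} - {i}. int (b k) * w k)"
    have "card {a \<in> ?A. ?f a = b} \<le> card {x \<in> {..<Q}. int Q dvd int x * w i + c}"
    proof (rule card_inj_on_le)
      show "inj_on (\<lambda>a. a i) {a \<in> ?A. ?f a = b}"
      proof (rule inj_onI)
        fix a a' assume "a \<in> {a \<in> ?A. ?f a = b}" "a' \<in> {a \<in> ?A. ?f a = b}" "a i = a' i"
        then have "restrict a ({..<V} - {i}) = restrict a' ({..<V} - {i})" "a \<in> extensional {..<V}" "a' \<in> extensional {..<V}"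
          by (auto simp: PiE_def)
        then show "a = a'" using \<open>a i = a' i\<close>
          by (intro extensionalityI[of _ "{..<V}"]) (auto simp: restrict_def fun_eq_iff split: if_splits)
      qed
      show "(\<lambda>a. a i) ` {a \<in> ?A. ?f a = b} \<subseteq> {x \<in> {..<Q}. int Q dvd int x * w i + c}"
      proof clarify
        fix a assume a: "a \<in> {..<V} \<rightarrow>\<^sub>E {..<Q}" "int Q dvd hash V w a" "b = ?f a"
        have "c = (\<Sum>k\<in>{..<V} - {i}. int (a k) * w k)" unfolding c_def a(3) by (intro sum.cong) auto
        then have "hash V w a = int (a i) * w i + c" unfolding hash_def by (simp add: sum_split_at[OF i(1)])
        then show "a i \<in> {..<Q} \<and> int Q dvd int (a i) * w i + c" using a i by auto
      qed
    qed simp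
    also have "\<dots> \<le> nat \<bar>w i\<bar>" by (rule card_lin_cong_le[OF Q i(2)])
    finally show "card {a \<in> ?A. ?f a = b} \<le> nat \<bar>w i\<bar>" .
  qed
  also have "card ?B = Q ^ (V - 1)" using i(1) by (simp add: card_PiE_const)
  finally show ?thesis .
qed

text \<open>A coordinate equal to 1 lets its coefficient be solved for, whatever the others are.
  With the upper bound for the same coordinate the probability becomes exactly \<open>1 / Q\<close>;
  \<open>second_moment\<close> needs the mean as an equation.\<close>

lemma card_hash_zero_ge:
  assumes Q: "Q > 0" and j: "j < V" "w j = 1"
  shows "Q ^ (V - 1) \<le> card {a \<in> {..<V} \<rightarrow>\<^sub>E {..<Q}. int Q dvd hash V w a}"
proof -
  let ?A = "{a \<in> {..<V} \<rightarrow>\<^sub>E {..<Q}. int Q dvd hash V w a}"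
  let ?B = "({..<V} - {j}) \<rightarrow>\<^sub>E {..<Q}"
  define c where "c b = (\<Sum>k\<in>{..<V} - {j}. int (b k) * w k)" for b :: "nat \<Rightarrow> nat"
  let ?g = "\<lambda>b. b(j := nat ((- c b) mod int Q))"
  have "card ?B \<le> card ?A"
  proof (rule card_inj_on_le)
    show "inj_on ?g ?B"
    proof (rule inj_onI)
      fix b b' assume b: "b \<in> ?B" "b' \<in> ?B" "?g b = ?g b'"
      have "b k = b' k" for k
      proof (cases "k = j")
        case True
        then show ?thesis using b(1,2) by (auto simp: PiE_def extensional_def)
      next
        case False
        then show ?thesis using b(3) by (metis fun_upd_other)
      qed
      then show "b = b'" by auto
    qed
    show "?g ` ?B \<subseteq> ?A"
    proof (clarify, intro conjI)
      fix b assume b: "b \<in> ?B"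
      have "nat ((- c b) mod int Q) < Q" using Q by (simp add: nat_less_iff)
      then show "?g b \<in> {..<V} \<rightarrow>\<^sub>E {..<Q}" using b j by (auto simp: PiE_def extensional_def Pi_def)
      have "(\<Sum>k\<in>{..<V} - {j}. int (?g b k) * w k) = c b" unfolding c_def by (intro sum.cong) auto
      then have "hash V w (?g b) = (- c b) mod int Q + c b" unfolding hash_def
        using j Q by (simp add: sum_split_at[OF j(1)])
      then show "int Q dvd hash V w (?g b)"
        by (metis add.left_inverse dvd_0_right mod_0_imp_dvd mod_add_left_eq mod_0)
    qed
    show "finite ?A" by (simp add: finite_PiE)
  qed
  then show ?thesis using j(1) by (simp add: card_PiE_const)
qed

lemma dvd_diff_less_eq:
  assumes "int Q dvd int x - int y" "x < Q" "y < Q" shows "x = y"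
proof (rule ccontr)
  assume "x \<noteq> y"
  then have "int Q \<le> \<bar>int x - int y\<bar>" using assms(1) dvd_imp_le_int[of "int x - int y" "int Q"] by simp
  then show False using assms(2,3) by linarith
qed

text \<open>The two congruences are triangular with unit diagonal: the one for \<open>w'\<close>
  does not involve \<open>a i\<close> and determines \<open>a j\<close>, then the one for
  \<open>w\<close> determines \<open>a i\<close>.\<close>

lemma card_hash_pair_le:
  assumes Q: "Q > 0" and ij: "i < V" "j < V" "i \<noteq> j" and w: "w j = 1" "w' j = 1" "w i = 1" "w' i = 0"
  shows "card {a \<in> {..<V} \<rightarrow>\<^sub>E {..<Q}. int Q dvd hash V w a \<and> int Q dvd hash V w' a} \<le> Q ^ (V - 2)"
proof -
  let ?A = "{a \<in> {..<V} \<rightarrow>\<^sub>E {..<Q}. int Q dvd hash V w a \<and> int Q dvd hash V w' a}"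
  let ?S = "{..<V} - {j} - {i}"
  have "card ?A \<le> card (?S \<rightarrow>\<^sub>E {..<Q})"
  proof (rule card_inj_on_le)
    show "(\<lambda>a. restrict a ?S) ` ?A \<subseteq> (?S \<rightarrow>\<^sub>E {..<Q})" by (auto simp: PiE_def Pi_def)
    show "finite (?S \<rightarrow>\<^sub>E {..<Q})" by (simp add: finite_PiE)
    show "inj_on (\<lambda>a. restrict a ?S) ?A"
    proof (rule inj_onI)
      fix a a' assume A: "a \<in> ?A" "a' \<in> ?A" and R: "restrict a ?S = restrict a' ?S"
      have eq: "a k = a' k" if "k \<in> ?S" for k using fun_cong[OF R, of k] that by simp
      have split: "hash V u b = int (b j) * u j + (int (b i) * u i + (\<Sum>k\<in>?S. int (b k) * u k))" for u b
        unfolding hash_def using ij by (subst sum_split_at[of j], simp, subst sum.remove[of _ i]) auto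
      have "hash V w' a - hash V w' a' = int (a j) - int (a' j)" unfolding split using w eq by simp
      moreover have "int Q dvd hash V w' a - hash V w' a'" using A by auto
      ultimately have j: "a j = a' j" using A ij by (intro dvd_diff_less_eq[of Q]) (auto simp: PiE_def)
      have "hash V w a - hash V w a' = int (a i) - int (a' i)" unfolding split using w eq j by simp
      moreover have "int Q dvd hash V w a - hash V w a'" using A by auto
      ultimately have i: "a i = a' i" using A ij by (intro dvd_diff_less_eq[of Q]) (auto simp: PiE_def)
      have "a k = a' k" if "k \<in> {..<V}" for k using that i j eq by (cases "k \<in> ?S") auto
      then show "a = a'" using A by (intro extensionalityI[of _ "{..<V}"]) (auto simp: PiE_def)
    qed
  qed
  moreover have "card ?S = V - 2" using ij by (simp add: card_Diff_subset card_Diff_singleton)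
  ultimately show ?thesis using card_PiE_const[of ?S Q] by simp
qed

text \<open>Chebyshev's inequality in counting form. The number \<open>X\<close> of events that
  occur has mean \<mu> and, by pairwise independence, variance at most \<mu>. Where no event occurs,
  \<open>X\<close> deviates from its mean by \<mu>, so this happens in a proportion of at most
  \<open>1 / \<mu>\<close>.\<close>

lemma second_moment:
  fixes Q :: real
  assumes fin: "finite A" "finite Z" and Q: "Q > 0"
    and E: "\<And>z. z \<in> Z \<Longrightarrow> real (card {a \<in> A. E z a}) = card A / Q"
    and pair: "\<And>z z'. z \<in> Z \<Longrightarrow> z' \<in> Z \<Longrightarrow> z \<noteq> z' \<Longrightarrow> real (card {a \<in> A. E z a \<and> E z' a}) \<le> card A / Q\<^sup>2"
  shows "real (card {a \<in> A. \<forall>z\<in>Z. \<not> E z a}) * card Z \<le> card A * Q"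
proof (cases "Z = {}")
  case False
  then have Z0: "card Z > 0" using fin by auto
  define X where "X a = (\<Sum>z\<in>Z. of_bool (E z a) :: real)" for a
  define \<mu> where "\<mu> = card Z / Q"
  have count: "(\<Sum>a\<in>A. of_bool (P a) :: real) = card {a \<in> A. P a}" for P
    using fin by (simp add: Int_def)
  have s1: "(\<Sum>a\<in>A. X a) = \<mu> * card A"
    unfolding X_def by (subst sum.swap) (simp add: count E \<mu>_def)
  have "(\<Sum>a\<in>A. (X a)\<^sup>2) = (\<Sum>a\<in>A. \<Sum>z\<in>Z. \<Sum>z'\<in>Z. of_bool (E z a \<and> E z' a))"
    unfolding X_def power2_eq_square sum_product by (simp add: of_bool_conj)
  also have "\<dots> = (\<Sum>z\<in>Z. \<Sum>a\<in>A. \<Sum>z'\<in>Z. of_bool (E z a \<and> E z' a))" by (rule sum.swap)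
  also have "\<dots> = (\<Sum>z\<in>Z. \<Sum>z'\<in>Z. real (card {a \<in> A. E z a \<and> E z' a}))"
    by (intro sum.cong refl, subst sum.swap) (simp only: count)
  \<comment> \<open>Off the diagonal the bound for pairs applies; on it the square of an indicator
    is the indicator.\<close>
  also have "\<dots> \<le> (\<Sum>z\<in>Z. \<Sum>z'\<in>Z. card A / Q\<^sup>2 + (if z' = z then card A / Q else 0))"
  proof (intro sum_mono)
    fix z z' assume "z \<in> Z" "z' \<in> Z"
    then show "real (card {a \<in> A. E z a \<and> E z' a}) \<le> card A / Q\<^sup>2 + (if z' = z then card A / Q else 0)"
      using pair[of z z'] E[of z] by auto
  qed
  also have "\<dots> = \<mu>\<^sup>2 * card A + \<mu> * card A"
    using fin by (simp add: sum.distrib \<mu>_def power2_eq_square field_simps)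
  finally have s2: "(\<Sum>a\<in>A. (X a)\<^sup>2) \<le> \<mu>\<^sup>2 * card A + \<mu> * card A" .
  let ?F = "{a \<in> A. \<forall>z\<in>Z. \<not> E z a}"
  have "card ?F * \<mu>\<^sup>2 = (\<Sum>a\<in>?F. (X a - \<mu>)\<^sup>2)"
    by (simp add: X_def)
  also have "\<dots> \<le> (\<Sum>a\<in>A. (X a - \<mu>)\<^sup>2)" using fin by (intro sum_mono2) auto
  also have "\<dots> = (\<Sum>a\<in>A. (X a)\<^sup>2) - 2 * \<mu> * (\<Sum>a\<in>A. X a) + \<mu>\<^sup>2 * card A"
    by (simp add: power2_diff sum.distrib sum_subtractf sum_distrib_left sum_distrib_right mult_ac)
  also have "\<dots> \<le> \<mu> * card A" using s2 unfolding s1 by (simp add: power2_eq_square)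
  finally have "card ?F * \<mu> * \<mu> \<le> card A * \<mu>" by (simp add: power2_eq_square mult_ac)
  moreover have "\<mu> > 0" using Z0 Q by (simp add: \<mu>_def)
  ultimately have "card ?F * \<mu> \<le> card A" by simp
  then show ?thesis using Q by (simp add: \<mu>_def field_simps)
qed (use Q in simp)

text \<open>A sparse vector can be decoded from a list of exactly \<open>q\<close> pairs of a
  position and a value.\<close>

lemma card_sparse_le:
  assumes "V > 0"
  shows "card {w \<in> {..<V} \<rightarrow>\<^sub>E {-int R..int R}. card {i \<in> {..<V}. w i \<noteq> 0} \<le> q} \<le> (V * (2 * R + 1)) ^ q"
proof -
  let ?W = "{w \<in> {..<V} \<rightarrow>\<^sub>E {-int R..int R}. card {i \<in> {..<V}. w i \<noteq> 0} \<le> q}"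
  let ?C = "{..<V} \<times> {-int R..int R}"
  let ?L = "{xs. set xs \<subseteq> ?C \<and> length xs = q}"
  let ?d = "\<lambda>xs. \<lambda>i\<in>{..<V}. case map_of xs i of None \<Rightarrow> 0 | Some v \<Rightarrow> v"
  have "?W \<subseteq> ?d ` ?L"
  proof
    fix w assume w: "w \<in> ?W"
    let ?S = "{i \<in> {..<V}. w i \<noteq> 0}"
    obtain us where us: "set us = ?S" "distinct us" using finite_distinct_list[of ?S] by auto
    \<comment> \<open>Padding with position 0 brings the list to length \<open>q\<close>. Every
      listed position comes with its true value in \<open>w\<close>, so the decoded vector is
      unchanged.\<close>
    define js where "js = us @ replicate (q - length us) 0"
    have len: "length js = q" using w us distinct_card[OF us(2)] by (simp add: js_def)
    have "set us \<subseteq> set js" "set js \<subseteq> insert 0 (set us)" by (auto simp: js_def)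
    then have sub: "set js \<subseteq> {..<V}" and sup: "?S \<subseteq> set js" unfolding us(1) using assms by auto
    let ?xs = "map (\<lambda>i. (i, w i)) js"
    have L: "?xs \<in> ?L" using w sub len by (auto simp: PiE_def)
    have D: "?d ?xs = w"
    proof (rule extensionalityI[of _ "{..<V}"])
      fix i assume "i \<in> {..<V}"
      then show "?d ?xs i = w i" using sup by (auto simp: map_of_map_restrict restrict_map_def)
    qed (use w in \<open>auto simp: PiE_def\<close>)
    show "w \<in> ?d ` ?L"
      by (rule image_eqI[where x = ?xs]) (rule D[symmetric], rule L)
  qed
  moreover have "finite ?L" by (simp add: finite_lists_length_eq)
  ultimately have "card ?W \<le> card ?L" by (meson card_image_le card_mono finite_imageI le_trans)
  also have "\<dots> = card ?C ^ q" by (simp add: card_lists_length_eq)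
  also have "nat (2 * int R + 1) = 2 * R + 1" by linarith
  then have "card ?C = V * (2 * R + 1)" by (simp add: card_cartesian_product)
  finally show ?thesis .
qed

text \<open>The birthday bound: one of at most \<open>r * r\<close> pairs collides, and a collision
  leaves \<open>r - 1\<close> values free.\<close>

lemma card_not_inj_le:
  "card {f \<in> {..<r} \<rightarrow>\<^sub>E {..<N::nat}. \<not> inj_on f {..<r}} \<le> r * r * N ^ (r - 1)"
proof -
  let ?F = "{..<r} \<rightarrow>\<^sub>E {..<N}"
  have fin: "finite ?F" by (simp add: finite_PiE)
  have one: "card {f \<in> ?F. f i = f j} \<le> N ^ (r - 1)" if "i < r" "j < r" "i \<noteq> j" for i j
  proof -
    have "card {f \<in> ?F. f i = f j} \<le> card (({..<r} - {i}) \<rightarrow>\<^sub>E {..<N})"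
    proof (rule card_inj_on_le)
      show "inj_on (\<lambda>f. restrict f ({..<r} - {i})) {f \<in> ?F. f i = f j}"
      proof (rule inj_onI)
        fix f g assume fg: "f \<in> {f \<in> ?F. f i = f j}" "g \<in> {f \<in> ?F. f i = f j}"
          and R: "restrict f ({..<r} - {i}) = restrict g ({..<r} - {i})"
        have eq: "f k = g k" if "k \<in> {..<r} - {i}" for k using fun_cong[OF R, of k] that by simp
        have "f k = g k" if "k \<in> {..<r}" for k
          using that eq[of k] eq[of j] fg \<open>j < r\<close> \<open>i \<noteq> j\<close> by (cases "k = i") auto
        then show "f = g" using fg by (intro extensionalityI[of _ "{..<r}"]) (auto simp: PiE_def)
      qed
      show "(\<lambda>f. restrict f ({..<r} - {i})) ` {f \<in> ?F. f i = f j} \<subseteq> (({..<r} - {i}) \<rightarrow>\<^sub>E {..<N})"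
        by (auto simp: PiE_def Pi_def)
      show "finite (({..<r} - {i}) \<rightarrow>\<^sub>E {..<N})" by (simp add: finite_PiE)
    qed
    then show ?thesis using that by (simp add: card_PiE_const)
  qed
  let ?P = "{(i, j). i < r \<and> j < r \<and> i \<noteq> j}"
  have finP: "finite ?P" by (rule finite_subset[of _ "{..<r} \<times> {..<r}"]) auto
  have cP: "card ?P \<le> r * r"
    using card_mono[of "{..<r} \<times> {..<r}" ?P] by (auto simp: card_cartesian_product)
  have "{f \<in> ?F. \<not> inj_on f {..<r}} \<subseteq> (\<Union>p\<in>?P. {f \<in> ?F. f (fst p) = f (snd p)})"
    unfolding inj_on_def by fastforce
  then have "card {f \<in> ?F. \<not> inj_on f {..<r}} \<le> card (\<Union>p\<in>?P. {f \<in> ?F. f (fst p) = f (snd p)})"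
    using fin finP by (intro card_mono) auto
  also have "\<dots> \<le> (\<Sum>p\<in>?P. card {f \<in> ?F. f (fst p) = f (snd p)})" using finP by (rule card_UN_le)
  also have "\<dots> \<le> (\<Sum>p\<in>?P. N ^ (r - 1))" by (rule sum_mono) (use one in auto)
  also have "\<dots> \<le> r * r * N ^ (r - 1)" using cP by simp
  finally show ?thesis .
qed

text \<open>A random word rarely falls into a small class: there are at most \<open>M\<close> values
  of \<sigma>, a small class has at most \<open>b\<close> words, and at most \<open>r ^ r\<close>
  maps have a given word as image.\<close>

lemma card_small_class_le:
  fixes \<sigma> :: "nat set \<Rightarrow> 'b"
  assumes M: "finite (\<sigma> ` {z. z \<subseteq> {..<N} \<and> card z = r})" "card (\<sigma> ` {z. z \<subseteq> {..<N} \<and> card z = r}) \<le> M"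
  shows "card {f \<in> {..<r} \<rightarrow>\<^sub>E {..<N}. inj_on f {..<r}
      \<and> card {z. z \<subseteq> {..<N} \<and> card z = r \<and> \<sigma> z = \<sigma> (f ` {..<r})} \<le> b} \<le> M * (b * r ^ r)"
proof -
  let ?A = "{f \<in> {..<r} \<rightarrow>\<^sub>E {..<N}. inj_on f {..<r}
      \<and> card {z. z \<subseteq> {..<N} \<and> card z = r \<and> \<sigma> z = \<sigma> (f ` {..<r})} \<le> b}"
  let ?D = "{z. z \<subseteq> {..<N} \<and> card z = r}"
  let ?Z = "\<lambda>s. {z. z \<subseteq> {..<N} \<and> card z = r \<and> \<sigma> z = s}"
  let ?S = "{s \<in> \<sigma> ` ?D. card (?Z s) \<le> b}"
  have finZ: "finite (?Z s)" for s by (rule finite_subset[of _ "Pow {..<N}"]) auto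
  have finz: "finite z" if "z \<in> ?Z s" for z s using that by (auto intro: finite_subset)
  have finS: "finite ?S" using M(1) by simp
  have "?A \<subseteq> (\<Union>s\<in>?S. \<Union>z\<in>?Z s. {..<r} \<rightarrow>\<^sub>E z)"
  proof
    fix f assume f: "f \<in> ?A"
    let ?z = "f ` {..<r}"
    have "?z \<subseteq> {..<N}" "card ?z = r" using f by (auto simp: PiE_def card_image)
    moreover have "f \<in> {..<r} \<rightarrow>\<^sub>E ?z" using f by (auto simp: PiE_def)
    ultimately show "f \<in> (\<Union>s\<in>?S. \<Union>z\<in>?Z s. {..<r} \<rightarrow>\<^sub>E z)" using f
      by (intro UN_I[of "\<sigma> ?z"] UN_I[of ?z]) auto
  qed
  moreover have "finite (\<Union>s\<in>?S. \<Union>z\<in>?Z s. {..<r} \<rightarrow>\<^sub>E z)"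
    by (rule finite_UN_I[OF finS], rule finite_UN_I[OF finZ], rule finite_PiE) (simp, rule finz)
  ultimately have "card ?A \<le> card (\<Union>s\<in>?S. \<Union>z\<in>?Z s. {..<r} \<rightarrow>\<^sub>E z)" by (intro card_mono)
  also have "\<dots> \<le> (\<Sum>s\<in>?S. card (\<Union>z\<in>?Z s. {..<r} \<rightarrow>\<^sub>E z))" using finS by (rule card_UN_le)
  also have "\<dots> \<le> (\<Sum>s\<in>?S. b * r ^ r)"
  proof (rule sum_mono)
    fix s assume s: "s \<in> ?S"
    have "card (\<Union>z\<in>?Z s. {..<r} \<rightarrow>\<^sub>E z) \<le> (\<Sum>z\<in>?Z s. card ({..<r} \<rightarrow>\<^sub>E z))"
      by (rule card_UN_le[OF finZ])
    also have "\<dots> = card (?Z s) * r ^ r" by (simp add: card_PiE)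
    also have "\<dots> \<le> b * r ^ r" using s by simp
    finally show "card (\<Union>z\<in>?Z s. {..<r} \<rightarrow>\<^sub>E z) \<le> b * r ^ r" .
  qed
  also have "\<dots> = card ?S * (b * r ^ r)" by simp
  also have "card ?S \<le> M" using M card_mono[OF M(1), of ?S] by auto
  finally show ?thesis by (simp add: mult_le_mono1)
qed

section \<open>Uniform numbers from coin flips\<close>

definition bits_nat :: "bool list \<Rightarrow> nat" where
  "bits_nat bs = foldl (\<lambda>x b. 2 * x + of_bool b) 0 bs"

lemma bits_nat_Nil [simp]: "bits_nat [] = 0"
  by (simp add: bits_nat_def)

lemma bits_nat_snoc [simp]: "bits_nat (bs @ [b]) = 2 * bits_nat bs + of_bool b"
  by (simp add: bits_nat_def)

lemma bits_nat_less: "bits_nat bs < 2 ^ length bs"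
  by (induction bs rule: rev_induct) auto

lemma bits_nat_inj: "length bs = length cs \<Longrightarrow> bits_nat bs = bits_nat cs \<Longrightarrow> bs = cs"
proof (induction bs arbitrary: cs rule: rev_induct)
  case (snoc b bs)
  then obtain c cs' where cs: "cs = cs' @ [c]" by (metis length_0_conv rev_exhaust snoc_eq_iff_butlast)
  have "2 * bits_nat bs + of_bool b = 2 * bits_nat cs' + (of_bool c :: nat)" using snoc.prems cs by simp
  moreover from arg_cong[OF this, of odd] have "b = c" by simp
  ultimately have "b = c" "bits_nat bs = bits_nat cs'" by simp_all
  then show ?case using snoc cs by simp
qed simp

definition draw :: "nat \<Rightarrow> nat \<Rightarrow> bool list \<Rightarrow> nat \<Rightarrow> nat" where
  "draw n b r = (\<lambda>j\<in>{..<n}. bits_nat (take b (drop (j * b) r)))"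

lemma draw_PiE: "draw n b r \<in> {..<n} \<rightarrow>\<^sub>E {..<2 ^ b}"
proof -
  have "bits_nat (take b xs) < 2 ^ b" for xs
    by (rule less_le_trans[OF bits_nat_less]) (simp add: power_increasing)
  then show ?thesis by (simp add: draw_def)
qed

text \<open>The drawn numbers and the unread flips determine the coin sequence. This is the counting
  form of uniform and independent draws.\<close>

lemma draw_inj:
  assumes "length r = length r'" "n * b \<le> length r" "draw n b r = draw n b r'" "drop (n * b) r = drop (n * b) r'"
  shows "r = r'"
proof -
  have "drop (j * b) r = drop (j * b) r'" if "j \<le> n" for j
    using that
  proof (induction "n - j" arbitrary: j)
    case 0
    then show ?case using assms(4) by simp
  next
    case (Suc i)
    then have j: "j < n" by simp
    then have "Suc j * b \<le> n * b" by (intro mult_le_mono1) simp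
    then have len: "b + j * b \<le> length r" using assms(2) by simp
    have "bits_nat (take b (drop (j * b) r)) = bits_nat (take b (drop (j * b) r'))"
      using fun_cong[OF assms(3), of j] j by (simp add: draw_def)
    then have "take b (drop (j * b) r) = take b (drop (j * b) r')"
      using len assms(1) by (intro bits_nat_inj) auto
    moreover have "drop b (drop (j * b) r) = drop b (drop (j * b) r')"
      using Suc.hyps(1)[of "Suc j"] Suc.hyps(2) j by (simp add: add.commute)
    ultimately show ?case by (metis append_take_drop_id)
  qed
  from this[of 0] show ?thesis by simp
qed

lemma card_coins: "card (coins T) = 2 ^ T" and finite_coins: "finite (coins T)"
proof -
  have "coins T = {xs. set xs \<subseteq> (UNIV :: bool set) \<and> length xs = T}" by (auto simp: coins_def)
  then show "card (coins T) = 2 ^ T" "finite (coins T)"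
    by (simp_all only: card_lists_length_eq finite_lists_length_eq finite) simp_all
qed

lemma card_coins_draw_le:
  assumes T: "n * b + n' * b' \<le> T"
  defines "D \<equiv> ({..<n} \<rightarrow>\<^sub>E {..<2 ^ b}) \<times> ({..<n'} \<rightarrow>\<^sub>E {..<(2::nat) ^ b'})"
  shows "card {r \<in> coins T. P (draw n b r, draw n' b' (drop (n * b) r))} \<le> card {x \<in> D. P x} * 2 ^ (T - (n * b + n' * b'))"
proof -
  let ?L = "n * b + n' * b'"
  let ?f = "\<lambda>r. ((draw n b r, draw n' b' (drop (n * b) r)), drop ?L r)"
  have "card {r \<in> coins T. P (draw n b r, draw n' b' (drop (n * b) r))} \<le> card ({x \<in> D. P x} \<times> coins (T - ?L))"
  proof (rule card_inj_on_le)
    show "inj_on ?f {r \<in> coins T. P (draw n b r, draw n' b' (drop (n * b) r))}"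
    proof (rule inj_onI)
      fix r r' assume "r \<in> {r \<in> coins T. P (draw n b r, draw n' b' (drop (n * b) r))}"
        "r' \<in> {r \<in> coins T. P (draw n b r, draw n' b' (drop (n * b) r))}" "?f r = ?f r'"
      then have *: "length r = T" "length r' = T" "draw n b r = draw n b r'"
        "draw n' b' (drop (n * b) r) = draw n' b' (drop (n * b) r')" "drop ?L r = drop ?L r'"
        by (simp_all add: coins_def)
      have "drop (n * b) r = drop (n * b) r'"
        by (rule draw_inj[OF _ _ *(4)]) (use * T in \<open>auto simp: add.commute\<close>)
      then show "r = r'" by (rule draw_inj[rotated 3]) (use * T in auto)
    qed
    show "?f ` {r \<in> coins T. P (draw n b r, draw n' b' (drop (n * b) r))} \<subseteq> {x \<in> D. P x} \<times> coins (T - ?L)"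
      unfolding D_def using draw_PiE by (auto simp: coins_def simp del: PiE_iff)
    show "finite ({x \<in> D. P x} \<times> coins (T - ?L))"
      unfolding D_def by (simp add: finite_PiE finite_coins)
  qed
  then show ?thesis by (simp add: card_cartesian_product card_coins)
qed

lemma prob_coins_ge:
  assumes T: "n * b + n' * b' \<le> T"
    and good: "\<And>r. length r = T \<Longrightarrow> \<not> Bad (draw n b r) (draw n' b' (drop (n * b) r)) \<Longrightarrow> r \<in> G"
    and bad: "10 * card {x \<in> ({..<n} \<rightarrow>\<^sub>E {..<2 ^ b}) \<times> ({..<n'} \<rightarrow>\<^sub>E {..<(2::nat) ^ b'}). Bad (fst x) (snd x)}
        \<le> (2 ^ b) ^ n * (2 ^ b') ^ n'"
  shows "measure_pmf.prob (pmf_of_set (coins T)) G \<ge> 0.9"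
proof -
  let ?B = "{r \<in> coins T. Bad (draw n b r) (draw n' b' (drop (n * b) r))}"
  have ne: "coins T \<noteq> {}" using card_coins[of T] by fastforce
  have "10 * card ?B \<le> 10 * (card {x \<in> ({..<n} \<rightarrow>\<^sub>E {..<2 ^ b}) \<times> ({..<n'} \<rightarrow>\<^sub>E {..<(2::nat) ^ b'}). Bad (fst x) (snd x)} * 2 ^ (T - (n * b + n' * b')))"
    using card_coins_draw_le[OF T, of "\<lambda>x. Bad (fst x) (snd x)"] by simp
  also have "\<dots> \<le> (2 ^ b) ^ n * (2 ^ b') ^ n' * 2 ^ (T - (n * b + n' * b'))"
    using mult_le_mono1[OF bad, of "2 ^ (T - (n * b + n' * b'))"] by (simp add: mult.assoc)
  also have "\<dots> = 2 ^ (n * b + n' * b' + (T - (n * b + n' * b')))"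
    by (simp only: power_add power_mult[symmetric] mult.commute[of b] mult.commute[of b'])
  also have "\<dots> = 2 ^ T" using T by simp
  finally have B: "10 * card ?B \<le> 2 ^ T" .
  have "coins T - ?B \<subseteq> coins T \<inter> G" using good by (auto simp: coins_def)
  then have "card (coins T) - card ?B \<le> card (coins T \<inter> G)"
    using finite_coins[of T] by (metis (no_types, lifting) card_mono diff_card_le_card_Diff finite_Int finite_subset mem_Collect_eq subsetI le_trans)
  then have "10 * 2 ^ T \<le> 10 * card (coins T \<inter> G) + 2 ^ T" using B unfolding card_coins by linarith
  then have "9 * real (2 ^ T) \<le> 10 * real (card (coins T \<inter> G))" by linarith
  then show ?thesis
    unfolding measure_pmf_of_set[OF ne finite_coins] card_coins by (simp add: field_simps)
qed

notation vec_index (infixl "$v" 100)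

section \<open>The lattice\<close>

lemma of_int_bit: "(of_int z :: bit) = of_bool (odd z)"
proof (cases "even z")
  case True
  then obtain k where "z = 2 * k" ..
  then show ?thesis by simp
next
  case False
  then obtain k where "z = 2 * k + 1" by (auto elim: oddE)
  then show ?thesis by (simp del: add_bit_eq_xor)
qed

lemma bit_eq_of_bool: "x = of_bool (x = (1 :: bit))"
  by (cases x) auto

lemma sum_lessThan_add: "(\<Sum>j<A + B. f j) = (\<Sum>j<A. f j) + (\<Sum>j<B. f (A + j :: nat) :: 'a :: comm_monoid_add)"
  by (induction B) (auto simp: add.assoc)

lemma nim_pow_less: "nim_nat x < 2 ^ 2 ^ v \<Longrightarrow> nim_nat (x ^ e) < 2 ^ 2 ^ v"
proof (induction e)
  case 0
  show ?case using one_less_power[of "2::nat" "2 ^ v"] by (simp add: one_nim_def)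
next
  case (Suc e)
  interpret binary_field "2 ^ v" "nim_mul v" "2 ^ 2 ^ v div 2" by (rule binary_field_nim_mul)
  have "x * x ^ e = Nim (nim_mul v (nim_nat x) (nim_nat (x ^ e)))"
    using Suc by (intro nim_times_level) auto
  then show ?case using Suc closed by simp
qed

lemma nim_sum_less: "(\<And>a. a \<in> S \<Longrightarrow> nim_nat (f a) < 2 ^ v) \<Longrightarrow> nim_nat (\<Sum>a\<in>S. f a) < 2 ^ v"
proof (induction S rule: infinite_finite_induct)
  case (insert a S)
  then show ?case by (simp add: plus_nim_def xor_less_exp)
qed (auto simp: zero_nim_def)

lemma nim_eq_0I:
  assumes "nim_nat x < 2 ^ v" "\<And>b. b < v \<Longrightarrow> \<not> bit (nim_nat x) b"
  shows "x = 0"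
proof -
  have "nim_nat x = 0"
  proof (rule bit_eqI)
    fix b
    show "bit (nim_nat x) b \<longleftrightarrow> bit (0 :: nat) b"
    proof (cases "b < v")
      case False
      then have "nim_nat x < 2 ^ b" using assms(1) by (meson less_le_trans not_less one_le_numeral power_increasing)
      then show ?thesis by (simp add: bit_iff_odd)
    qed (use assms(2) in simp)
  qed
  then show ?thesis by (metis nim.collapse zero_nim_def)
qed

text \<open>
  The columns of the basis are those of \<open>G\<close>, then \<open>t\<close> (column \<open>n\<close>), the \<open>m\<close> unit vectors of the code part times 4, the
  \<open>N\<close> positions of the code and one column per check for its modulus. The rows are the \<open>m\<close> rows of \<open>2 G\<close>,
  the positions of the code, the multiplier of \<open>t\<close> and the checks: \<open>d div 2 * l\<close> parity checks
  modulo 2 and the hash condition modulo \<open>Q\<close>. Each check is repeated \<open>d\<close> times, so that a lattice vector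
  violating it has at least \<open>d\<close> nonzero entries.
\<close>

locale reduction =
  fixes m n N l d r Q :: nat and g :: "nat \<Rightarrow> nat \<Rightarrow> int" and f a :: "nat \<Rightarrow> nat"
begin

text \<open>\<open>V\<close> counts the rows before the checks, \<open>C1\<close> the columns before
  those of the moduli, and \<open>NC\<close> the checks; \<open>M\<close> and \<open>C\<close> are
  the numbers of rows and columns.\<close>

definition "V = m + N + 1"
definition "C1 = n + 1 + m + N"
definition "NC = d div 2 * l + 1"
definition "M = V + NC * d"
definition "C = C1 + NC"

text \<open>The exponents are 0, 1, 3, 5 and so on: for the first block of checks, truncated subtraction gives
  the exponent 0 and thus the overall parity.\<close>

definition parity_bit :: "nat \<Rightarrow> nat \<Rightarrow> int" where
  "parity_bit c i = int (nim_nat (Nim i ^ (2 * (c div l) - 1)) div 2 ^ (c mod l) mod 2)"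

text \<open>The columns with entry 4 allow twice the lift of \<open>G x + j t\<close> to be replaced
  by twice any integer vector of the same parity. The cheapest choice has entries 0 and 2, so each
  disagreement costs \<open>2 powr p\<close>; an entry whose half is odd can never be
  cancelled.\<close>

definition prim :: "nat \<Rightarrow> nat \<Rightarrow> int" where
  "prim i j = (if i < m + N then (if j = n + 1 + i then (if i < m then 4 else 1)
     else if j \<le> n \<and> i < m then 2 * g i j else 0) else of_bool (j = n))"

text \<open>Placed in the column of \<open>t\<close>, so that odd multipliers demand a word in the
  coset of the random word and even multipliers a codeword. The columns of the moduli take care of
  reduction modulo 2.\<close>

definition syndrome :: "nat \<Rightarrow> int" where
  "syndrome c = (\<Sum>j<r. parity_bit c (f j))"

text \<open>The hash of a column of the first \<open>V\<close> rows. By linearity this row then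
  produces the hash of the first \<open>V\<close> entries of the lattice vector.\<close>

definition hash_col :: "nat \<Rightarrow> int" where
  "hash_col j = (\<Sum>i<V. int (a i) * prim i j)"

definition check :: "nat \<Rightarrow> nat \<Rightarrow> int" where
  "check c j = (if c < d div 2 * l then (if j = n then syndrome c
     else if n + 1 + m \<le> j then parity_bit c (j - (n + 1 + m)) else 0) else hash_col j)"

definition modulus :: "nat \<Rightarrow> int" where
  "modulus c = (if c < d div 2 * l then 2 else int Q)"

definition entry :: "nat \<Rightarrow> nat \<Rightarrow> int" where
  "entry i j = (if i < V then (if j < C1 then prim i j else 0)
     else if j < C1 then check ((i - V) div d) j
     else if j = C1 + (i - V) div d then modulus ((i - V) div d) else 0)"

definition B :: "int mat" where
  "B = mat M C (\<lambda>(i, j). entry i j)"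

lemma B_dims [simp]: "dim_row B = M" "dim_col B = C"
  by (simp_all add: B_def)

definition S :: "(nat \<Rightarrow> int) \<Rightarrow> nat \<Rightarrow> int" where
  "S x i = (\<Sum>j<n. g i j * x j) + g i n * x n"

definition primal :: "(nat \<Rightarrow> int) \<Rightarrow> nat \<Rightarrow> int" where
  "primal x i = (if i < m then 2 * (S x i + 2 * x (n + 1 + i)) else if i < m + N then x (n + 1 + i) else x n)"

definition check_val :: "(nat \<Rightarrow> int) \<Rightarrow> nat \<Rightarrow> int" where
  "check_val x c = (if c < d div 2 * l then syndrome c * x n + (\<Sum>i<N. parity_bit c i * x (n + 1 + m + i))
      else hash V (primal x) a)"

lemma sum_prim:
  assumes "i < V"
  shows "(\<Sum>j<C1. prim i j * x j) = primal x i"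
proof -
  have C1: "C1 = n + (1 + (m + N))" by (simp add: C1_def)
  have *: "(\<Sum>j<C1. prim i j * x j)
      = (\<Sum>j<n. prim i j * x j) + (prim i n * x n + (\<Sum>j<m + N. prim i (n + (1 + j)) * x (n + (1 + j))))"
    unfolding C1 sum_lessThan_add by simp
  show ?thesis
  proof (cases "i < m + N")
    case True
    have "(\<Sum>j<m + N. prim i (n + (1 + j)) * x (n + (1 + j))) = (\<Sum>j<m + N. if j = i then (if i < m then 4 else 1) * x (n + 1 + i) else 0)"
      using True by (intro sum.cong) (auto simp: prim_def)
    also have "\<dots> = (if i < m then 4 else 1) * x (n + 1 + i)" using True by simp
    finally show ?thesis unfolding * using True
      by (auto simp: prim_def primal_def S_def sum_distrib_left algebra_simps intro!: sum.cong)
  next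
    case False
    have "(\<Sum>j<n. prim i j * x j) = 0" "(\<Sum>j<m + N. prim i (n + (1 + j)) * x (n + (1 + j))) = 0"
      using False by (auto simp: prim_def intro!: sum.neutral)
    then show ?thesis unfolding * using False by (simp add: prim_def primal_def)
  qed
qed

lemma sum_check: "(\<Sum>j<C1. check c j * x j) = check_val x c"
proof (cases "c < d div 2 * l")
  case True
  have C1: "C1 = n + (1 + (m + N))" by (simp add: C1_def)
  have "(\<Sum>j<n. check c j * x j) = 0" "(\<Sum>j<m. check c (n + (1 + j)) * x (n + (1 + j))) = 0"
    using True by (auto simp: check_def intro!: sum.neutral)
  moreover have "(\<Sum>j<N. check c (n + (1 + (m + j))) * x (n + (1 + (m + j)))) = (\<Sum>i<N. parity_bit c i * x (n + 1 + m + i))"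
    using True by (intro sum.cong) (auto simp: check_def add.assoc)
  ultimately show ?thesis unfolding C1 sum_lessThan_add using True
    by (simp add: check_def check_val_def)
next
  case False
  have "(\<Sum>j<C1. check c j * x j) = (\<Sum>j<C1. \<Sum>i<V. int (a i) * (prim i j * x j))"
    using False by (simp add: check_def hash_col_def sum_distrib_right mult.assoc)
  also have "\<dots> = (\<Sum>i<V. int (a i) * (\<Sum>j<C1. prim i j * x j))"
    by (subst sum.swap) (simp add: sum_distrib_left)
  also have "\<dots> = hash V (primal x) a" unfolding hash_def by (intro sum.cong) (auto simp: sum_prim)
  finally show ?thesis using False by (simp add: check_val_def)
qed

lemma sum_entry:
  assumes "i < M"
  shows "(\<Sum>j<C. entry i j * x j) = (if i < V then primal x i
     else check_val x ((i - V) div d) + modulus ((i - V) div d) * x (C1 + (i - V) div d))"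
proof (cases "i < V")
  case True
  have "(\<Sum>j<C1. entry i j * x j) = primal x i"
    unfolding sum_prim[OF True, symmetric] using True by (intro sum.cong) (auto simp: entry_def)
  then show ?thesis using True unfolding C_def sum_lessThan_add by (simp add: entry_def)
next
  case False
  let ?c = "(i - V) div d"
  have c: "?c < NC" using False assms by (simp add: M_def less_mult_imp_div_less)
  have "(\<Sum>j<C1. entry i j * x j) = check_val x ?c"
    unfolding sum_check[symmetric] using False by (intro sum.cong) (auto simp: entry_def)
  moreover have "(\<Sum>j<NC. entry i (C1 + j) * x (C1 + j)) = (\<Sum>j<NC. if j = ?c then modulus ?c * x (C1 + ?c) else 0)"
    using False by (intro sum.cong) (auto simp: entry_def)
  ultimately show ?thesis using False c unfolding C_def sum_lessThan_add by simp
qed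

definition lat :: "(nat \<Rightarrow> int) \<Rightarrow> int vec" where
  "lat x = vec M (\<lambda>i. if i < V then primal x i
     else check_val x ((i - V) div d) + modulus ((i - V) div d) * x (C1 + (i - V) div d))"

lemma lat_mult: "B *\<^sub>v vec C x = lat x"
proof (rule eq_vecI)
  fix i assume "i < dim_vec (lat x)"
  then have i: "i < M" by (simp add: lat_def)
  then have "(B *\<^sub>v vec C x) $v i = (\<Sum>j<C. entry i j * x j)"
    by (simp add: B_def scalar_prod_def atLeast0LessThan)
  then show "(B *\<^sub>v vec C x) $v i = lat x $v i" using i by (simp add: sum_entry lat_def)
qed (simp add: lat_def)

lemma int_lattice_B: "int_lattice B = range lat"
proof -
  have "B *\<^sub>v v \<in> range lat" if "v \<in> carrier_vec C" for v
  proof -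
    have "v = vec C (\<lambda>i. v $v i)" using that by (intro eq_vecI) auto
    then show ?thesis by (metis lat_mult rangeI)
  qed
  moreover have "lat x \<in> int_lattice B" for x
    unfolding int_lattice_def lat_mult[symmetric] by auto
  ultimately show ?thesis by (auto simp: int_lattice_def)
qed

lemma lat_nonzero: "i < V \<Longrightarrow> primal x i \<noteq> 0 \<Longrightarrow> lat x \<in> nonzero_lattice_vecs B"
proof -
  assume i: "i < V" "primal x i \<noteq> 0"
  then have "lat x $v i \<noteq> 0\<^sub>v M $v i" by (simp add: lat_def M_def)
  then show ?thesis unfolding nonzero_lattice_vecs_def int_lattice_B by auto
qed

lemma nonzero_lattice_vecs_ne: "nonzero_lattice_vecs B \<noteq> {}"
  using lat_nonzero[of "m + N" "\<lambda>_. 1"] by (auto simp: V_def primal_def)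

end

lemma hamming_wt_ge:
  assumes "finite J" "h ` J \<subseteq> {i. i < dim_vec w \<and> w $v i \<noteq> 0}" "inj_on h J"
  shows "card J \<le> hamming_wt w"
  unfolding hamming_wt_def by (rule card_inj_on_le[OF assms(3,2)]) simp

locale ncp_reduction = reduction +
  fixes G :: "bit mat" and t :: "bit vec" and v :: nat
  assumes G: "G \<in> carrier_mat m n" and t: "t \<in> carrier_vec m"
    and g: "i < m \<Longrightarrow> j < n \<Longrightarrow> g i j = of_bool (G $$ (i, j) = 1)"
    and gt: "i < m \<Longrightarrow> g i n = of_bool (t $v i = 1)"
    and l: "l = 2 ^ v" and N: "N = 2 ^ l" and d: "even d" "d \<ge> 2"
begin

text \<open>Modulo 2 an odd multiplier acts as 1, and over bits \<open>G x + t\<close> equals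
  \<open>t - G x\<close>. The odd entries are thus the disagreements of \<open>t\<close> with a
  codeword.\<close>

lemma odd_S:
  assumes "i < m" "odd (x n)"
  shows "odd (S x i) \<longleftrightarrow> (t - G *\<^sub>v vec n (\<lambda>j. of_int (x j))) $v i \<noteq> 0"
proof -
  have "(of_int (g i j) :: bit) = G $$ (i, j)" if "j < n" for j
    using assms that by (cases "G $$ (i, j)") (auto simp: g)
  moreover have "(of_int (g i n) :: bit) = t $v i" using assms by (cases "t $v i") (auto simp: gt)
  ultimately have "(of_int (S x i) :: bit) = (\<Sum>j<n. G $$ (i, j) * of_int (x j)) + t $v i"
    using assms unfolding S_def
    by (simp add: of_int_bit[of "x n"] del: add_bit_eq_xor mult_bit_eq_and)
  also have "\<dots> = (t - G *\<^sub>v vec n (\<lambda>j. of_int (x j))) $v i"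
    using assms(1) G t by (simp add: scalar_prod_def atLeast0LessThan add.commute del: add_bit_eq_xor mult_bit_eq_and)
  finally have "(t - G *\<^sub>v vec n (\<lambda>j. of_int (x j))) $v i = of_bool (odd (S x i))" by (metis of_int_bit)
  then show ?thesis by simp
qed

text \<open>The syndrome of a word given by its support, as a tuple of field elements instead of
  bits. Being extensional, it lies in a product set that can be counted.\<close>

definition \<sigma> :: "nat set \<Rightarrow> nat \<Rightarrow> nim" where
  "\<sigma> z = (\<lambda>\<tau>\<in>{..<d div 2}. \<Sum>i\<in>z. Nim i ^ (2 * \<tau> - 1))"

lemma odd_sum_parity_bit:
  assumes "finite z"
  shows "odd (\<Sum>i\<in>z. parity_bit c i) \<longleftrightarrow> bit (nim_nat (\<Sum>i\<in>z. Nim i ^ (2 * (c div l) - 1))) (c mod l)"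
  by (simp only: bit_nim_sum[OF assms] parity_bit_def of_nat_sum[symmetric] even_of_nat)

lemma syndrome_eq:
  assumes "\<sigma> z = \<sigma> (f ` {..<r})" "inj_on f {..<r}" "finite z" "c < d div 2 * l"
  shows "even (syndrome c + (\<Sum>i\<in>z. parity_bit c i))"
proof -
  have "c div l < d div 2" using assms(4) by (simp add: less_mult_imp_div_less)
  then have "(\<Sum>i\<in>z. Nim i ^ (2 * (c div l) - 1)) = (\<Sum>i\<in>f ` {..<r}. Nim i ^ (2 * (c div l) - 1))"
    using fun_cong[OF assms(1), of "c div l"] by (simp add: \<sigma>_def)
  moreover have "syndrome c = (\<Sum>i\<in>f ` {..<r}. parity_bit c i)"
    unfolding syndrome_def using assms(2) by (simp add: sum.reindex)
  ultimately show ?thesis using odd_sum_parity_bit[OF assms(3), of c] odd_sum_parity_bit[of "f ` {..<r}" c]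
    unfolding even_add by auto
qed

lemma N_eq: "N = 2 ^ 2 ^ v" using N l by simp

text \<open>The coordinate with exponent 0 is a parity and takes two values only; the other
  \<open>d div 2 - 1\<close> take at most \<open>N\<close>. Up to lower order factors an average
  coset thus holds \<open>N ^ (r + 1 - d div 2)\<close> words of weight \<open>r\<close>.\<close>

lemma card_\<sigma>_image:
  "finite (\<sigma> ` {z. z \<subseteq> {..<N} \<and> card z = q})" "card (\<sigma> ` {z. z \<subseteq> {..<N} \<and> card z = q}) \<le> 2 * N ^ (d div 2 - 1)"
proof -
  let ?R = "\<lambda>\<tau>::nat. if \<tau> = 0 then Nim ` {..<2} else Nim ` {..<N}"
  have sub: "\<sigma> ` {z. z \<subseteq> {..<N} \<and> card z = q} \<subseteq> Pi\<^sub>E {..<d div 2} ?R"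
  proof clarify
    fix z assume z: "z \<subseteq> {..<N}"
    have mem: "x \<in> Nim ` {..<k}" if "nim_nat x < k" for x k
      using that by (metis image_eqI lessThan_iff nim.collapse)
    have "nim_nat (\<Sum>i\<in>z. Nim i ^ e) < N" for e
      unfolding N_eq using z N_eq by (intro nim_sum_less nim_pow_less) auto
    moreover have "nim_nat (\<Sum>i\<in>z. Nim i ^ 0) < 2 ^ 1"
      by (intro nim_sum_less) (simp add: one_nim_def)
    ultimately show "\<sigma> z \<in> Pi\<^sub>E {..<d div 2} ?R"
      unfolding \<sigma>_def using mem by (auto intro!: mem)
  qed
  have fin: "finite (Pi\<^sub>E {..<d div 2} ?R)" by (rule finite_PiE) auto
  show "finite (\<sigma> ` {z. z \<subseteq> {..<N} \<and> card z = q})" by (rule finite_subset[OF sub fin])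
  have cN: "card (Nim ` {..<k}) = k" for k by (simp add: card_image inj_on_def)
  obtain h where h: "d div 2 = Suc h" using d by (metis One_nat_def Suc_diff_Suc diff_0_eq_0 div_greater_zero_iff gr0_conv_Suc zero_less_numeral)
  have "card (\<sigma> ` {z. z \<subseteq> {..<N} \<and> card z = q}) \<le> card (Pi\<^sub>E {..<d div 2} ?R)" by (rule card_mono[OF fin sub])
  also have "\<dots> = (\<Prod>\<tau><Suc h. card (?R \<tau>))" unfolding h by (simp add: card_PiE)
  also have "\<dots> = 2 * N ^ h" by (simp only: prod.lessThan_Suc_shift) (simp add: cN)
  finally show "card (\<sigma> ` {z. z \<subseteq> {..<N} \<and> card z = q}) \<le> 2 * N ^ (d div 2 - 1)" by (simp add: h)
qed

text \<open>Modulo 2 only the odd entries of \<open>y\<close> contribute. The checks with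
  \<open>c div l = \<tau>\<close> are the bits of one power sum over their positions, so all power
  sums required by \<open>BCH_distance\<close> vanish.\<close>

lemma parity_distance:
  assumes "\<And>c. c < d div 2 * l \<Longrightarrow> even (\<Sum>i<N. parity_bit c i * y i)" and ex: "i0 < N" "odd (y i0)"
  shows "d \<le> card {i \<in> {..<N}. odd (y i)}"
proof (rule ccontr)
  assume less: "\<not> d \<le> card {i \<in> {..<N}. odd (y i)}"
  let ?z = "{i \<in> {..<N}. odd (y i)}"
  have inj: "inj_on Nim A" for A by (simp add: inj_on_def)
  show False
  proof (rule BCH_distance[of "Nim ` ?z" "d div 2"])
    show "finite (Nim ` ?z)" "Nim ` ?z \<noteq> {}" using ex by auto
    show "card (Nim ` ?z) < 2 * (d div 2)" using less d by (simp add: card_image[OF inj])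
    fix \<tau> assume \<tau>: "\<tau> < d div 2"
    show "(\<Sum>s\<in>Nim ` ?z. s ^ (2 * \<tau> - 1)) = 0"
    proof (rule nim_eq_0I[of _ "2 ^ v"])
      show "nim_nat (\<Sum>s\<in>Nim ` ?z. s ^ (2 * \<tau> - 1)) < 2 ^ 2 ^ v"
        using N_eq by (intro nim_sum_less nim_pow_less) auto
      fix b :: nat assume "b < 2 ^ v"
      then have b: "b < l" by (simp add: l)
      let ?c = "\<tau> * l + b"
      have "\<tau> * l + b < Suc \<tau> * l" using b by simp
      also have "\<dots> \<le> d div 2 * l" using \<tau> by (intro mult_le_mono1) simp
      finally have c: "?c < d div 2 * l" .
      have cd: "?c div l = \<tau>" "?c mod l = b" using b by auto
      have "even (\<Sum>i<N. parity_bit ?c i * y i)" by (rule assms(1)[OF c])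
      moreover have "even ((\<Sum>i<N. parity_bit ?c i * y i) - (\<Sum>i\<in>?z. parity_bit ?c i))"
      proof -
        have "(\<Sum>i\<in>?z. parity_bit ?c i) = (\<Sum>i<N. parity_bit ?c i * of_bool (odd (y i)))"
          by (rule sum.mono_neutral_cong_left) auto
        then have "(\<Sum>i<N. parity_bit ?c i * y i) - (\<Sum>i\<in>?z. parity_bit ?c i) = (\<Sum>i<N. parity_bit ?c i * (y i - of_bool (odd (y i))))"
          by (simp add: sum_subtractf right_diff_distrib)
        then show ?thesis by (auto intro!: dvd_sum)
      qed
      ultimately have "even (\<Sum>i\<in>?z. parity_bit ?c i)" by (simp add: even_diff)
      then have "\<not> bit (nim_nat (\<Sum>i\<in>?z. Nim i ^ (2 * \<tau> - 1))) b"
        using odd_sum_parity_bit[of ?z ?c] unfolding cd by simp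
      then show "\<not> bit (nim_nat (\<Sum>s\<in>Nim ` ?z. s ^ (2 * \<tau> - 1))) b"
        by (simp add: sum.reindex[OF inj])
    qed
  qed
qed

lemma code_dist_le:
  assumes "x \<in> carrier_vec n"
  shows "code_dist t (lin_code G) \<le> hamming_wt (t - G *\<^sub>v x)"
proof -
  have "hamming_wt u \<le> dim_vec u" for u :: "bit vec"
    using card_mono[of "{..<dim_vec u}" "{i. i < dim_vec u \<and> u $v i \<noteq> 0}"] by (auto simp: hamming_wt_def)
  moreover have "dim_vec (t - c) = m" if "c \<in> lin_code G" for c
    using that t G by (auto simp: lin_code_def)
  ultimately have "(\<lambda>c. hamming_wt (t - c)) ` lin_code G \<subseteq> {..m}" by fastforce
  then have "finite ((\<lambda>c. hamming_wt (t - c)) ` lin_code G)" by (rule finite_subset) simp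
  then show ?thesis unfolding code_dist_def using assms G by (intro Min_le) (auto simp: lin_code_def)
qed

lemma code_dist_attained: "\<exists>x\<in>carrier_vec n. code_dist t (lin_code G) = hamming_wt (t - G *\<^sub>v x)"
proof -
  have "hamming_wt u \<le> dim_vec u" for u :: "bit vec"
    using card_mono[of "{..<dim_vec u}" "{i. i < dim_vec u \<and> u $v i \<noteq> 0}"] by (auto simp: hamming_wt_def)
  moreover have "dim_vec (t - c) = m" if "c \<in> lin_code G" for c
    using that t G by (auto simp: lin_code_def)
  ultimately have "(\<lambda>c. hamming_wt (t - c)) ` lin_code G \<subseteq> {..m}" by fastforce
  then have fin: "finite ((\<lambda>c. hamming_wt (t - c)) ` lin_code G)" by (rule finite_subset) simp
  have "G *\<^sub>v 0\<^sub>v n \<in> lin_code G" using G by (auto simp: lin_code_def)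
  then have "(\<lambda>c. hamming_wt (t - c)) ` lin_code G \<noteq> {}" by auto
  from Min_in[OF fin this] show ?thesis unfolding code_dist_def using G by (auto simp: lin_code_def)
qed

text \<open>Besides odd multipliers and odd words there are vectors that violate a check, and
  repetition of the checks makes these dense too. What is left has zero check rows, hence is even,
  satisfies the random condition with its own entries, and is nonzero already within the first
  \<open>V\<close> rows.\<close>

lemma lattice_cases:
  assumes w: "w \<in> nonzero_lattice_vecs B" and dist: "d \<le> code_dist t (lin_code G)"
  shows "d \<le> hamming_wt w \<or> dim_vec w = M \<and> even_vec w \<and> int Q dvd hash V (\<lambda>i. w $v i) a \<and> (\<exists>i<V. w $v i \<noteq> 0)"
proof -
  obtain x where x: "w = lat x" "w \<noteq> 0\<^sub>v M"
    using w by (auto simp: nonzero_lattice_vecs_def int_lattice_B)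
  have dim: "dim_vec w = M" by (simp add: x(1) lat_def)
  have prim: "w $v i = primal x i" if "i < V" for i using that by (simp add: x(1) lat_def M_def)
  have d0: "d > 0" using d by simp
  have chk: "w $v (V + c * d + e) = check_val x c + modulus c * x (C1 + c)" if "c < NC" "e < d" for c e
  proof -
    have "c * d + e < Suc c * d" using that by simp
    also have "\<dots> \<le> NC * d" using that by (intro mult_le_mono1) simp
    finally have "V + c * d + e < M" by (simp add: M_def)
    moreover have "(V + c * d + e - V) div d = c" using that by (simp add: add.assoc)
    ultimately show ?thesis by (simp add: x(1) lat_def)
  qed
  have lt: "V + c * d + e < M" if "c < NC" "e < d" for c e
  proof -
    have "c * d + e < Suc c * d" using that by simp
    also have "\<dots> \<le> NC * d" using that by (intro mult_le_mono1) simp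
    finally show ?thesis by (simp add: M_def)
  qed
  have VM: "V \<le> M" by (simp add: M_def)
  show ?thesis
  proof (cases "\<forall>c<NC. check_val x c + modulus c * x (C1 + c) = 0")
    case False
    then obtain c where c: "c < NC" "check_val x c + modulus c * x (C1 + c) \<noteq> 0" by auto
    have "card {..<d} \<le> hamming_wt w"
    proof (rule hamming_wt_ge)
      show "(\<lambda>e. V + c * d + e) ` {..<d} \<subseteq> {i. i < dim_vec w \<and> w $v i \<noteq> 0}"
        using chk[OF c(1)] c lt by (auto simp: dim)
    qed (auto simp: inj_on_def)
    then show ?thesis by simp
  next
    case True
    show ?thesis
    proof (cases "odd (x n)")
      case odd: True
      let ?u = "t - G *\<^sub>v vec n (\<lambda>j. of_int (x j))"
      have du: "dim_vec ?u = m" using G t by simp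
      have "d \<le> hamming_wt ?u" using dist code_dist_le[of "vec n (\<lambda>j. of_int (x j))"] by simp
      also have "\<dots> = card {i. i < dim_vec ?u \<and> ?u $v i \<noteq> 0}" by (simp only: hamming_wt_def)
      also have "\<dots> \<le> hamming_wt w"
      proof (rule hamming_wt_ge[where h = id])
        show "id ` {i. i < dim_vec ?u \<and> ?u $v i \<noteq> 0} \<subseteq> {i. i < dim_vec w \<and> w $v i \<noteq> 0}"
        proof clarify
          fix i assume i: "i < dim_vec ?u" "?u $v i \<noteq> 0"
          then have "i < m" using du by simp
          then have "odd (S x i)" using odd_S[of i x] odd i(2) by simp
          then have "S x i + 2 * x (n + 1 + i) \<noteq> 0" by presburger
          then have "primal x i \<noteq> 0" using \<open>i < m\<close> by (simp add: primal_def)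
          then show "id i < dim_vec w \<and> w $v id i \<noteq> 0" using prim[of i] \<open>i < m\<close> VM by (simp add: dim V_def)
        qed
      qed auto
      finally show ?thesis by simp
    next
      case even: False
      \<comment> \<open>For an even multiplier the syndrome of the random word drops out modulo 2,
        and the word is measured against the code itself instead of a coset.\<close>
      have par: "even (\<Sum>i<N. parity_bit c i * x (n + 1 + m + i))" if "c < d div 2 * l" for c
      proof -
        have "syndrome c * x n + (\<Sum>i<N. parity_bit c i * x (n + 1 + m + i)) + 2 * x (C1 + c) = 0"
          using True[rule_format, of c] that by (simp add: check_val_def modulus_def NC_def)
        then have "(\<Sum>i<N. parity_bit c i * x (n + 1 + m + i)) = - (syndrome c * x n) - 2 * x (C1 + c)" by simp
        then show ?thesis using even by simp
      qed
      show ?thesis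
      proof (cases "\<exists>i<N. odd (x (n + 1 + m + i))")
        case True
        then obtain i0 where "i0 < N" "odd (x (n + 1 + m + i0))" by auto
        with par have "d \<le> card {i \<in> {..<N}. odd (x (n + 1 + m + i))}"
          by (rule parity_distance[where y = "\<lambda>i. x (n + 1 + m + i)"])
        also have "\<dots> \<le> hamming_wt w"
        proof (rule hamming_wt_ge)
          show "(\<lambda>i. m + i) ` {i \<in> {..<N}. odd (x (n + 1 + m + i))} \<subseteq> {i. i < dim_vec w \<and> w $v i \<noteq> 0}"
          proof clarify
            fix i assume i: "i < N" "odd (x (n + 1 + m + i))"
            then have "primal x (m + i) \<noteq> 0" by (auto simp: primal_def add.assoc)
            then show "m + i < dim_vec w \<and> w $v (m + i) \<noteq> 0" using prim[of "m + i"] i(1) VM by (simp add: dim V_def)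
          qed
        qed (auto simp: inj_on_def)
        finally show ?thesis by simp
      next
        case False
        have ev: "even (primal x i)" for i
        proof (cases "m \<le> i \<and> i < m + N")
          case True
          then show ?thesis using False by (auto simp: primal_def dest!: spec[of _ "i - m"])
        qed (use even in \<open>auto simp: primal_def\<close>)
        have zero: "w $v i = 0" if "\<not> i < V" "i < M" for i
        proof -
          have "(i - V) div d < NC" using that by (simp add: M_def less_mult_imp_div_less)
          then show ?thesis using True that by (simp add: x(1) lat_def)
        qed
        have "even_vec w" unfolding even_vec_def dim using prim zero ev by (metis even_zero)
        moreover have "int Q dvd hash V (\<lambda>i. w $v i) a"
        proof -
          have "hash V (\<lambda>i. w $v i) a = hash V (primal x) a" unfolding hash_def by (intro sum.cong) (auto simp: prim)
          also have "\<dots> = - (int Q * x (C1 + d div 2 * l))"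
            using True[rule_format, of "d div 2 * l"] by (simp add: check_val_def modulus_def NC_def)
          finally show ?thesis by simp
        qed
        moreover have "\<exists>i<V. w $v i \<noteq> 0"
        proof (rule ccontr)
          assume "\<not> (\<exists>i<V. w $v i \<noteq> 0)"
          then have "w = 0\<^sub>v M" using zero dim by (intro eq_vecI) auto
          then show False using x(2) by simp
        qed
        ultimately show ?thesis using dim by blast
      qed
    qed
  qed
qed

definition yes_vec :: "(nat \<Rightarrow> int) \<Rightarrow> nat set \<Rightarrow> nat \<Rightarrow> int" where
  "yes_vec u z i = (if i < m then 2 * u i else if i < m + N then of_bool (i - m \<in> z) else 1)"

text \<open>Multiplier 1 and the lift of \<open>y\<close> give residues of the right parity, which
  the columns with entry 4 bring to 0 or 2. The choice of \<open>z\<close> satisfies the checks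
  modulo 2 and the hash condition modulo \<open>Q\<close>, so no check row contributes to the
  norm.\<close>

lemma yes_case:
  assumes y: "y \<in> carrier_vec n" "code_dist t (lin_code G) = hamming_wt (t - G *\<^sub>v y)"
    and z: "z \<subseteq> {..<N}" "\<sigma> z = \<sigma> (f ` {..<r})" "inj_on f {..<r}"
  defines "u \<equiv> \<lambda>i. of_bool ((t - G *\<^sub>v y) $v i \<noteq> 0)"
  assumes Q: "int Q dvd hash V (yes_vec u z) a"
  shows "\<exists>w\<in>nonzero_lattice_vecs B. lp_norm p w = (2 powr p * code_dist t (lin_code G) + card z + 1) powr (1 / p)"
proof -
  let ?e = "t - G *\<^sub>v y"
  have de: "dim_vec ?e = m" using G t by simp
  have finz: "finite z" using z(1) by (rule finite_subset) simp
  define y' where "y' j = (if j < n then of_bool (y $v j = 1) else 1 :: int)" for j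
  define x0 where "x0 j = (if j \<le> n then y' j else if j < n + 1 + m then (u (j - (n + 1)) - S y' (j - (n + 1))) div 2
    else of_bool (j - (n + 1 + m) \<in> z))" for j
  \<comment> \<open>In the column of a modulus the coefficient is the negated quotient, which clears
    the check exactly once divisibility is known.\<close>
  define x where "x j = (if j < C1 then x0 j else - (check_val x0 (j - C1) div modulus (j - C1)))" for j
  have S0: "S x0 i = S y' i" for i by (simp add: S_def x0_def)
  have "vec n (\<lambda>j. of_int (y' j)) = y" using y(1)
    by (intro eq_vecI) (auto simp: y'_def bit_eq_of_bool[symmetric])
  then have oddS: "odd (S y' i) \<longleftrightarrow> ?e $v i \<noteq> 0" if "i < m" for i using odd_S[of i y'] that by (simp add: y'_def)
  have ev: "even (u i - S y' i)" if "i < m" for i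
    using oddS[OF that] by (cases "?e $v i") (simp_all add: u_def)
  have prim0: "primal x0 i = yes_vec u z i" if "i < V" for i
  proof (cases "i < m")
    case True
    then have "x0 (n + 1 + i) = (u i - S y' i) div 2" by (simp add: x0_def)
    then show ?thesis using ev[OF True] True by (simp add: primal_def yes_vec_def S0)
  next
    case False
    then show ?thesis by (auto simp: primal_def yes_vec_def x0_def y'_def)
  qed
  have prim: "primal x i = primal x0 i" if "i < V" for i
  proof -
    have "S x i = S x0 i" by (simp add: S_def x_def C1_def)
    then show ?thesis using that by (auto simp: primal_def x_def C1_def V_def)
  qed
  have chk: "check_val x c = check_val x0 c" for c
  proof -
    have "hash V (primal x) a = hash V (primal x0) a" by (simp add: hash_def prim)
    then show ?thesis by (auto simp: check_val_def x_def C1_def)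
  qed
  have dvd: "modulus c dvd check_val x0 c" for c
  proof (cases "c < d div 2 * l")
    case True
    have "(\<Sum>i<N. parity_bit c i * x0 (n + 1 + m + i)) = (\<Sum>i<N. parity_bit c i * of_bool (i \<in> z))"
      by (intro sum.cong) (auto simp: x0_def)
    also have "\<dots> = (\<Sum>i\<in>z. parity_bit c i)"
      using z(1) by (intro sum.mono_neutral_cong_right) auto
    finally show ?thesis using syndrome_eq[OF z(2,3) finz True] True
      by (simp add: check_val_def modulus_def x0_def y'_def)
  next
    case False
    have "hash V (primal x0) a = hash V (yes_vec u z) a" by (simp add: hash_def prim0)
    then show ?thesis using False Q by (simp add: check_val_def modulus_def)
  qed
  have w: "lat x $v i = (if i < V then yes_vec u z i else 0)" if "i < M" for i
    using that dvd by (simp add: lat_def prim prim0 chk) (simp add: x_def)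
  have "V - 1 < V" "yes_vec u z (V - 1) \<noteq> 0" by (simp_all add: V_def yes_vec_def)
  then have "lat x \<in> nonzero_lattice_vecs B" using prim prim0 by (intro lat_nonzero[of "V - 1"]) auto
  moreover have "lp_norm p (lat x) = (2 powr p * code_dist t (lin_code G) + card z + 1) powr (1 / p)"
  proof -
    have pw: "of_bool P powr p = (of_bool P :: real)" for P by (cases P) auto
    have "(\<Sum>i<M. \<bar>real_of_int (lat x $v i)\<bar> powr p) = (\<Sum>i<V. \<bar>real_of_int (yes_vec u z i)\<bar> powr p)"
      unfolding M_def sum_lessThan_add by (simp add: w M_def)
    also have "\<dots> = (\<Sum>i<m. \<bar>real_of_int (2 * u i)\<bar> powr p) + (\<Sum>i<N. of_bool (i \<in> z)) + 1"
      unfolding V_def sum_lessThan_add by (simp add: yes_vec_def pw)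
    also have "(\<Sum>i<N. of_bool (i \<in> z) :: real) = card z"
      using z(1) by (simp add: Int_absorb1)
    also have "(\<Sum>i<m. \<bar>real_of_int (2 * u i)\<bar> powr p) = (\<Sum>i<m. 2 powr p * of_bool (?e $v i \<noteq> 0))"
      by (intro sum.cong) (auto simp: u_def)
    also have "\<dots> = 2 powr p * card {i \<in> {..<m}. ?e $v i \<noteq> 0}"
      unfolding sum_distrib_left[symmetric] by (simp add: Int_def del: bit_not_zero_iff)
    also have "{i \<in> {..<m}. ?e $v i \<noteq> 0} = {i. i < dim_vec ?e \<and> ?e $v i \<noteq> 0}" unfolding de by auto
    finally show ?thesis unfolding lp_norm_def y(2) hamming_wt_def by (simp add: lat_def)
  qed
  ultimately show ?thesis by blast
qed

end

section \<open>The program\<close>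

text \<open>
  Arrays: 0 \<open>m\<close>, 1 \<open>n\<close>, 2 \<open>k\<close>, 3 \<open>d\<close>, 4 \<open>G\<close>, 5 \<open>t\<close>, 6 \<open>2 ^ e\<close>, 7 \<open>e\<close>, 8 \<open>2 ^ (e * C)\<close>, 9 the stride of all
  tables, 10 \<open>N\<close>, 11 \<open>l\<close>, 12 table of \<open>xor\<close>, 13 table of nimber products, 14 table of odd powers, 15 powers of
  two, 16 \<open>r\<close>, 17 \<open>K\<close>, 18 \<open>2 ^ K\<close>, 19 \<open>V\<close>, 20 the random word, 21 the hash coefficients, 22 syndromes, 23 hash
  of each column, 24 to 27 loop counters, 28 coin flips, 29 \<open>d div 2 * l\<close>, 30 \<open>C1\<close>, 31 \<open>M\<close>, 32 number of columns.
\<close>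

lemma update_other [simp]: "a \<noteq> b \<Longrightarrow> update s a i v b = s b"
  by (simp add: update_def)

lemma update_same [simp]: "update s a i v a = (s a)(i := v)"
  by (simp add: update_def)

definition frame :: "nat set \<Rightarrow> store \<Rightarrow> store \<Rightarrow> bool" where
  "frame X s s' \<longleftrightarrow> (\<forall>b. b \<notin> X \<longrightarrow> s' b = s b)"

lemma frame_refl [simp]: "frame X s s"
  by (simp add: frame_def)

lemma frame_trans: "frame X s s' \<Longrightarrow> frame Y s' s'' \<Longrightarrow> X \<union> Y \<subseteq> Z \<Longrightarrow> frame Z s s''"
  unfolding frame_def by (metis Un_iff subsetD)

lemma frame_update [simp]: "a \<in> X \<Longrightarrow> frame X s (update s' a i v) \<longleftrightarrow> frame X s s'"
  by (auto simp: frame_def update_def)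

lemma frameD: "frame X s s' \<Longrightarrow> b \<notin> X \<Longrightarrow> s' b = s b"
  by (simp add: frame_def)

definition Read_array :: "nat \<Rightarrow> exp \<Rightarrow> com" where
  "Read_array X cnt = For 24 cnt (Read X (Var 24))"

lemma runs_Read_array:
  assumes cnt: "\<And>s'. frame {24, X} s s' \<Longrightarrow> val cnt s' = int n" and X: "X \<noteq> 24"
    and len: "n \<le> length xs" and le: "\<And>x. x \<in> set xs \<Longrightarrow> \<bar>x\<bar> \<le> 2 ^ w" and n: "int n \<le> 2 ^ w"
  shows "runs w (Read_array X cnt) s xs r ys (n * 4 + 3) (\<lambda>s' xs' r' ys'.
    xs' = drop n xs \<and> r' = r \<and> ys' = ys \<and> frame {24, X} s s' \<and> (\<forall>i<n. s' X (int i) = xs ! i))"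
  unfolding Read_array_def
proof (rule runs_For[where n = n and k = 1 and I = "\<lambda>i s' xs' r' ys'. xs' = drop i xs \<and> r' = r \<and> ys' = ys
    \<and> frame {24, X} s s' \<and> (\<forall>j<i. s' X (int j) = xs ! j)"])
  fix i s1 xs1 r1 ys1
  assume i: "i < n" and I: "xs1 = drop i xs \<and> r1 = r \<and> ys1 = ys \<and> frame {24, X} s s1 \<and> (\<forall>j<i. s1 X (int j) = xs ! j)"
    and v: "s1 24 0 = int i"
  have xs1: "xs1 = xs ! i # drop (Suc i) xs" using i len I by (simp add: Cons_nth_drop_Suc)
  show "runs w (Read X (Var 24)) s1 xs1 r1 ys1 1 (\<lambda>s' xs' r' ys'. s' 24 0 = int i \<and>
     xs' = drop (Suc i) xs \<and> r' = r \<and> ys' = ys \<and> frame {24, X} s (update s' 24 0 (int (Suc i)))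
     \<and> (\<forall>j<Suc i. update s' 24 0 (int (Suc i)) X (int j) = xs ! j))"
    unfolding xs1
    by (rule runs_Read) (use I v X i len le in \<open>auto simp: less_Suc_eq\<close>)
qed (use cnt n X in \<open>auto\<close>)

definition Init_E :: com where
  "Init_E = Seq (Set_var 6 (Lit 1)) (Seq (Set_var 7 (Lit 0))
     (While (Less (Var 6) (Var 0)) (Seq (Set_var 6 (Mul (Lit 2) (Var 6))) (Set_var 7 (Add (Var 7) (Lit 1))))))"

definition log_ceil :: "nat \<Rightarrow> nat" where
  "log_ceil m = (LEAST e. m \<le> 2 ^ e)"

lemma log_ceil_le: "m \<le> 2 ^ log_ceil m"
  unfolding log_ceil_def by (rule LeastI[of _ m]) simp

lemma less_log_ceil: "e < log_ceil m \<Longrightarrow> 2 ^ e < m"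
  unfolding log_ceil_def by (drule not_less_Least) simp

lemma runs_Init_E:
  assumes m: "s 0 0 = int m" and w: "2 * int m \<le> 2 ^ w" "1 \<le> m"
  shows "runs w Init_E s xs r ys (log_ceil m * 4 + 6) (\<lambda>s' xs' r' ys'.
    xs' = xs \<and> r' = r \<and> ys' = ys \<and> frame {6, 7} s s' \<and> s' 6 0 = 2 ^ log_ceil m \<and> s' 7 0 = int (log_ceil m))"
proof -
  let ?c = "Seq (Set_var 6 (Mul (Lit 2) (Var 6))) (Set_var 7 (Add (Var 7) (Lit 1)))"
  let ?I = "\<lambda>i s' xs' r' ys'. xs' = xs \<and> r' = r \<and> ys' = ys \<and> frame {6, 7} s s' \<and> s' 6 0 = 2 ^ i \<and> s' 7 0 = int i"
  have "int (log_ceil m) \<le> 2 ^ w"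
  proof (cases "log_ceil m")
    case (Suc e)
    then have "2 ^ e < m" using less_log_ceil[of e m] by simp
    moreover have "e < (2::nat) ^ e" by (rule less_exp)
    ultimately have "log_ceil m \<le> m" using Suc by linarith
    then have "int (log_ceil m) \<le> int m" by simp
    then show ?thesis using w by linarith
  qed simp
  note lw = this
  have 1: "\<bar>1\<bar> \<le> (2::int) ^ w" by simp
  show ?thesis unfolding Init_E_def
  proof (rule runs_Seq[where ?T1.0 = 1 and ?T2.0 = "log_ceil m * 4 + 4"], rule runs_Set_var)
    let ?s = "update s 6 0 (val (Lit 1) s)"
    show "runs w (Seq (Set_var 7 (Lit 0)) (While (Less (Var 6) (Var 0)) ?c)) ?s xs r ys (log_ceil m * 4 + 4) (?I (log_ceil m))"
    proof (rule runs_Seq[where ?T1.0 = 1 and ?T2.0 = "log_ceil m * 4 + 1"], rule runs_Set_var)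
      let ?s' = "update ?s 7 0 (val (Lit 0) ?s)"
      show "runs w (While (Less (Var 6) (Var 0)) ?c) ?s' xs r ys (log_ceil m * 4 + 1) (?I (log_ceil m))"
      proof (rule runs_While[where I = ?I and n = "log_ceil m" and k = 3])
        fix i s1 xs1 r1 ys1
        assume i: "i < log_ceil m" and I: "?I i s1 xs1 r1 ys1"
        have s0: "s1 0 0 = int m" using I m frameD[of "{6,7}" s s1 0] by simp
        have lt: "2 ^ i < m" using less_log_ceil[OF i] .
        then have lt': "(2::int) ^ i < int m" by (metis of_nat_less_iff of_nat_numeral of_nat_power)
        then have lt'': "2 * 2 ^ i \<le> (2::int) ^ w" using w by linarith
        have "runs w ?c s1 xs1 r1 ys1 3 (?I (Suc i))"
        proof (rule runs_Seq[where ?T1.0 = 1 and ?T2.0 = 1], rule runs_Set_var)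
          show "\<bar>val (Mul (Lit 2) (Var 6)) s1\<bar> \<le> 2 ^ w" using I lt'' by simp
          show "runs w (Set_var 7 (Add (Var 7) (Lit 1))) (update s1 6 0 (val (Mul (Lit 2) (Var 6)) s1)) xs1 r1 ys1 1 (?I (Suc i))"
          proof (rule runs_Set_var)
            have "int i + 1 \<le> 2 ^ w" using i lw by linarith
            then show "\<bar>val (Add (Var 7) (Lit 1)) (update s1 6 0 (val (Mul (Lit 2) (Var 6)) s1))\<bar> \<le> 2 ^ w"
              using I by simp
          qed (use I in auto)
        qed simp_all
        then show "val (Less (Var 6) (Var 0)) s1 \<noteq> 0 \<and> runs w ?c s1 xs1 r1 ys1 3 (?I (Suc i))"
          using I s0 lt' by simp
      next
        fix s1 xs1 r1 ys1
        assume I: "?I (log_ceil m) s1 xs1 r1 ys1"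
        have s0: "s1 0 0 = int m" using I m frameD[of "{6,7}" s s1 0] by simp
        have "int m \<le> 2 ^ log_ceil m" using log_ceil_le[of m] by (metis of_nat_le_iff of_nat_numeral of_nat_power)
        then show "val (Less (Var 6) (Var 0)) s1 = 0 \<and> ?I (log_ceil m) s1 xs1 r1 ys1" using I s0 by simp
      qed (use 1 in auto)
    qed simp_all
  qed (use 1 in simp_all)
qed

text \<open>Field orders are squared until they reach \<open>E ^ C\<close>, so they stay at most
  \<open>(E ^ C) ^ 2\<close>. This serves as the stride of every table and is available before the
  final order is known.\<close>

definition Init_stride :: "nat \<Rightarrow> com" where
  "Init_stride C = Seq (Set_var 8 (Lit 1)) (Seq (For 24 (Lit (int C)) (Set_var 8 (Mul (Var 8) (Var 6))))
     (Set_var 9 (Mul (Var 8) (Var 8))))"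

lemma runs_Init_stride:
  assumes E: "s 6 0 = int E" "E \<ge> 1" and w: "(int E ^ C)\<^sup>2 \<le> 2 ^ w" "int C \<le> 2 ^ w"
  shows "runs w (Init_stride C) s xs r ys (C * 4 + 10) (\<lambda>s' xs' r' ys'.
    xs' = xs \<and> r' = r \<and> ys' = ys \<and> frame {8, 9, 24} s s' \<and> s' 8 0 = int E ^ C \<and> s' 9 0 = (int E ^ C)\<^sup>2)"
proof -
  let ?Q = "\<lambda>s' xs' r' ys'. xs' = xs \<and> r' = r \<and> ys' = ys \<and> frame {8, 9, 24} s s' \<and> s' 8 0 = int E ^ C \<and> s' 9 0 = (int E ^ C)\<^sup>2"
  let ?I = "\<lambda>i s' xs' r' ys'. xs' = xs \<and> r' = r \<and> ys' = ys \<and> frame {8, 24} s s' \<and> s' 8 0 = int E ^ i"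
  have pos: "int E ^ C \<ge> 1" using E by simp
  have "int E ^ C \<le> (int E ^ C)\<^sup>2" using pos by (simp add: power2_eq_square mult_le_cancel_right1)
  then have w': "int E ^ C \<le> 2 ^ w" using w by linarith
  show ?thesis unfolding Init_stride_def
  proof (rule runs_Seq[where ?T1.0 = 1 and ?T2.0 = "C * 4 + 7"], rule runs_Set_var)
    let ?s = "update s 8 0 (val (Lit 1) s)"
    show "runs w (Seq (For 24 (Lit (int C)) (Set_var 8 (Mul (Var 8) (Var 6)))) (Set_var 9 (Mul (Var 8) (Var 8)))) ?s xs r ys (C * 4 + 7) ?Q"
    proof (rule runs_Seq[where ?T1.0 = "C * 4 + 3" and ?T2.0 = 1])
      show "runs w (For 24 (Lit (int C)) (Set_var 8 (Mul (Var 8) (Var 6)))) ?s xs r ys (C * 4 + 3)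
        (\<lambda>s' xs' r' ys'. runs w (Set_var 9 (Mul (Var 8) (Var 8))) s' xs' r' ys' 1 ?Q)"
      proof (rule runs_For[where n = C and k = 1 and I = ?I])
        fix i s1 xs1 r1 ys1
        assume i: "i < C" and I: "?I i s1 xs1 r1 ys1" and v: "s1 24 0 = int i"
        have s6: "s1 6 0 = int E" using I E frameD[of "{8, 24}" s s1 6] by simp
        have "int E ^ Suc i \<le> int E ^ C" using E i by (intro power_increasing) auto
        then have "\<bar>val (Mul (Var 8) (Var 6)) s1\<bar> \<le> 2 ^ w" using I w' s6 by (simp add: mult.commute)
        then show "runs w (Set_var 8 (Mul (Var 8) (Var 6))) s1 xs1 r1 ys1 1 (\<lambda>s' xs' r' ys'. s' 24 0 = int i
          \<and> ?I (Suc i) (update s' 24 0 (int (Suc i))) xs' r' ys')"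
          by (rule runs_Set_var) (use I v s6 in auto)
      next
        fix s1 xs1 r1 ys1
        assume I: "?I C s1 xs1 r1 ys1"
        show "runs w (Set_var 9 (Mul (Var 8) (Var 8))) s1 xs1 r1 ys1 1 ?Q"
          by (rule runs_Set_var)
            (use I w in \<open>auto simp: power2_eq_square intro: frame_trans[of "{8, 24}"]\<close>)
      qed (use w in auto)
    qed simp
  qed simp_all
qed

section \<open>Tables of nimber sums and products\<close>

abbreviation "addr i j \<equiv> Add (Mul i (Var 9)) j"

definition nmul :: "nat \<Rightarrow> nat \<Rightarrow> nat" where
  "nmul x y = nim_nat (Nim x * Nim y)"

lemma nmul_level: "x < 2 ^ 2 ^ i \<Longrightarrow> y < 2 ^ 2 ^ i \<Longrightarrow> nmul x y = nim_mul i x y"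
  unfolding nmul_def using nim_times_level[of "Nim x" i "Nim y"] by simp

lemma nmul_less: "x < 2 ^ 2 ^ i \<Longrightarrow> y < 2 ^ 2 ^ i \<Longrightarrow> nmul x y < 2 ^ 2 ^ i"
  using nmul_level binary_field.closed[OF binary_field_nim_mul] by simp

text \<open>The digits are multiplied by \<open>nmul\<close> itself and not by the product of a
  fixed level, so a single table can be extended by lookups in itself.\<close>

lemma nmul_quad:
  assumes x: "x < 2 ^ 2 ^ Suc i" and y: "y < 2 ^ 2 ^ Suc i"
  shows "nmul x y = quad_mul (2 ^ 2 ^ i) (2 ^ 2 ^ i div 2) nmul x y"
proof -
  have hi: "z div 2 ^ 2 ^ i < 2 ^ 2 ^ i" if "z < 2 ^ 2 ^ Suc i" for z :: nat
    using that by (simp add: less_mult_imp_div_less mult_2 power_add)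
  have lo: "z mod 2 ^ 2 ^ i < 2 ^ 2 ^ i" for z :: nat by simp
  have c: "(2::nat) ^ 2 ^ i div 2 < 2 ^ 2 ^ i" by (rule binary_field.c_less[OF binary_field_nim_mul])
  note * = nmul_level[of _ i, OF lo lo] nmul_level[of _ i, OF lo hi] nmul_level[of _ i, OF hi lo]
     nmul_level[of _ i, OF hi hi]
  have "nmul (x div 2 ^ 2 ^ i) (y div 2 ^ 2 ^ i) < 2 ^ 2 ^ i" by (rule nmul_less[OF hi[OF x] hi[OF y]])
  then show ?thesis unfolding nmul_level[OF x y] nim_mul.simps quad_mul_def
    using *(1)[of x y] *(2)[OF y, of x] *(3)[OF x, of y] *(4)[OF x y] nmul_level[OF c] by simp
qed

lemma addr_inj:
  assumes "int a * int S + int b = int a' * int S + int b'" "b < S" "b' < S"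
  shows "a = a' \<and> b = b'"
proof -
  have "a * S + b = a' * S + b'" using assms(1) by (metis of_nat_add of_nat_eq_iff of_nat_mult)
  then have "(a * S + b) div S = (a' * S + b') div S" "(a * S + b) mod S = (a' * S + b') mod S" by simp_all
  then show ?thesis using assms(2,3) by simp
qed

definition tab :: "nat \<Rightarrow> (nat \<Rightarrow> nat \<Rightarrow> nat) \<Rightarrow> (nat \<times> nat) set \<Rightarrow> (int \<Rightarrow> int) \<Rightarrow> bool" where
  "tab S op R A \<longleftrightarrow> (\<forall>(a, b)\<in>R. A (int a * int S + int b) = int (op a b))"

text \<open>Second indices below the stride make addresses unambiguous, so other pairs keep their
  entries; a pair already in \<open>R\<close> receives the value that it holds.\<close>

lemma tab_update:
  assumes "tab S op R A" "R \<subseteq> UNIV \<times> {..<S}" "y < S" "u = int (op x y)" "z = int x * int S + int y"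
  shows "tab S op (insert (x, y) R) (A(z := u))"
proof -
  have "A(z := u) = A" if "(a, b) \<in> R" "int a * int S + int b = z" for a b
    using assms addr_inj[of a S b x y] that by (auto simp: tab_def fun_upd_idem_iff)
  then show ?thesis using assms unfolding tab_def by fastforce
qed

lemma tab_mono: "tab S op R A \<Longrightarrow> R' \<subseteq> R \<Longrightarrow> tab S op R' A"
  by (auto simp: tab_def)

definition Fill :: "exp \<Rightarrow> exp \<Rightarrow> exp \<Rightarrow> com" where
  "Fill bnd eA eM = For 26 bnd (For 27 bnd (Seq (Assign 12 (addr (Var 26) (Var 27)) eA) (Assign 13 (addr (Var 26) (Var 27)) eM)))"

text \<open>Validity on the old region \<open>R\<close> is part of the invariant of both loops, so
  \<open>eA\<close> and \<open>eM\<close> may look up digits while the tables are being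
  overwritten.\<close>

lemma runs_Fill:
  assumes bnd: "\<And>s'. frame {12, 13, 26, 27} s s' \<Longrightarrow> val bnd s' = int nb"
    and eval: "\<And>s' x y. frame {12, 13, 26, 27} s s' \<Longrightarrow> s' 26 0 = int x \<Longrightarrow> s' 27 0 = int y \<Longrightarrow> x < nb \<Longrightarrow> y < nb
      \<Longrightarrow> tab S xor R (s' 12) \<Longrightarrow> tab S nmul R (s' 13) \<Longrightarrow> val eA s' = int (xor x y) \<and> val eM s' = int (nmul x y)"
    and le: "\<And>x y. x < nb \<Longrightarrow> y < nb \<Longrightarrow> int (xor x y) \<le> 2 ^ w \<and> int (nmul x y) \<le> 2 ^ w"
    and S: "s 9 0 = int S" "nb \<le> S" "R \<subseteq> UNIV \<times> {..<S}" "int nb \<le> 2 ^ w"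
    and tabs: "tab S xor R (s 12)" "tab S nmul R (s 13)"
  shows "runs w (Fill bnd eA eM) s xs r ys (nb * (nb * 6 + 6) + 3) (\<lambda>s' xs' r' ys'.
    xs' = xs \<and> r' = r \<and> ys' = ys \<and> frame {12, 13, 26, 27} s s'
    \<and> tab S xor ({..<nb} \<times> {..<nb}) (s' 12) \<and> tab S nmul ({..<nb} \<times> {..<nb}) (s' 13))"
  (is "runs _ _ _ _ _ _ _ ?Q")
proof -
  let ?A = "Assign 12 (addr (Var 26) (Var 27)) eA" and ?M = "Assign 13 (addr (Var 26) (Var 27)) eM"
  let ?F = "\<lambda>s' xs' r' ys'. xs' = xs \<and> r' = r \<and> ys' = ys \<and> frame {12, 13, 26, 27} s s'"
  let ?R = "\<lambda>x y. R \<union> {..<x} \<times> {..<nb} \<union> {x} \<times> {..<y}"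
  let ?J = "\<lambda>x y s' xs' r' ys'. ?F s' xs' r' ys' \<and> tab S xor (?R x y) (s' 12) \<and> tab S nmul (?R x y) (s' 13)"
  have R: "?R x y \<subseteq> UNIV \<times> {..<S}" if "x < nb" "y \<le> nb" for x y using S that by auto
  have Suc_y: "?R x (Suc y) = insert (x, y) (?R x y)" for x y by auto
  have Suc_x: "?R (Suc x) 0 = ?R x nb" for x by auto
  show ?thesis unfolding Fill_def
  proof (rule runs_For[where n = nb and k = "nb * 6 + 3" and I = "\<lambda>x. ?J x 0"])
    fix x s1 xs1 r1 ys1
    assume x: "x < nb" and I: "?J x 0 s1 xs1 r1 ys1" and vx: "s1 26 0 = int x"
    show "runs w (For 27 bnd (Seq ?A ?M)) s1 xs1 r1 ys1 (nb * 6 + 3)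
      (\<lambda>s' xs' r' ys'. s' 26 0 = int x \<and> ?J (Suc x) 0 (update s' 26 0 (int (Suc x))) xs' r' ys')"
    proof (rule runs_For[where n = nb and k = 3 and I = "\<lambda>y s' xs' r' ys'. s' 26 0 = int x \<and> ?J x y s' xs' r' ys'"])
      fix y s2 xs2 r2 ys2
      assume y: "y < nb" and J: "s2 26 0 = int x \<and> ?J x y s2 xs2 r2 ys2" and vy: "s2 27 0 = int y"
      have fr: "frame {12, 13, 26, 27} s s2" using J by simp
      have s9: "s2 9 0 = int S" using frameD[OF fr, of 9] S by simp
      have a2: "val (addr (Var 26) (Var 27)) s2 = int x * int S + int y" using J vy s9 by simp
      have t: "tab S xor R (s2 12)" "tab S nmul R (s2 13)" using J by (auto elim: tab_mono)
      have ev: "val eA s2 = int (xor x y)" using eval[OF fr _ vy x y t] J by simp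
      let ?s3 = "update s2 12 (int x * int S + int y) (int (xor x y))"
      have t3: "tab S xor (?R x (Suc y)) (?s3 12)"
        unfolding Suc_y update_same using J R[OF x, of y] y S by (intro tab_update) auto
      have ev3: "val eM ?s3 = int (nmul x y)"
        using eval[of ?s3 x y] fr J vy x y t tab_mono[OF t3, of R] by auto
      have tM: "tab S nmul (?R x (Suc y)) ((s2 13)(int x * int S + int y := int (nmul x y)))"
        unfolding Suc_y using J R[OF x, of y] y S by (intro tab_update) auto
      show "runs w (Seq ?A ?M) s2 xs2 r2 ys2 3 (\<lambda>s' xs' r' ys'. s' 27 0 = int y \<and>
        update s' 27 0 (int (Suc y)) 26 0 = int x \<and> ?J x (Suc y) (update s' 27 0 (int (Suc y))) xs' r' ys')"
      proof (rule runs_Seq[where ?T1.0 = 1 and ?T2.0 = 1], rule runs_Assign)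
        show "\<bar>val eA s2\<bar> \<le> 2 ^ w" using le[OF x y] ev by simp
        show "runs w ?M (update s2 12 (val (addr (Var 26) (Var 27)) s2) (val eA s2)) xs2 r2 ys2 1 (\<lambda>s' xs' r' ys'. s' 27 0 = int y \<and>
          update s' 27 0 (int (Suc y)) 26 0 = int x \<and> ?J x (Suc y) (update s' 27 0 (int (Suc y))) xs' r' ys')"
          unfolding ev a2
          by (rule runs_Assign) (use le[OF x y] ev3 s9 J vy t3 tM in \<open>simp_all add: fun_upd_def\<close>)
      qed simp_all
    next
      fix s2 xs2 r2 ys2
      assume "s2 26 0 = int x \<and> ?J x nb s2 xs2 r2 ys2"
      then show "s2 26 0 = int x \<and> ?J (Suc x) 0 (update s2 26 0 (int (Suc x))) xs2 r2 ys2" unfolding Suc_x by simp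
    qed (use I vx bnd S in auto)
  next
    fix s1 xs1 r1 ys1
    assume "?J nb 0 s1 xs1 r1 ys1"
    then show "?Q s1 xs1 r1 ys1"
      by (auto elim: tab_mono)
  qed (use bnd S tabs in auto)
qed

definition Init_field :: com where
  "Init_field = Seq (Set_var 10 (Lit 2)) (Seq (Set_var 11 (Lit 1))
     (Fill (Lit 2) (Mod (Add (Var 26) (Var 27)) (Lit 2)) (Mul (Var 26) (Var 27))))"

lemma nmul_xor_bits: "x < 2 \<Longrightarrow> y < 2 \<Longrightarrow> xor x y = (x + y) mod 2 \<and> nmul x y = x * y"
proof -
  assume "x < 2" "y < 2"
  moreover from this have "nmul x y = x * y" using nmul_level[of x 0 y] by simp
  ultimately show ?thesis by (auto simp: less_2_cases_iff)
qed

lemma runs_Init_field: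
  assumes S: "s 9 0 = int S" "2 \<le> S" and w: "w \<ge> 1"
  shows "runs w Init_field s xs r ys 50 (\<lambda>s' xs' r' ys'.
    xs' = xs \<and> r' = r \<and> ys' = ys \<and> frame {10, 11, 12, 13, 26, 27} s s' \<and> s' 10 0 = 2 \<and> s' 11 0 = 1
    \<and> tab S xor ({..<2} \<times> {..<2}) (s' 12) \<and> tab S nmul ({..<2} \<times> {..<2}) (s' 13))"
proof -
  let ?s = "update (update s 10 0 2) 11 0 1"
  have w2: "(2::int) \<le> 2 ^ w" using power_increasing[OF w, of "2::int"] by simp
  have bits: "xor x y \<le> 1 \<and> nmul x y \<le> 1" if "x < 2" "y < 2" for x y
    using nmul_xor_bits[OF that] that by (auto simp: less_2_cases_iff)
  have le: "int (xor x y) \<le> 2 ^ w \<and> int (nmul x y) \<le> 2 ^ w" if "x < 2" "y < 2" for x y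
  proof -
    have "int (xor x y) \<le> 1" "int (nmul x y) \<le> 1" using bits[OF that] by simp_all
    then show ?thesis using w2 by linarith
  qed
  show ?thesis unfolding Init_field_def
  proof (rule runs_Seq[where ?T1.0 = 1 and ?T2.0 = 47], rule runs_Set_var)
    show "runs w (Seq (Set_var 11 (Lit 1)) (Fill (Lit 2) (Mod (Add (Var 26) (Var 27)) (Lit 2)) (Mul (Var 26) (Var 27))))
      (update s 10 0 (val (Lit 2) s)) xs r ys 47 (\<lambda>s' xs' r' ys'.
      xs' = xs \<and> r' = r \<and> ys' = ys \<and> frame {10, 11, 12, 13, 26, 27} s s' \<and> s' 10 0 = 2 \<and> s' 11 0 = 1
      \<and> tab S xor ({..<2} \<times> {..<2}) (s' 12) \<and> tab S nmul ({..<2} \<times> {..<2}) (s' 13))"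
    proof (rule runs_Seq[where ?T1.0 = 1 and ?T2.0 = 45], rule runs_Set_var)
      have "runs w (Fill (Lit 2) (Mod (Add (Var 26) (Var 27)) (Lit 2)) (Mul (Var 26) (Var 27))) ?s xs r ys (2 * (2 * 6 + 6) + 3)
        (\<lambda>s' xs' r' ys'. xs' = xs \<and> r' = r \<and> ys' = ys \<and> frame {12, 13, 26, 27} ?s s'
    \<and> tab S xor ({..<2} \<times> {..<2}) (s' 12) \<and> tab S nmul ({..<2} \<times> {..<2}) (s' 13))"
        by (rule runs_Fill[where R = "{}"])
          (use S le w2 nmul_xor_bits in \<open>auto simp: tab_def zmod_int\<close>)
      then show "runs w (Fill (Lit 2) (Mod (Add (Var 26) (Var 27)) (Lit 2)) (Mul (Var 26) (Var 27)))
        (update (update s 10 0 (val (Lit 2) s)) 11 0 (val (Lit 1) (update s 10 0 (val (Lit 2) s)))) xs r ys 45 (\<lambda>s' xs' r' ys'.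
        xs' = xs \<and> r' = r \<and> ys' = ys \<and> frame {10, 11, 12, 13, 26, 27} s s' \<and> s' 10 0 = 2 \<and> s' 11 0 = 1
        \<and> tab S xor ({..<2} \<times> {..<2}) (s' 12) \<and> tab S nmul ({..<2} \<times> {..<2}) (s' 13))"
        unfolding val.simps by (rule runs_mono) (auto simp: frame_def)
    qed (use w2 in auto)
  qed (use w2 in auto)
qed

definition lo :: "exp \<Rightarrow> exp" where "lo e = Mod e (Var 10)"
definition hi :: "exp \<Rightarrow> exp" where "hi e = Div e (Var 10)"
definition Xor_exp :: "exp \<Rightarrow> exp \<Rightarrow> exp" where "Xor_exp e e' = Cell 12 (addr e e')"
definition Nmul_exp :: "exp \<Rightarrow> exp \<Rightarrow> exp" where "Nmul_exp e e' = Cell 13 (addr e e')"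

lemma val_Xor_exp: "val e s = int a \<Longrightarrow> val e' s = int b \<Longrightarrow> s 9 0 = int S \<Longrightarrow> tab S xor R (s 12) \<Longrightarrow> (a, b) \<in> R
    \<Longrightarrow> val (Xor_exp e e') s = int (xor a b)"
  by (auto simp: Xor_exp_def tab_def)

lemma val_Nmul_exp: "val e s = int a \<Longrightarrow> val e' s = int b \<Longrightarrow> s 9 0 = int S \<Longrightarrow> tab S nmul R (s 13) \<Longrightarrow> (a, b) \<in> R
    \<Longrightarrow> val (Nmul_exp e e') s = int (nmul a b)"
  by (auto simp: Nmul_exp_def tab_def)

definition ext_add :: exp where
  "ext_add = Add (Xor_exp (lo (Var 26)) (lo (Var 27))) (Mul (Var 10) (Xor_exp (hi (Var 26)) (hi (Var 27))))"

definition ext_mul :: exp where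
  "ext_mul = (let x = Var 26; y = Var 27; bb = Nmul_exp (hi x) (hi y) in
     Add (Xor_exp (Nmul_exp (lo x) (lo y)) (Nmul_exp (Div (Var 10) (Lit 2)) bb))
       (Mul (Var 10) (Xor_exp bb (Xor_exp (Nmul_exp (lo x) (hi y)) (Nmul_exp (hi x) (lo y))))))"

lemma val_ext:
  assumes s: "s 26 0 = int x" "s 27 0 = int y" "s 9 0 = int S" "s 10 0 = int N" and N: "N = 2 ^ 2 ^ i"
    and xy: "x < N * N" "y < N * N"
    and t: "tab S xor ({..<N} \<times> {..<N}) (s 12)" "tab S nmul ({..<N} \<times> {..<N}) (s 13)"
  shows "val ext_add s = int (xor x y) \<and> val ext_mul s = int (nmul x y)"
proof -
  have NN: "N * N = 2 ^ 2 ^ Suc i" by (simp add: N mult_2 power_add)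
  have N0: "N > 0" by (simp add: N)
  have lo: "val (lo (Var 26)) s = int (x mod N)" "val (lo (Var 27)) s = int (y mod N)"
    and hi: "val (hi (Var 26)) s = int (x div N)" "val (hi (Var 27)) s = int (y div N)"
    and c: "val (Div (Var 10) (Lit 2)) s = int (N div 2)"
    using s by (simp_all add: lo_def hi_def zmod_int zdiv_int)
  have l: "x mod N < N" "y mod N < N" "x div N < N" "y div N < N" "N div 2 < N"
    using xy N0 by (simp_all add: less_mult_imp_div_less)
  have nl: "nmul a b < N" if "a < N" "b < N" for a b using nmul_less that by (simp add: N)
  have xl: "xor a b < N" if "a < N" "b < N" for a b using xor_less_exp that by (simp add: N)
  have A: "val (Xor_exp e e') s = int (xor a b)" if "val e s = int a" "val e' s = int b" "a < N" "b < N" for e e' a b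
    using val_Xor_exp[OF that(1,2) s(3) t(1)] that by simp
  have M: "val (Nmul_exp e e') s = int (nmul a b)" if "val e s = int a" "val e' s = int b" "a < N" "b < N" for e e' a b
    using val_Nmul_exp[OF that(1,2) s(3) t(2)] that by simp
  have "xor x y = xor x y mod N + N * (xor x y div N)" by simp
  then have x: "xor x y = xor (x mod N) (y mod N) + N * xor (x div N) (y div N)"
    by (simp add: N xor_mod_exp xor_div_exp)
  have 1: "val ext_add s = int (xor x y)"
    unfolding x ext_add_def val.simps A[OF lo l(1,2)] A[OF hi l(3,4)] using s by simp
  let ?bb = "nmul (x div N) (y div N)"
  have bb: "val (Nmul_exp (hi (Var 26)) (hi (Var 27))) s = int ?bb" "?bb < N" using M[OF hi l(3,4)] nl l by auto
  have t1: "val (Xor_exp (Nmul_exp (lo (Var 26)) (lo (Var 27))) (Nmul_exp (Div (Var 10) (Lit 2)) (Nmul_exp (hi (Var 26)) (hi (Var 27))))) s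
      = int (xor (nmul (x mod N) (y mod N)) (nmul (N div 2) ?bb))"
    by (intro A M lo c bb l nl)
  have t2: "val (Xor_exp (Nmul_exp (hi (Var 26)) (hi (Var 27))) (Xor_exp (Nmul_exp (lo (Var 26)) (hi (Var 27))) (Nmul_exp (hi (Var 26)) (lo (Var 27))))) s
      = int (xor ?bb (xor (nmul (x mod N) (y div N)) (nmul (x div N) (y mod N))))"
    by (intro A M lo hi bb l nl xl)
  have "val ext_mul s = int (quad_mul N (N div 2) nmul x y)"
    unfolding ext_mul_def Let_def val.simps t1[unfolded val.simps] t2[unfolded val.simps] quad_mul_def using s t1 t2 by simp
  then show ?thesis using 1 nmul_quad[of x i y] xy unfolding NN by (simp add: N)
qed

text \<open>A nimber product does not depend on the field in which it is computed. With a stride that is fixed in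
  advance, the tables can therefore be extended in place, overwriting old entries by equal values.\<close>

definition Grow_field :: com where
  "Grow_field = While (Less (Var 10) (Var 8)) (Seq (Fill (Mul (Var 10) (Var 10)) ext_add ext_mul)
     (Seq (Set_var 10 (Mul (Var 10) (Var 10))) (Set_var 11 (Mul (Lit 2) (Var 11)))))"

definition level :: "nat \<Rightarrow> nat" where
  "level X = (LEAST i. X \<le> 2 ^ 2 ^ i)"

lemma level_le: "X \<le> 2 ^ 2 ^ level X"
  unfolding level_def by (rule LeastI[of _ X]) (rule less_imp_le[OF less_two_exp])

lemma less_level: "i < level X \<Longrightarrow> 2 ^ 2 ^ i < X"
  unfolding level_def by (drule not_less_Least) simp

lemma runs_Grow_field:
  assumes s: "s 8 0 = int X" "s 9 0 = int S" "s 10 0 = 2" "s 11 0 = 1" and S: "S = X * X" "X \<ge> 2" "int S \<le> 2 ^ w"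
    and t: "tab S xor ({..<2} \<times> {..<2}) (s 12)" "tab S nmul ({..<2} \<times> {..<2}) (s 13)"
  shows "runs w Grow_field s xs r ys (level X * (S * (S * 6 + 6) + 9) + 1) (\<lambda>s' xs' r' ys'.
    xs' = xs \<and> r' = r \<and> ys' = ys \<and> frame {10, 11, 12, 13, 26, 27} s s' \<and> s' 10 0 = int (2 ^ 2 ^ level X)
    \<and> s' 11 0 = int (2 ^ level X)
    \<and> tab S nmul ({..<2 ^ 2 ^ level X} \<times> {..<2 ^ 2 ^ level X}) (s' 13))"
    (is "runs _ _ _ _ _ _ _ ?Q")
proof -
  let ?I = "\<lambda>i s' xs' r' ys'. xs' = xs \<and> r' = r \<and> ys' = ys \<and> frame {10, 11, 12, 13, 26, 27} s s'
     \<and> s' 10 0 = int (2 ^ 2 ^ i) \<and> s' 11 0 = int (2 ^ i)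
    \<and> tab S xor ({..<2 ^ 2 ^ i} \<times> {..<2 ^ 2 ^ i}) (s' 12) \<and> tab S nmul ({..<2 ^ 2 ^ i} \<times> {..<2 ^ 2 ^ i}) (s' 13)"
  show ?thesis unfolding Grow_field_def
  proof (rule runs_While[where I = ?I and n = "level X" and k = "S * (S * 6 + 6) + 8"])
    fix i s1 xs1 r1 ys1
    assume i: "i < level X" and I: "?I i s1 xs1 r1 ys1"
    let ?N = "(2::nat) ^ 2 ^ i"
    have fr: "frame {10, 11, 12, 13, 26, 27} s s1" using I by simp
    have s1: "s1 8 0 = int X" "s1 9 0 = int S" using frameD[OF fr] s by simp_all
    have lt: "?N < X" by (rule less_level[OF i])
    have NN: "?N * ?N = 2 ^ 2 ^ Suc i" by (simp add: mult_2 power_add)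
    have NS: "?N * ?N \<le> S" using lt S by (auto intro: mult_le_mono)
    have l: "2 ^ Suc i \<le> ?N * ?N" unfolding NN by (rule less_imp_le[OF less_exp])
    have lw: "int (?N * ?N) \<le> 2 ^ w" "int (2 ^ Suc i) \<le> 2 ^ w"
      using NS l S(3) by (meson of_nat_le_iff order_trans)+
    have F: "runs w (Fill (Mul (Var 10) (Var 10)) ext_add ext_mul) s1 xs1 r1 ys1 (?N * ?N * (?N * ?N * 6 + 6) + 3) (\<lambda>s' xs' r' ys'.
       xs' = xs1 \<and> r' = r1 \<and> ys' = ys1 \<and> frame {12, 13, 26, 27} s1 s'
       \<and> tab S xor ({..<?N * ?N} \<times> {..<?N * ?N}) (s' 12) \<and> tab S nmul ({..<?N * ?N} \<times> {..<?N * ?N}) (s' 13))"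
    proof (rule runs_Fill[where R = "{..<?N} \<times> {..<?N}"])
      fix s' assume f: "frame {12, 13, 26, 27} s1 s'"
      have s': "s' 10 0 = int ?N" "s' 9 0 = int S" using frameD[OF f] I s1 by simp_all
      show "val (Mul (Var 10) (Var 10)) s' = int (?N * ?N)" using s' by simp
      fix x y assume *: "s' 26 0 = int x" "s' 27 0 = int y" "x < ?N * ?N" "y < ?N * ?N"
        "tab S xor ({..<?N} \<times> {..<?N}) (s' 12)" "tab S nmul ({..<?N} \<times> {..<?N}) (s' 13)"
      show "val ext_add s' = int (xor x y) \<and> val ext_mul s' = int (nmul x y)"
        by (rule val_ext[OF *(1,2) s'(2,1) refl *(3-6)])
    next
      fix x y assume *: "x < ?N * ?N" "y < ?N * ?N"
      then have "xor x y < ?N * ?N" "nmul x y < ?N * ?N" unfolding NN by (rule xor_less_exp, rule nmul_less)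
      then show "int (xor x y) \<le> 2 ^ w \<and> int (nmul x y) \<le> 2 ^ w"
        using lw(1) by (meson less_imp_le of_nat_le_iff order_trans)
    next
      show "{..<?N} \<times> {..<?N} \<subseteq> UNIV \<times> {..<S}"
        using order_trans[OF le_square[of ?N] NS] by fastforce
    qed (use I s1 NS lw in auto)
    have "runs w (Seq (Fill (Mul (Var 10) (Var 10)) ext_add ext_mul)
       (Seq (Set_var 10 (Mul (Var 10) (Var 10))) (Set_var 11 (Mul (Lit 2) (Var 11))))) s1 xs1 r1 ys1 (S * (S * 6 + 6) + 8) (?I (Suc i))"
    proof (rule runs_Seq[where ?T1.0 = "?N * ?N * (?N * ?N * 6 + 6) + 3" and ?T2.0 = 3], rule runs_mono[OF F])
      fix s2 xs2 r2 ys2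
      assume P: "xs2 = xs1 \<and> r2 = r1 \<and> ys2 = ys1 \<and> frame {12, 13, 26, 27} s1 s2
       \<and> tab S xor ({..<?N * ?N} \<times> {..<?N * ?N}) (s2 12) \<and> tab S nmul ({..<?N * ?N} \<times> {..<?N * ?N}) (s2 13)"
      then have f: "frame {12, 13, 26, 27} s1 s2" by simp
      have s2: "s2 10 0 = int ?N" "s2 11 0 = int (2 ^ i)" using frameD[OF f] I by simp_all
      have fr2: "frame {10, 11, 12, 13, 26, 27} s s2" using fr f by (rule frame_trans) auto
      show "runs w (Seq (Set_var 10 (Mul (Var 10) (Var 10))) (Set_var 11 (Mul (Lit 2) (Var 11)))) s2 xs2 r2 ys2 3 (?I (Suc i))"
      proof (rule runs_Seq[where ?T1.0 = 1 and ?T2.0 = 1], rule runs_Set_var)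
        have v: "val (Mul (Var 10) (Var 10)) s2 = int (2 ^ 2 ^ Suc i)" using s2 NN[symmetric] by simp
        show "\<bar>val (Mul (Var 10) (Var 10)) s2\<bar> \<le> 2 ^ w" unfolding v using lw(1) NN by simp
        show "runs w (Set_var 11 (Mul (Lit 2) (Var 11))) (update s2 10 0 (val (Mul (Var 10) (Var 10)) s2)) xs2 r2 ys2 1 (?I (Suc i))"
          unfolding v
        proof (rule runs_Set_var)
          have v2: "val (Mul (Lit 2) (Var 11)) (update s2 10 0 (int (2 ^ 2 ^ Suc i))) = int (2 ^ Suc i)"
            using s2 by simp
          show "\<bar>val (Mul (Lit 2) (Var 11)) (update s2 10 0 (int (2 ^ 2 ^ Suc i)))\<bar> \<le> 2 ^ w" unfolding v2 using lw(2) by simp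
          show "?I (Suc i) (update (update s2 10 0 (int (2 ^ 2 ^ Suc i))) 11 0 (val (Mul (Lit 2) (Var 11)) (update s2 10 0 (int (2 ^ 2 ^ Suc i))))) xs2 r2 ys2"
            unfolding v2 using P I fr2 unfolding NN by simp
        qed simp
      qed simp_all
    next
      have "?N * ?N * (?N * ?N * 6 + 6) \<le> S * (S * 6 + 6)" using NS by (intro mult_le_mono add_le_mono) auto
      then show "1 + (?N * ?N * (?N * ?N * 6 + 6) + 3) + 3 \<le> S * (S * 6 + 6) + 8" by linarith
    qed simp
    moreover have e: "s1 10 0 = int ?N" using I by (elim conjE)
    have "s1 10 0 < s1 8 0" unfolding e s1(1) of_nat_less_iff by (rule lt)
    then have "val (Less (Var 10) (Var 8)) s1 \<noteq> 0" by simp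
    ultimately show "val (Less (Var 10) (Var 8)) s1 \<noteq> 0 \<and> runs w (Seq (Fill (Mul (Var 10) (Var 10)) ext_add ext_mul)
       (Seq (Set_var 10 (Mul (Var 10) (Var 10))) (Set_var 11 (Mul (Lit 2) (Var 11))))) s1 xs1 r1 ys1 (S * (S * 6 + 6) + 8) (?I (Suc i))"
      by (intro conjI)
  next
    fix s1 xs1 r1 ys1
    assume I: "?I (level X) s1 xs1 r1 ys1"
    have fr: "frame {10, 11, 12, 13, 26, 27} s s1" using I by (elim conjE)
    have e: "s1 10 0 = int (2 ^ 2 ^ level X)" using I by (elim conjE)
    have e8: "s1 8 0 = int X" using frameD[OF fr] s by simp
    have "\<not> s1 10 0 < s1 8 0" unfolding e e8 of_nat_less_iff not_less by (rule level_le)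
    then have "val (Less (Var 10) (Var 8)) s1 = 0" by simp
    with I show "val (Less (Var 10) (Var 8)) s1 = 0 \<and> ?Q s1 xs1 r1 ys1" by blast
  qed (use s t in auto)
qed

section \<open>Tables of odd powers and of powers of two\<close>

definition pow_odd :: "nat \<Rightarrow> nat \<Rightarrow> nat" where
  "pow_odd \<tau> x = nim_nat (Nim x ^ (2 * \<tau> - 1))"

text \<open>Rows 0 and 1 are separate cases: truncated subtraction gives row 0 the exponent 0, and
  only from row 1 on does the exponent grow by 2.\<close>

lemma pow_odd_simps: "pow_odd 0 x = 1" "pow_odd (Suc 0) x = x"
  "pow_odd (Suc (Suc \<tau>)) x = nmul (nmul (pow_odd (Suc \<tau>) x) x) x"
proof -
  have "nim_nat 1 = 1" by (simp add: one_nim_def)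
  then show "pow_odd 0 x = 1" "pow_odd (Suc 0) x = x"
    "pow_odd (Suc (Suc \<tau>)) x = nmul (nmul (pow_odd (Suc \<tau>) x) x) x"
    by (simp_all add: pow_odd_def nmul_def mult_ac)
qed

lemma pow_odd_less: "x < 2 ^ 2 ^ v \<Longrightarrow> pow_odd \<tau> x < 2 ^ 2 ^ v"
  unfolding pow_odd_def by (rule nim_pow_less) simp

definition Pow_table :: com where
  "Pow_table = Seq (For 24 (Var 10) (Seq (Assign 14 (Var 24) (Lit 1)) (Assign 14 (Add (Var 9) (Var 24)) (Var 24))))
     (For 25 (Div (Var 3) (Lit 2)) (For 24 (Var 10) (Assign 14 (addr (Add (Var 25) (Lit 2)) (Var 24))
        (Nmul_exp (Nmul_exp (Cell 14 (addr (Add (Var 25) (Lit 1)) (Var 24))) (Var 24)) (Var 24)))))"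

lemma runs_Pow_table:
  assumes s: "s 3 0 = int d" "s 9 0 = int S" "s 10 0 = int N" and N: "N = 2 ^ 2 ^ v" "N \<le> S" "int N \<le> 2 ^ w" "int d \<le> 2 ^ w"
    and t: "tab S nmul ({..<N} \<times> {..<N}) (s 13)"
  shows "runs w Pow_table s xs r ys (N * 6 + d * (N * 4 + 6) + 10) (\<lambda>s' xs' r' ys'.
    xs' = xs \<and> r' = r \<and> ys' = ys \<and> frame {14, 24, 25} s s' \<and> tab S pow_odd ({..<d div 2} \<times> {..<N}) (s' 14))"
    (is "runs _ _ _ _ _ _ _ ?Q")
proof -
  let ?F = "\<lambda>s' xs' r' ys'. xs' = xs \<and> r' = r \<and> ys' = ys \<and> frame {14, 24, 25} s s'"
  let ?I = "\<lambda>i s' xs' r' ys'. ?F s' xs' r' ys' \<and> tab S pow_odd ({..<2} \<times> {..<i}) (s' 14)"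
  let ?R = "\<lambda>\<tau> x. {..<Suc (Suc \<tau>)} \<times> {..<N} \<union> {Suc (Suc \<tau>)} \<times> {..<x}"
  let ?J = "\<lambda>\<tau> x s' xs' r' ys'. ?F s' xs' r' ys' \<and> tab S pow_odd (?R \<tau> x) (s' 14)"
  let ?b = "Assign 14 (addr (Add (Var 25) (Lit 2)) (Var 24)) (Nmul_exp (Nmul_exp (Cell 14 (addr (Add (Var 25) (Lit 1)) (Var 24))) (Var 24)) (Var 24))"
  have one: "(1::int) \<le> 2 ^ w" by simp
  have lt: "int x \<le> 2 ^ w" if "x < N" for x using that N(3) by linarith
  show ?thesis unfolding Pow_table_def
  proof (rule runs_Seq[where ?T1.0 = "N * 6 + 3" and ?T2.0 = "d * (N * 4 + 6) + 3"])
    show "runs w (For 24 (Var 10) (Seq (Assign 14 (Var 24) (Lit 1)) (Assign 14 (Add (Var 9) (Var 24)) (Var 24)))) s xs r ys (N * 6 + 3)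
      (\<lambda>s' xs' r' ys'. runs w (For 25 (Div (Var 3) (Lit 2)) (For 24 (Var 10) ?b)) s' xs' r' ys' (d * (N * 4 + 6) + 3) ?Q)"
    proof (rule runs_For[where n = N and k = 3 and I = ?I])
      fix i s1 xs1 r1 ys1
      assume i: "i < N" and I: "?I i s1 xs1 r1 ys1" and v: "s1 24 0 = int i"
      have s9: "s1 9 0 = int S" using I s frameD[of "{14,24,25}" s s1 9] by simp
      have "tab S pow_odd (insert (1, i) (insert (0, i) ({..<2} \<times> {..<i}))) (((s1 14)(int i := 1))(int S + int i := int i))"
        using I i N by (intro tab_update) (auto simp: pow_odd_simps)
      moreover have "insert (1, i) (insert (0, i) ({..<2::nat} \<times> {..<i})) = {..<2} \<times> {..<Suc i}" by (auto simp: less_2_cases_iff)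
      ultimately have t: "tab S pow_odd ({..<2} \<times> {..<Suc i}) (((s1 14)(int i := 1))(int S + int i := int i))" by simp
      show "runs w (Seq (Assign 14 (Var 24) (Lit 1)) (Assign 14 (Add (Var 9) (Var 24)) (Var 24))) s1 xs1 r1 ys1 3
        (\<lambda>s' xs' r' ys'. s' 24 0 = int i \<and> ?I (Suc i) (update s' 24 0 (int (Suc i))) xs' r' ys')"
        by (rule runs_Seq[where ?T1.0 = 1 and ?T2.0 = 1], rule runs_Assign, simp, rule runs_Assign)
          (use I v s9 t lt[OF i] in \<open>simp_all add: fun_upd_def\<close>)
    next
      fix s1 xs1 r1 ys1
      assume I: "?I N s1 xs1 r1 ys1"
      \<comment> \<open>Round \<tau> writes row \<open>\<tau> + 2\<close>. In the end
        \<open>d div 2 + 2\<close> rows are filled, and \<open>tab_mono\<close> restricts the claim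
        to the first \<open>d div 2\<close>.\<close>
      show "runs w (For 25 (Div (Var 3) (Lit 2)) (For 24 (Var 10) ?b)) s1 xs1 r1 ys1 (d * (N * 4 + 6) + 3) ?Q"
      proof (rule runs_For[where n = "d div 2" and k = "N * 4 + 3" and I = "\<lambda>\<tau>. ?J \<tau> 0"])
        fix \<tau> s2 xs2 r2 ys2
        assume \<tau>: "\<tau> < d div 2" and J: "?J \<tau> 0 s2 xs2 r2 ys2" and v25: "s2 25 0 = int \<tau>"
        show "runs w (For 24 (Var 10) ?b) s2 xs2 r2 ys2 (N * 4 + 3)
          (\<lambda>s' xs' r' ys'. s' 25 0 = int \<tau> \<and> ?J (Suc \<tau>) 0 (update s' 25 0 (int (Suc \<tau>))) xs' r' ys')"
        proof (rule runs_For[where n = N and k = 1 and I = "\<lambda>x s' xs' r' ys'. s' 25 0 = int \<tau> \<and> ?J \<tau> x s' xs' r' ys'"])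
          fix x s3 xs3 r3 ys3
          assume x: "x < N" and K: "s3 25 0 = int \<tau> \<and> ?J \<tau> x s3 xs3 r3 ys3" and v24: "s3 24 0 = int x"
          have fr: "frame {14, 24, 25} s s3" using K by simp
          have s9: "s3 9 0 = int S" and t13: "tab S nmul ({..<N} \<times> {..<N}) (s3 13)"
            using s t frameD[OF fr] by simp_all
          have p: "pow_odd (Suc \<tau>) x < N" using pow_odd_less x N by simp
          have M: "val (Nmul_exp e e') s3 = int (nmul a b)" if "val e s3 = int a" "val e' s3 = int b" "a < N" "b < N" for e e' a b
            using val_Nmul_exp[OF that(1,2) s9 t13] that by simp
          have "(Suc \<tau>, x) \<in> ?R \<tau> x" using x by simp
          then have "s3 14 (int (Suc \<tau>) * int S + int x) = int (pow_odd (Suc \<tau>) x)" using K unfolding tab_def by blast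
          then have c: "val (Cell 14 (addr (Add (Var 25) (Lit 1)) (Var 24))) s3 = int (pow_odd (Suc \<tau>) x)"
            using K v24 s9 by (simp add: add.commute)
          have n1: "nmul (pow_odd (Suc \<tau>) x) x < N" using nmul_less p x N by simp
          have vx: "val (Var 24) s3 = int x" using v24 by simp
          have e: "val (Nmul_exp (Nmul_exp (Cell 14 (addr (Add (Var 25) (Lit 1)) (Var 24))) (Var 24)) (Var 24)) s3 = int (pow_odd (Suc (Suc \<tau>)) x)"
            unfolding pow_odd_simps by (intro M c vx p x n1)
          have ad: "val (addr (Add (Var 25) (Lit 2)) (Var 24)) s3 = int (Suc (Suc \<tau>)) * int S + int x"
            using K v24 s9 by (simp add: add.commute)
          have "tab S pow_odd (insert (Suc (Suc \<tau>), x) (?R \<tau> x)) ((s3 14)(int (Suc (Suc \<tau>)) * int S + int x := int (pow_odd (Suc (Suc \<tau>)) x)))"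
            using K x N by (intro tab_update) auto
          moreover have "insert (Suc (Suc \<tau>), x) (?R \<tau> x) = ?R \<tau> (Suc x)" by auto
          ultimately have t': "tab S pow_odd (?R \<tau> (Suc x)) ((s3 14)(int (Suc (Suc \<tau>)) * int S + int x := int (pow_odd (Suc (Suc \<tau>)) x)))" by simp
          have le: "\<bar>int (pow_odd (Suc (Suc \<tau>)) x)\<bar> \<le> 2 ^ w" using lt[OF pow_odd_less[of x v "Suc (Suc \<tau>)", folded N(1), OF x]] by simp
          show "runs w ?b s3 xs3 r3 ys3 1 (\<lambda>s' xs' r' ys'. s' 24 0 = int x \<and> update s' 24 0 (int (Suc x)) 25 0 = int \<tau>
             \<and> ?J \<tau> (Suc x) (update s' 24 0 (int (Suc x))) xs' r' ys')"
            by (rule runs_Assign; (unfold e ad)?) (use K v24 t' le in \<open>simp_all add: fun_upd_def del: of_nat_Suc\<close>)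
        next
          fix s3 xs3 r3 ys3
          assume K: "s3 25 0 = int \<tau> \<and> ?J \<tau> N s3 xs3 r3 ys3"
          have "?R (Suc \<tau>) 0 = ?R \<tau> N" by auto
          then show "s3 25 0 = int \<tau> \<and> ?J (Suc \<tau>) 0 (update s3 25 0 (int (Suc \<tau>))) xs3 r3 ys3" using K by simp
        next
          fix x s3 xs3 r3 ys3
          assume "s3 25 0 = int \<tau> \<and> ?J \<tau> x s3 xs3 r3 ys3"
          then have fr: "frame {14, 24, 25} s s3" by simp
          show "val (Var 10) s3 = int N" using frameD[OF fr, of 10] s by simp
        qed (use J v25 N in auto)
      next
        fix s2 xs2 r2 ys2
        assume "?J (d div 2) 0 s2 xs2 r2 ys2"
        then show "?Q s2 xs2 r2 ys2" by (auto elim: tab_mono)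
      next
        have "?R 0 0 = {..<2} \<times> {..<N}" by auto
        then show "?J 0 0 (update s1 25 0 0) xs1 r1 ys1" using I by simp
      next
        fix \<tau> s2 xs2 r2 ys2
        assume "?J \<tau> 0 s2 xs2 r2 ys2"
        then show "val (Div (Var 3) (Lit 2)) s2 = int (d div 2)" using s frameD[of "{14, 24, 25}" s s2 3] by (simp add: zdiv_int)
      next
        show "int (d div 2) \<le> 2 ^ w" using N(4) by linarith
        show "d div 2 * (N * 4 + 3 + 3) + 3 \<le> d * (N * 4 + 6) + 3" by (intro add_le_mono1 mult_le_mono; simp)
      qed
    next
      fix i s1 xs1 r1 ys1
      assume "?I i s1 xs1 r1 ys1"
      then have fr: "frame {14, 24, 25} s s1" by simp
      show "val (Var 10) s1 = int N" using frameD[OF fr, of 10] s by simp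
    qed (use N in \<open>auto simp: tab_def\<close>)
  qed simp
qed

definition Two_table :: com where
  "Two_table = Seq (Assign 15 (Lit 0) (Lit 1)) (For 24 (Var 11) (Assign 15 (Add (Var 24) (Lit 1)) (Mul (Lit 2) (Cell 15 (Var 24)))))"

lemma runs_Two_table:
  assumes s: "s 11 0 = int l" and w: "l \<le> w"
  shows "runs w Two_table s xs r ys (l * 4 + 6) (\<lambda>s' xs' r' ys'.
    xs' = xs \<and> r' = r \<and> ys' = ys \<and> frame {15, 24} s s' \<and> (\<forall>b \<le> l. s' 15 (int b) = 2 ^ b))"
    (is "runs _ _ _ _ _ _ _ ?Q")
proof -
  let ?I = "\<lambda>i s' xs' r' ys'. xs' = xs \<and> r' = r \<and> ys' = ys \<and> frame {15, 24} s s' \<and> (\<forall>b \<le> i. s' 15 (int b) = 2 ^ b)"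
  have w': "(2::int) ^ Suc i \<le> 2 ^ w" if "i < l" for i using that w by (intro power_increasing) auto
  have "l < 2 ^ l" by (rule less_exp)
  also have "\<dots> \<le> (2::nat) ^ w" using w by (intro power_increasing) auto
  finally have lw: "int l \<le> 2 ^ w" by (metis less_imp_le of_nat_le_iff of_nat_numeral of_nat_power)
  show ?thesis unfolding Two_table_def
  proof (rule runs_Seq[where ?T1.0 = 1 and ?T2.0 = "l * 4 + 3"], rule runs_Assign)
    show "runs w (For 24 (Var 11) (Assign 15 (Add (Var 24) (Lit 1)) (Mul (Lit 2) (Cell 15 (Var 24)))))
       (update s 15 (val (Lit 0) s) (val (Lit 1) s)) xs r ys (l * 4 + 3) ?Q"
    proof (rule runs_For[where n = l and k = 1 and I = ?I])
      fix i s1 xs1 r1 ys1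
      assume i: "i < l" and I: "?I i s1 xs1 r1 ys1" and v: "s1 24 0 = int i"
      have c: "s1 15 (int i) = 2 ^ i" using I by simp
      show "runs w (Assign 15 (Add (Var 24) (Lit 1)) (Mul (Lit 2) (Cell 15 (Var 24)))) s1 xs1 r1 ys1 1
        (\<lambda>s' xs' r' ys'. s' 24 0 = int i \<and> ?I (Suc i) (update s' 24 0 (int (Suc i))) xs' r' ys')"
        by (rule runs_Assign) (use I v c w'[OF i] in \<open>auto simp: le_Suc_eq\<close>)
    next
      fix i s1 xs1 r1 ys1
      assume "?I i s1 xs1 r1 ys1"
      then have fr: "frame {15, 24} s s1" by simp
      show "val (Var 11) s1 = int l" using frameD[OF fr, of 11] s by simp
    qed (use lw in auto)
  qed simp_all
qed

lemma runs_SeqI: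
  "runs w c1 s xs r ys T1 (\<lambda>s' xs' r' ys'. runs w c2 s' xs' r' ys' T2 Q) \<Longrightarrow> runs w (Seq c1 c2) s xs r ys (1 + T1 + T2) Q"
  by (rule runs_Seq) auto

lemma runs_Set_varI:
  "Q (update s a 0 (val f s)) xs r ys \<Longrightarrow> \<bar>val f s\<bar> \<le> 2 ^ w \<Longrightarrow> runs w (Set_var a f) s xs r ys 1 Q"
  by (rule runs_Set_var) auto

section \<open>Derived parameters and random choices\<close>

definition Params :: "nat \<Rightarrow> nat \<Rightarrow> com" where
  "Params A q = Seq (Set_var 16 (Div (Mul (Lit (int A)) (Var 3)) (Lit (int q))))
    (Seq (Set_var 17 (Sub (Mul (Var 11) (Sub (Add (Var 16) (Lit 1)) (Div (Var 3) (Lit 2)))) (Mul (Var 7) (Var 3))))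
    (Seq (Set_var 19 (Add (Add (Var 0) (Var 10)) (Lit 1)))
    (Seq (Set_var 29 (Mul (Div (Var 3) (Lit 2)) (Var 11)))
    (Seq (Set_var 30 (Add (Add (Add (Var 1) (Lit 1)) (Var 0)) (Var 10)))
    (Seq (Set_var 31 (Add (Var 19) (Mul (Add (Var 29) (Lit 1)) (Var 3))))
    (Seq (Set_var 32 (Add (Var 30) (Add (Var 29) (Lit 1))))
    (Seq (Set_var 18 (Lit 1)) (For 24 (Var 17) (Set_var 18 (Mul (Lit 2) (Var 18)))))))))))"

text \<open>The program subtracts integers whereas \<open>K\<close> is defined with truncated
  subtraction. The hypotheses \<open>h\<close> make the two agree.\<close>

lemma runs_Params:
  fixes A q d l m n N e :: nat
  defines "r0 \<equiv> A * d div q" and "h \<equiv> d div 2"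
  defines "K \<equiv> l * (r0 + 1 - h) - e * d"
  assumes s: "s 0 0 = int m" "s 1 0 = int n" "s 3 0 = int d" "s 7 0 = int e" "s 10 0 = int N" "s 11 0 = int l"
    and h: "h \<le> r0 + 1" "e * d \<le> l * (r0 + 1 - h)"
    and w: "int r0 \<le> 2 ^ w" "int (m + N + 1 + (h * l + 1) * d) \<le> 2 ^ w" "int (n + 1 + m + N + (h * l + 1)) \<le> 2 ^ w" "K \<le> w"
  shows "runs w (Params A q) s xs r ys (K * 4 + 30) (\<lambda>s' xs' r' ys'.
    xs' = xs \<and> r' = r \<and> ys' = ys \<and> frame {16, 17, 18, 19, 24, 29, 30, 31, 32} s s'
    \<and> s' 16 0 = int r0 \<and> s' 17 0 = int K \<and> s' 18 0 = 2 ^ K \<and> s' 19 0 = int (m + N + 1) \<and> s' 29 0 = int (h * l)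
    \<and> s' 30 0 = int (n + 1 + m + N) \<and> s' 31 0 = int (m + N + 1 + (h * l + 1) * d) \<and> s' 32 0 = int (n + 1 + m + N + (h * l + 1)))"
    (is "runs _ _ _ _ _ _ _ ?Q")
proof -
  let ?X = "{16, 17, 18, 19, 24, 29, 30, 31, 32} :: nat set"
  define u where "u = update (update (update (update (update (update (update (update s 16 0 (int r0)) 17 0 (int K)) 19 0 (int (m + N + 1)))
    29 0 (int (h * l))) 30 0 (int (n + 1 + m + N))) 31 0 (int (m + N + 1 + (h * l + 1) * d))) 32 0 (int (n + 1 + m + N + (h * l + 1)))) 18 0 1"
  have Kint: "int l * (int r0 + 1 - int h) - int e * int d = int K"
    using h by (simp add: K_def of_nat_diff)
  have r0: "int A * int d div int q = int r0" by (simp add: r0_def zdiv_int)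
  have hd: "int d div 2 = int h" by (simp add: h_def zdiv_int)
  have "K < 2 ^ K" by (rule less_exp)
  also have "\<dots> \<le> (2::nat) ^ w" using w(4) by (intro power_increasing) auto
  finally have Kw: "int K \<le> 2 ^ w" by (metis less_imp_le of_nat_le_iff of_nat_numeral of_nat_power)
  let ?I = "\<lambda>i s' xs' r' ys'. xs' = xs \<and> r' = r \<and> ys' = ys \<and> frame {18, 24} u s' \<and> s' 18 0 = 2 ^ i"
  have loop: "runs w (For 24 (Var 17) (Set_var 18 (Mul (Lit 2) (Var 18)))) u xs r ys (K * 4 + 3) ?Q"
  proof (rule runs_For[where n = K and k = 1 and I = ?I])
    fix i s1 xs1 r1 ys1
    assume i: "i < K" and I: "?I i s1 xs1 r1 ys1" and v: "s1 24 0 = int i"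
    have "(2::int) ^ Suc i \<le> 2 ^ w" using i w by (intro power_increasing) auto
    then show "runs w (Set_var 18 (Mul (Lit 2) (Var 18))) s1 xs1 r1 ys1 1 (\<lambda>s' xs' r' ys'. s' 24 0 = int i
        \<and> ?I (Suc i) (update s' 24 0 (int (Suc i))) xs' r' ys')"
      by (intro runs_Set_varI) (use I v in auto)
  next
    fix s1 xs1 r1 ys1
    assume I: "?I K s1 xs1 r1 ys1"
    then have fr: "frame {18, 24} u s1" by simp
    have "frame ?X s u" by (simp add: u_def)
    then have fr': "frame ?X s s1" using fr by (rule frame_trans) auto
    have "s1 b = u b" if "b \<notin> {18, 24}" for b using frameD[OF fr that] .
    then have "s1 16 0 = int r0 \<and> s1 17 0 = int K \<and> s1 19 0 = int (m + N + 1) \<and> s1 29 0 = int (h * l)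
      \<and> s1 30 0 = int (n + 1 + m + N) \<and> s1 31 0 = int (m + N + 1 + (h * l + 1) * d) \<and> s1 32 0 = int (n + 1 + m + N + (h * l + 1))"
      by (simp add: u_def)
    with I fr' show "?Q s1 xs1 r1 ys1" by simp
  next
    fix i s1 xs1 r1 ys1
    assume "?I i s1 xs1 r1 ys1"
    then show "val (Var 17) s1 = int K" using frameD[of "{18, 24}" u s1 17] by (simp add: u_def)
  qed (use Kw in \<open>auto simp: u_def\<close>)
  have lt: "int (m + N + 1) \<le> 2 ^ w" "int (h * l) \<le> 2 ^ w" "int (n + 1 + m + N) \<le> 2 ^ w"
  proof -
    have "m + N + 1 \<le> m + N + 1 + (h * l + 1) * d" "h * l \<le> n + 1 + m + N + (h * l + 1)"
      "n + 1 + m + N \<le> n + 1 + m + N + (h * l + 1)" by simp_all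
    then show "int (m + N + 1) \<le> 2 ^ w" "int (h * l) \<le> 2 ^ w" "int (n + 1 + m + N) \<le> 2 ^ w"
      using w(2,3) by (meson of_nat_le_iff order_trans)+
  qed
  have p1: "(1::int) \<le> 2 ^ w" by simp
  let ?s1 = "update s 16 0 (int r0)"
  let ?s2 = "update ?s1 17 0 (int K)"
  let ?s3 = "update ?s2 19 0 (int (m + N + 1))"
  let ?s4 = "update ?s3 29 0 (int (h * l))"
  let ?s5 = "update ?s4 30 0 (int (n + 1 + m + N))"
  let ?s6 = "update ?s5 31 0 (int (m + N + 1 + (h * l + 1) * d))"
  let ?s7 = "update ?s6 32 0 (int (n + 1 + m + N + (h * l + 1)))"
  have V1: "val (Div (Mul (Lit (int A)) (Var 3)) (Lit (int q))) s = int r0" using s r0 by simp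
  have V2: "val (Sub (Mul (Var 11) (Sub (Add (Var 16) (Lit 1)) (Div (Var 3) (Lit 2)))) (Mul (Var 7) (Var 3))) ?s1 = int K"
    using s Kint by (simp add: hd)
  have V3: "val (Add (Add (Var 0) (Var 10)) (Lit 1)) ?s2 = int (m + N + 1)" using s by simp
  have V4: "val (Mul (Div (Var 3) (Lit 2)) (Var 11)) ?s3 = int (h * l)" using s by (simp add: hd)
  have V5: "val (Add (Add (Add (Var 1) (Lit 1)) (Var 0)) (Var 10)) ?s4 = int (n + 1 + m + N)" using s by simp
  have V6: "val (Add (Var 19) (Mul (Add (Var 29) (Lit 1)) (Var 3))) ?s5 = int (m + N + 1 + (h * l + 1) * d)"
    using s by (simp add: algebra_simps)
  have V7: "val (Add (Var 30) (Add (Var 29) (Lit 1))) ?s6 = int (n + 1 + m + N + (h * l + 1))" by simp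
  have V8: "val (Lit 1) ?s7 = 1" by simp
  have "runs w (Params A q) s xs r ys (1 + 1 + (1 + 1 + (1 + 1 + (1 + 1 + (1 + 1 + (1 + 1 + (1 + 1 + (1 + 1 + (K * 4 + 3)))))))) ) ?Q"
    unfolding Params_def
    apply (rule runs_SeqI, rule runs_Set_varI, unfold V1)
     apply (rule runs_SeqI, rule runs_Set_varI, unfold V2)
      apply (rule runs_SeqI, rule runs_Set_varI, unfold V3)
       apply (rule runs_SeqI, rule runs_Set_varI, unfold V4)
        apply (rule runs_SeqI, rule runs_Set_varI, unfold V5)
         apply (rule runs_SeqI, rule runs_Set_varI, unfold V6)
          apply (rule runs_SeqI, rule runs_Set_varI, unfold V7)
           apply (rule runs_SeqI, rule runs_Set_varI, unfold V8)
            apply (rule loop[unfolded u_def])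
    by (simp_all only: abs_of_nat abs_one lt w Kw p1)
  then show ?thesis by (rule runs_mono) auto
qed

text \<open>Each number grows by doubling and adding a flip, most significant bit first, which is
  the order of \<open>bits_nat\<close>.\<close>

definition Sample :: "nat \<Rightarrow> exp \<Rightarrow> exp \<Rightarrow> com" where
  "Sample X cnt bits = For 24 cnt (Seq (Assign X (Var 24) (Lit 0))
     (For 25 bits (Seq (Flip 28 (Lit 0)) (Assign X (Var 24) (Add (Mul (Lit 2) (Cell X (Var 24))) (Var 28))))))"

lemma runs_Sample:
  assumes val: "\<And>s'. frame {24, 25, 28, X} s s' \<Longrightarrow> val cnt s' = int n \<and> val bits s' = int b"
    and X: "X \<noteq> 24" "X \<noteq> 25" "X \<noteq> 28" and len: "n * b \<le> length r" and w: "b \<le> w" "int n \<le> 2 ^ w"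
  shows "runs w (Sample X cnt bits) s xs r ys (n * (b * 6 + 8) + 3) (\<lambda>s' xs' r' ys'.
    xs' = xs \<and> r' = drop (n * b) r \<and> ys' = ys \<and> frame {24, 25, 28, X} s s' \<and> (\<forall>j<n. s' X (int j) = int (draw n b r j)))"
    (is "runs _ _ _ _ _ _ _ ?Q")
proof -
  let ?F = "\<lambda>s' xs' ys'. xs' = xs \<and> ys' = ys \<and> frame {24, 25, 28, X} s s'"
  let ?D = "\<lambda>j s'. \<forall>j'<j. s' X (int j') = int (draw n b r j')"
  let ?I = "\<lambda>j s' xs' r' ys'. ?F s' xs' ys' \<and> r' = drop (j * b) r \<and> ?D j s'"
  let ?J = "\<lambda>j i s' xs' r' ys'. s' 24 0 = int j \<and> ?F s' xs' ys' \<and> r' = drop (j * b + i) r \<and> ?D j s'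
     \<and> s' X (int j) = int (bits_nat (take i (drop (j * b) r)))"
  let ?body = "Seq (Flip 28 (Lit 0)) (Assign X (Var 24) (Add (Mul (Lit 2) (Cell X (Var 24))) (Var 28)))"
  have bw: "int b \<le> 2 ^ w"
  proof -
    have "b < 2 ^ b" by (rule less_exp)
    also have "\<dots> \<le> (2::nat) ^ w" using w by (intro power_increasing) auto
    finally show ?thesis by (metis less_imp_le of_nat_le_iff of_nat_numeral of_nat_power)
  qed
  show ?thesis unfolding Sample_def
  proof (rule runs_For[where n = n and k = "b * 6 + 5" and I = ?I])
    fix j s1 xs1 r1 ys1
    assume j: "j < n" and I: "?I j s1 xs1 r1 ys1" and v24: "s1 24 0 = int j"
    have "Suc j * b \<le> n * b" using j by (intro mult_le_mono1) simp
    then have jb: "j * b + b \<le> length r" using len by simp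
    show "runs w (Seq (Assign X (Var 24) (Lit 0)) (For 25 bits ?body)) s1 xs1 r1 ys1 (b * 6 + 5)
      (\<lambda>s' xs' r' ys'. s' 24 0 = int j \<and> ?I (Suc j) (update s' 24 0 (int (Suc j))) xs' r' ys')"
    proof (rule runs_Seq[where ?T1.0 = 1 and ?T2.0 = "b * 6 + 3"], rule runs_Assign)
      show "runs w (For 25 bits ?body) (update s1 X (val (Var 24) s1) (val (Lit 0) s1)) xs1 r1 ys1 (b * 6 + 3)
        (\<lambda>s' xs' r' ys'. s' 24 0 = int j \<and> ?I (Suc j) (update s' 24 0 (int (Suc j))) xs' r' ys')"
      proof (rule runs_For[where n = b and k = 3 and I = "?J j"])
        fix i s2 xs2 r2 ys2
        assume i: "i < b" and J: "?J j i s2 xs2 r2 ys2" and v25: "s2 25 0 = int i"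
        have ji: "j * b + i < length r" using jb i by simp
        have r2: "r2 = r ! (j * b + i) # drop (Suc (j * b + i)) r" using J ji by (simp add: Cons_nth_drop_Suc)
        let ?x = "r ! (j * b + i)"
        have tk: "take (Suc i) (drop (j * b) r) = take i (drop (j * b) r) @ [?x]"
          using ji by (simp add: take_Suc_conv_app_nth)
        have bn: "int (bits_nat (take (Suc i) (drop (j * b) r))) = 2 * int (bits_nat (take i (drop (j * b) r))) + of_bool ?x"
          unfolding tk by simp
        have "bits_nat (take (Suc i) (drop (j * b) r)) < 2 ^ length (take (Suc i) (drop (j * b) r))" by (rule bits_nat_less)
        also have "\<dots> \<le> 2 ^ w" using i w by (intro power_increasing) auto
        finally have le: "int (bits_nat (take (Suc i) (drop (j * b) r))) \<le> 2 ^ w"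
          by (metis less_imp_le of_nat_le_iff of_nat_numeral of_nat_power)
        show "runs w ?body s2 xs2 r2 ys2 3 (\<lambda>s' xs' r' ys'. s' 25 0 = int i \<and> ?J j (Suc i) (update s' 25 0 (int (Suc i))) xs' r' ys')"
          unfolding r2
        proof (rule runs_Seq[where ?T1.0 = 1 and ?T2.0 = 1], rule runs_Flip, rule runs_Assign)
          let ?s3 = "update s2 28 (val (Lit 0) s2) (of_bool ?x)"
          have v: "val (Add (Mul (Lit 2) (Cell X (Var 24))) (Var 28)) ?s3 = int (bits_nat (take (Suc i) (drop (j * b) r)))"
            unfolding bn using J X by simp
          show "\<bar>val (Add (Mul (Lit 2) (Cell X (Var 24))) (Var 28)) ?s3\<bar> \<le> 2 ^ w" unfolding v using le by simp
          show "update ?s3 X (val (Var 24) ?s3) (val (Add (Mul (Lit 2) (Cell X (Var 24))) (Var 28)) ?s3) 25 0 = int i \<and>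
             ?J j (Suc i) (update (update ?s3 X (val (Var 24) ?s3) (val (Add (Mul (Lit 2) (Cell X (Var 24))) (Var 28)) ?s3)) 25 0 (int (Suc i)))
               xs2 (drop (Suc (j * b + i)) r) ys2"
            unfolding v using J X v25 by auto
        qed simp_all
      next
        fix s2 xs2 r2 ys2
        assume J: "?J j b s2 xs2 r2 ys2"
        then show "s2 24 0 = int j \<and> ?I (Suc j) (update s2 24 0 (int (Suc j))) xs2 r2 ys2"
          using X j by (auto simp: less_Suc_eq draw_def add.commute)
      next
        fix i s2 xs2 r2 ys2
        assume "?J j i s2 xs2 r2 ys2"
        then show "val bits s2 = int b" using val by blast
      qed (use I v24 X bw in auto)
    qed simp_all
  next
    fix j s1 xs1 r1 ys1
    assume "?I j s1 xs1 r1 ys1"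
    then show "val cnt s1 = int n" using val by blast
  qed (use w in auto)
qed

text \<open>Both branches are evaluated and weighted with 0 or 1; the double \<open>Eq\<close> turns
  any nonzero condition into 1. A lookup in the discarded branch may fall outside the filled range,
  which is harmless because stores are total.\<close>

definition ITE :: "exp \<Rightarrow> exp \<Rightarrow> exp \<Rightarrow> exp" where
  "ITE c e e' = Add (Mul (Eq (Eq c (Lit 0)) (Lit 0)) e) (Mul (Eq c (Lit 0)) e')"

lemma val_ITE [simp]: "val (ITE c e e') s = (if val c s \<noteq> 0 then val e s else val e' s)"
  by (simp add: ITE_def)

definition bit_exp :: "exp \<Rightarrow> exp \<Rightarrow> exp" where
  "bit_exp c x = Mod (Div (Cell 14 (addr (Div c (Var 11)) x)) (Cell 15 (Mod c (Var 11)))) (Lit 2)"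

definition prim_exp :: exp where
  "prim_exp = ITE (Less (Var 24) (Add (Var 0) (Var 10)))
     (ITE (Eq (Var 25) (Add (Add (Var 1) (Lit 1)) (Var 24)))
       (ITE (Less (Var 24) (Var 0)) (Lit 4) (Lit 1))
       (ITE (Mul (Less (Var 25) (Add (Var 1) (Lit 1))) (Less (Var 24) (Var 0)))
         (Mul (Lit 2) (ITE (Eq (Var 25) (Var 1)) (Cell 5 (Var 24)) (Cell 4 (Add (Mul (Var 24) (Var 1)) (Var 25)))))
         (Lit 0)))
     (Eq (Var 25) (Var 1))"

definition entry_exp :: exp where
  "entry_exp = (let c = Div (Sub (Var 24) (Var 19)) (Var 3) in
     ITE (Less (Var 24) (Var 19)) (ITE (Less (Var 25) (Var 30)) prim_exp (Lit 0))
       (ITE (Less (Var 25) (Var 30))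
         (ITE (Less c (Var 29))
           (ITE (Eq (Var 25) (Var 1)) (Cell 22 c)
             (ITE (Less (Add (Var 1) (Var 0)) (Var 25)) (bit_exp c (Sub (Var 25) (Add (Add (Var 1) (Lit 1)) (Var 0)))) (Lit 0)))
           (Cell 23 (Var 25)))
         (ITE (Eq (Var 25) (Add (Var 30) c)) (ITE (Less c (Var 29)) (Lit 2) (Var 18)) (Lit 0))))"

definition Syndrome :: com where
  "Syndrome = For 24 (Var 29) (Seq (Assign 22 (Var 24) (Lit 0))
     (For 25 (Var 16) (Assign 22 (Var 24) (Add (Cell 22 (Var 24)) (bit_exp (Var 24) (Cell 20 (Var 25)))))))"

definition Hash_cols :: com where
  "Hash_cols = For 25 (Var 30) (Seq (Assign 23 (Var 25) (Lit 0))
     (For 24 (Var 19) (Assign 23 (Var 25) (Add (Cell 23 (Var 25)) (Mul (Cell 21 (Var 24)) prim_exp)))))"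

definition Output :: com where
  "Output = Seq (Write (Var 31)) (Seq (Write (Var 32)) (Seq (Write (Var 2))
     (For 24 (Var 31) (For 25 (Var 32) (Write entry_exp)))))"

section \<open>Correctness of the computed matrix entries\<close>

context reduction
begin

text \<open>What memory must hold before the matrix is computed. The remaining stages write to
  arrays 22 to 25 only, so by \<open>ctx_frame\<close> this persists to the end.\<close>

definition ctx :: "nat \<Rightarrow> nat \<Rightarrow> store \<Rightarrow> bool" where
  "ctx k st s \<longleftrightarrow> s 0 0 = int m \<and> s 1 0 = int n \<and> s 2 0 = int k \<and> s 3 0 = int d \<and> s 9 0 = int st \<and> s 10 0 = int N
    \<and> s 11 0 = int l \<and> s 16 0 = int r \<and> s 18 0 = int Q \<and> s 19 0 = int V \<and> s 29 0 = int (d div 2 * l) \<and> s 30 0 = int C1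
    \<and> s 31 0 = int M \<and> s 32 0 = int C
    \<and> (\<forall>i<m. \<forall>j<n. s 4 (int i * int n + int j) = g i j) \<and> (\<forall>i<m. s 5 (int i) = g i n)
    \<and> tab st pow_odd ({..<d div 2} \<times> {..<N}) (s 14) \<and> (\<forall>b \<le> l. s 15 (int b) = 2 ^ b)
    \<and> (\<forall>j<r. s 20 (int j) = int (f j)) \<and> (\<forall>i<V. s 21 (int i) = int (a i))"

lemma ctx_frame: "ctx k st s \<Longrightarrow> frame {22, 23, 24, 25} s s' \<Longrightarrow> ctx k st s'"
proof -
  assume c: "ctx k st s" and fr: "frame {22, 23, 24, 25} s s'"
  have "s' b = s b" if "b \<notin> {22, 23, 24, 25}" for b using frameD[OF fr that] .
  then have "s' 0 = s 0" "s' 1 = s 1" "s' 2 = s 2" "s' 3 = s 3" "s' 9 = s 9" "s' 10 = s 10" "s' 11 = s 11"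
    "s' 16 = s 16" "s' 18 = s 18" "s' 19 = s 19" "s' 29 = s 29" "s' 30 = s 30" "s' 31 = s 31" "s' 32 = s 32"
    "s' 4 = s 4" "s' 5 = s 5" "s' 14 = s 14" "s' 15 = s 15" "s' 20 = s 20" "s' 21 = s 21"
    by simp_all
  then show ?thesis using c unfolding ctx_def by simp
qed

lemma val_bit_exp:
  assumes c: "ctx k st s" and v: "val ce s = int c" "val xe s = int x" and lt: "c < d div 2 * l" "x < N"
  shows "val (bit_exp ce xe) s = parity_bit c x"
proof -
  have l: "l > 0" using lt(1) by (cases l) auto
  have s: "s 9 0 = int st" "s 11 0 = int l" and t: "tab st pow_odd ({..<d div 2} \<times> {..<N}) (s 14)" "\<And>b. b \<le> l \<Longrightarrow> s 15 (int b) = 2 ^ b"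
    using c by (auto simp: ctx_def)
  have "c div l < d div 2" using lt(1) by (simp add: less_mult_imp_div_less)
  then have p: "s 14 (int (c div l) * int st + int x) = int (pow_odd (c div l) x)" using t(1) lt(2) by (auto simp: tab_def)
  have b: "s 15 (int (c mod l)) = 2 ^ (c mod l)" using t(2)[of "c mod l"] l by (simp add: less_imp_le)
  have "val (bit_exp ce xe) s = int (pow_odd (c div l) x) div 2 ^ (c mod l) mod 2"
    unfolding bit_exp_def val.simps v using p b s by (simp add: zdiv_int zmod_int)
  then show ?thesis by (simp add: parity_bit_def pow_odd_def zdiv_int zmod_int)
qed

lemma val_prim_exp:
  assumes c: "ctx k st s" and v: "s 24 0 = int i" "s 25 0 = int j" and lt: "i < V" "j < C1"
  shows "val prim_exp s = prim i j"
proof -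
  have s: "s 0 0 = int m" "s 1 0 = int n" "s 10 0 = int N"
    and G: "\<And>i j. i < m \<Longrightarrow> j < n \<Longrightarrow> s 4 (int i * int n + int j) = g i j" and t: "\<And>i. i < m \<Longrightarrow> s 5 (int i) = g i n"
    using c by (auto simp: ctx_def)
  have 1: "int i < int m + int N \<longleftrightarrow> i < m + N" "int j = int n + 1 + int i \<longleftrightarrow> j = n + 1 + i" "int j < int n + 1 \<longleftrightarrow> j \<le> n" by linarith+
  show ?thesis
  proof (cases "i < m \<and> j \<le> n")
    case True
    then show ?thesis unfolding prim_exp_def prim_def using v s G[of i j] t[of i] 1 by (cases "j = n") simp_all
  next
    case False
    then show ?thesis unfolding prim_exp_def prim_def using v s 1 by auto
  qed
qed

lemma val_entry_exp:
  assumes c: "ctx k st s" and v: "s 24 0 = int i" "s 25 0 = int j" and lt: "i < M" "j < C"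
    and syn: "\<And>c. c < d div 2 * l \<Longrightarrow> s 22 (int c) = syndrome c" and h: "\<And>j. j < C1 \<Longrightarrow> s 23 (int j) = hash_col j"
  shows "val entry_exp s = entry i j"
proof -
  have s: "s 0 0 = int m" "s 1 0 = int n" "s 3 0 = int d" "s 18 0 = int Q" "s 19 0 = int V" "s 29 0 = int (d div 2 * l)" "s 30 0 = int C1"
    using c by (auto simp: ctx_def)
  show ?thesis
  proof (cases "i < V")
    case True
    then show ?thesis unfolding entry_exp_def entry_def Let_def using val_prim_exp[OF c v True] v s by simp
  next
    case False
    let ?e = "Div (Sub (Var 24) (Var 19)) (Var 3)"
    define c' where "c' = (i - V) div d"
    have e: "val ?e s = int c'" using False v s unfolding c'_def by (simp add: zdiv_int of_nat_diff)
    let ?x = "Sub (Var 25) (Add (Add (Var 1) (Lit 1)) (Var 0))"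
    have b: "val (bit_exp ?e ?x) s = parity_bit c' (j - (n + 1 + m))" if "c' < d div 2 * l" "n + 1 + m \<le> j" "j < C1"
    proof (rule val_bit_exp[OF c e _ that(1)])
      show "val ?x s = int (j - (n + 1 + m))" using v s that(2) by (simp add: of_nat_diff)
      show "j - (n + 1 + m) < N" using that by (simp add: C1_def)
    qed
    have 2: "int n + int m < int j \<longleftrightarrow> n + 1 + m \<le> j" by linarith
    have 3: "int j = int C1 + int c' \<longleftrightarrow> j = C1 + c'" by linarith
    have 4: "int c' < int (d div 2 * l) \<longleftrightarrow> c' < d div 2 * l" by (rule of_nat_less_iff)
    show ?thesis unfolding entry_exp_def entry_def Let_def c'_def[symmetric] val_ITE check_def modulus_def
      using False v s e b 2 3 4 syn[of c'] h[of j]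
      by (simp del: of_nat_mult)
  qed
qed

lemma runs_Syndrome:
  assumes c: "ctx k st s" and f: "\<And>j. j < r \<Longrightarrow> f j < N" and w: "int (d div 2 * l) \<le> 2 ^ w" "int r \<le> 2 ^ w"
  shows "runs w Syndrome s xs \<rho> ys (d div 2 * l * (r * 4 + 8) + 3) (\<lambda>s' xs' r' ys'. xs' = xs \<and> r' = \<rho> \<and> ys' = ys
    \<and> frame {22, 24, 25} s s' \<and> (\<forall>c < d div 2 * l. s' 22 (int c) = syndrome c))"
    (is "runs _ _ _ _ _ _ _ ?Q")
proof -
  let ?I = "\<lambda>i s' xs' r' ys'. xs' = xs \<and> r' = \<rho> \<and> ys' = ys
    \<and> frame {22, 24, 25} s s' \<and> (\<forall>c < i. s' 22 (int c) = syndrome c)"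
  let ?J = "\<lambda>i j s' xs' r' ys'. ?I i s' xs' r' ys' \<and> s' 24 0 = int i \<and> s' 22 (int i) = (\<Sum>j'<j. parity_bit i (f j'))"
  have ctx': "ctx k st s'" if "frame {22, 24, 25} s s'" for s'
    using ctx_frame[OF c, of s'] that by (auto simp: frame_def)
  have pb: "0 \<le> parity_bit i x \<and> parity_bit i x \<le> 1" for i x
    by (simp add: parity_bit_def)
  show ?thesis unfolding Syndrome_def
  proof (rule runs_For[where n = "d div 2 * l" and k = "r * 4 + 5" and I = ?I])
    fix i s1 xs1 r1 ys1
    assume i: "i < d div 2 * l" and I: "?I i s1 xs1 r1 ys1" and v: "s1 24 0 = int i"
    show "runs w (Seq (Assign 22 (Var 24) (Lit 0))
     (For 25 (Var 16) (Assign 22 (Var 24) (Add (Cell 22 (Var 24)) (bit_exp (Var 24) (Cell 20 (Var 25))))))) s1 xs1 r1 ys1 (r * 4 + 5)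
       (\<lambda>s' xs' r' ys'. s' 24 0 = int i \<and> ?I (Suc i) (update s' 24 0 (int (Suc i))) xs' r' ys')"
    proof (rule runs_Seq[where ?T1.0 = 1 and ?T2.0 = "r * 4 + 3"], rule runs_Assign)
      show "runs w (For 25 (Var 16) (Assign 22 (Var 24) (Add (Cell 22 (Var 24)) (bit_exp (Var 24) (Cell 20 (Var 25))))))
         (update s1 22 (val (Var 24) s1) (val (Lit 0) s1)) xs1 r1 ys1 (r * 4 + 3)
       (\<lambda>s' xs' r' ys'. s' 24 0 = int i \<and> ?I (Suc i) (update s' 24 0 (int (Suc i))) xs' r' ys')"
      proof (rule runs_For[where n = r and k = 1 and I = "?J i"])
        fix j s2 xs2 r2 ys2
        assume j: "j < r" and J: "?J i j s2 xs2 r2 ys2" and v25: "s2 25 0 = int j"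
        have c2: "ctx k st s2" using J ctx' by simp
        have "val (bit_exp (Var 24) (Cell 20 (Var 25))) s2 = parity_bit i (f j)"
          by (rule val_bit_exp[OF c2 _ _ i f[OF j]]) (use J v25 c2 j in \<open>simp_all add: ctx_def\<close>)
        then have e: "val (Add (Cell 22 (Var 24)) (bit_exp (Var 24) (Cell 20 (Var 25)))) s2 = (\<Sum>j'<Suc j. parity_bit i (f j'))"
          using J by simp
        have "0 \<le> (\<Sum>j'<Suc j. parity_bit i (f j'))" using pb by (intro sum_nonneg) auto
        moreover have "(\<Sum>j'<Suc j. parity_bit i (f j')) \<le> (\<Sum>j'<Suc j. 1)" using pb by (intro sum_mono) auto
        moreover have "(\<Sum>j'<Suc j. 1) = int (Suc j)" "int (Suc j) \<le> int r" using j by auto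
        ultimately have le: "\<bar>\<Sum>j'<Suc j. parity_bit i (f j')\<bar> \<le> 2 ^ w" using w(2) by linarith
        show "runs w (Assign 22 (Var 24) (Add (Cell 22 (Var 24)) (bit_exp (Var 24) (Cell 20 (Var 25))))) s2 xs2 r2 ys2 1
          (\<lambda>s' xs' r' ys'. s' 25 0 = int j \<and> ?J i (Suc j) (update s' 25 0 (int (Suc j))) xs' r' ys')"
        proof (rule runs_Assign)
          show "\<bar>val (Add (Cell 22 (Var 24)) (bit_exp (Var 24) (Cell 20 (Var 25)))) s2\<bar> \<le> 2 ^ w" unfolding e by (rule le)
          show "update s2 22 (val (Var 24) s2) (val (Add (Cell 22 (Var 24)) (bit_exp (Var 24) (Cell 20 (Var 25)))) s2) 25 0 = int j \<and>
            ?J i (Suc j) (update (update s2 22 (val (Var 24) s2) (val (Add (Cell 22 (Var 24)) (bit_exp (Var 24) (Cell 20 (Var 25)))) s2)) 25 0 (int (Suc j))) xs2 r2 ys2"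
            unfolding e using J v25 by auto
        qed simp
      next
        fix s2 xs2 r2 ys2
        assume "?J i r s2 xs2 r2 ys2"
        then show "s2 24 0 = int i \<and> ?I (Suc i) (update s2 24 0 (int (Suc i))) xs2 r2 ys2"
          by (auto simp: less_Suc_eq syndrome_def)
      next
        fix j s2 xs2 r2 ys2
        assume "?J i j s2 xs2 r2 ys2"
        then have "ctx k st s2" using ctx' by simp
        then show "val (Var 16) s2 = int r" by (simp add: ctx_def)
      qed (use I v w in auto)
    qed simp_all
  next
    fix i s1 xs1 r1 ys1
    assume "?I i s1 xs1 r1 ys1"
    then have "ctx k st s1" using ctx' by simp
    then show "val (Var 29) s1 = int (d div 2 * l)" by (simp add: ctx_def)
  qed (use w in auto)
qed

text \<open>The sums are not reduced modulo \<open>Q\<close>. Entries of \<open>prim\<close> have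
  absolute value at most 4 and coefficients are below \<open>Q\<close>, whence the requirement on
  \<open>V * (4 * Q)\<close>.\<close>

lemma runs_Hash_cols:
  assumes c: "ctx k st s" and a: "\<And>i. i < V \<Longrightarrow> a i < Q" and g: "\<And>i j. i < m \<Longrightarrow> j \<le> n \<Longrightarrow> \<bar>g i j\<bar> \<le> 1"
    and w: "int C1 \<le> 2 ^ w" "int (V * (4 * Q)) \<le> 2 ^ w" "int V \<le> 2 ^ w"
  shows "runs w Hash_cols s xs \<rho> ys (C1 * (V * 4 + 8) + 3) (\<lambda>s' xs' r' ys'. xs' = xs \<and> r' = \<rho> \<and> ys' = ys
    \<and> frame {23, 24, 25} s s' \<and> (\<forall>j < C1. s' 23 (int j) = hash_col j))"
    (is "runs _ _ _ _ _ _ _ ?Q")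
proof -
  let ?I = "\<lambda>j s' xs' r' ys'. xs' = xs \<and> r' = \<rho> \<and> ys' = ys
    \<and> frame {23, 24, 25} s s' \<and> (\<forall>j' < j. s' 23 (int j') = hash_col j')"
  let ?J = "\<lambda>j i s' xs' r' ys'. ?I j s' xs' r' ys' \<and> s' 25 0 = int j \<and> s' 23 (int j) = (\<Sum>i'<i. int (a i') * prim i' j)"
  let ?e = "Add (Cell 23 (Var 25)) (Mul (Cell 21 (Var 24)) prim_exp)"
  have ctx': "ctx k st s'" if "frame {23, 24, 25} s s'" for s'
    using ctx_frame[OF c, of s'] that by (auto simp: frame_def)
  have pb: "\<bar>prim i j\<bar> \<le> 4" for i j
    using g[of i j] by (auto simp: prim_def abs_mult)
  show ?thesis unfolding Hash_cols_def
  proof (rule runs_For[where n = C1 and k = "V * 4 + 5" and I = ?I])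
    fix j s1 xs1 r1 ys1
    assume j: "j < C1" and I: "?I j s1 xs1 r1 ys1" and v: "s1 25 0 = int j"
    show "runs w (Seq (Assign 23 (Var 25) (Lit 0)) (For 24 (Var 19) (Assign 23 (Var 25) ?e))) s1 xs1 r1 ys1 (V * 4 + 5)
       (\<lambda>s' xs' r' ys'. s' 25 0 = int j \<and> ?I (Suc j) (update s' 25 0 (int (Suc j))) xs' r' ys')"
    proof (rule runs_Seq[where ?T1.0 = 1 and ?T2.0 = "V * 4 + 3"], rule runs_Assign)
      show "runs w (For 24 (Var 19) (Assign 23 (Var 25) ?e)) (update s1 23 (val (Var 25) s1) (val (Lit 0) s1)) xs1 r1 ys1 (V * 4 + 3)
       (\<lambda>s' xs' r' ys'. s' 25 0 = int j \<and> ?I (Suc j) (update s' 25 0 (int (Suc j))) xs' r' ys')"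
      proof (rule runs_For[where n = V and k = 1 and I = "?J j"])
        fix i s2 xs2 r2 ys2
        assume i: "i < V" and J: "?J j i s2 xs2 r2 ys2" and v24: "s2 24 0 = int i"
        have c2: "ctx k st s2" using J ctx' by simp
        have "val prim_exp s2 = prim i j"
          by (rule val_prim_exp[OF c2 v24 _ i j]) (use J in simp)
        moreover have "s2 21 (int i) = int (a i)" using c2 i by (simp add: ctx_def)
        ultimately have e: "val ?e s2 = (\<Sum>i'<Suc i. int (a i') * prim i' j)"
          using J v24 by simp
        have "\<bar>\<Sum>i'<Suc i. int (a i') * prim i' j\<bar> \<le> (\<Sum>i'<Suc i. \<bar>int (a i') * prim i' j\<bar>)" by (rule sum_abs)
        also have "\<dots> \<le> (\<Sum>i'<Suc i. int Q * 4)"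
        proof (rule sum_mono)
          fix i' assume "i' \<in> {..<Suc i}"
          then have "int (a i') \<le> int Q" using a[of i'] i by simp
          then show "\<bar>int (a i') * prim i' j\<bar> \<le> int Q * 4"
            using pb[of i' j] unfolding abs_mult by (intro mult_mono) auto
        qed
        also have "\<dots> = int (Suc i * (4 * Q))" by (simp add: algebra_simps)
        also have "\<dots> \<le> int (V * (4 * Q))" using i by (intro of_nat_mono mult_le_mono1) simp
        also have "\<dots> \<le> 2 ^ w" by (rule w(2))
        finally have le: "\<bar>\<Sum>i'<Suc i. int (a i') * prim i' j\<bar> \<le> 2 ^ w" .
        show "runs w (Assign 23 (Var 25) ?e) s2 xs2 r2 ys2 1
          (\<lambda>s' xs' r' ys'. s' 24 0 = int i \<and> ?J j (Suc i) (update s' 24 0 (int (Suc i))) xs' r' ys')"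
        proof (rule runs_Assign)
          show "\<bar>val ?e s2\<bar> \<le> 2 ^ w" unfolding e by (rule le)
          show "update s2 23 (val (Var 25) s2) (val ?e s2) 24 0 = int i \<and>
            ?J j (Suc i) (update (update s2 23 (val (Var 25) s2) (val ?e s2)) 24 0 (int (Suc i))) xs2 r2 ys2"
            unfolding e using J v24 by auto
        qed simp
      next
        fix s2 xs2 r2 ys2
        assume "?J j V s2 xs2 r2 ys2"
        then show "s2 25 0 = int j \<and> ?I (Suc j) (update s2 25 0 (int (Suc j))) xs2 r2 ys2"
          by (auto simp: less_Suc_eq hash_col_def)
      next
        fix i s2 xs2 r2 ys2
        assume "?J j i s2 xs2 r2 ys2"
        then have "ctx k st s2" using ctx' by simp
        then show "val (Var 19) s2 = int V" by (simp add: ctx_def)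
      qed (use I v w in auto)
    qed simp_all
  next
    fix j s1 xs1 r1 ys1
    assume "?I j s1 xs1 r1 ys1"
    then have "ctx k st s1" using ctx' by simp
    then show "val (Var 30) s1 = int C1" by (simp add: ctx_def)
  qed (use w in auto)
qed

lemma encode_svp_B:
  "encode_svp B k = [int M, int C, int k] @ concat (map (\<lambda>i. map (\<lambda>j. entry i j) [0..<C]) [0..<M])"
proof -
  have "mat_to_list B = map (\<lambda>i. map (\<lambda>j. entry i j) [0..<C]) [0..<M]"
    unfolding mat_to_list_def B_dims by (intro map_cong refl) (auto simp: B_def)
  then show ?thesis by (simp add: encode_svp_def)
qed

lemma runs_Output:
  assumes c: "ctx k st s" and syn: "\<And>c. c < d div 2 * l \<Longrightarrow> s 22 (int c) = syndrome c" and h: "\<And>j. j < C1 \<Longrightarrow> s 23 (int j) = hash_col j"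
    and w: "int M \<le> 2 ^ w" "int C \<le> 2 ^ w"
  shows "runs w Output s xs \<rho> [] (M * (C * 4 + 6) + 9) (\<lambda>s' xs' r' ys'. ys' = encode_svp B k)"
proof -
  let ?E = "\<lambda>i. concat (map (\<lambda>i. map (\<lambda>j. entry i j) [0..<C]) [0..<i])"
  let ?h = "[int M, int C, int k]"
  let ?I = "\<lambda>i s' xs' r' ys'. frame {24, 25} s s' \<and> ys' = ?h @ ?E i"
  let ?J = "\<lambda>i j s' xs' r' ys'. s' 24 0 = int i \<and> frame {24, 25} s s' \<and> ys' = (?h @ ?E i) @ map (\<lambda>j. entry i j) [0..<j]"
  have ctx': "ctx k st s' \<and> s' 22 = s 22 \<and> s' 23 = s 23" if "frame {24, 25} s s'" for s'
    using ctx_frame[OF c, of s'] that by (auto simp: frame_def)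
  have s: "s 31 0 = int M" "s 32 0 = int C" "s 2 0 = int k" using c by (simp_all add: ctx_def)
  have loop: "runs w (For 24 (Var 31) (For 25 (Var 32) (Write entry_exp))) s xs \<rho> ?h (M * (C * 4 + 6) + 3) (\<lambda>s' xs' r' ys'. ys' = encode_svp B k)"
  proof (rule runs_For[where n = M and k = "C * 4 + 3" and I = ?I])
    fix i s1 xs1 r1 ys1
    assume i: "i < M" and I: "?I i s1 xs1 r1 ys1" and v: "s1 24 0 = int i"
    show "runs w (For 25 (Var 32) (Write entry_exp)) s1 xs1 r1 ys1 (C * 4 + 3)
      (\<lambda>s' xs' r' ys'. s' 24 0 = int i \<and> ?I (Suc i) (update s' 24 0 (int (Suc i))) xs' r' ys')"
    proof (rule runs_For[where n = C and k = 1 and I = "?J i"])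
      fix j s2 xs2 r2 ys2
      assume j: "j < C" and J: "?J i j s2 xs2 r2 ys2" and v25: "s2 25 0 = int j"
      have c2: "ctx k st s2 \<and> s2 22 = s 22 \<and> s2 23 = s 23" using J ctx'[of s2] by blast
      have "val entry_exp s2 = entry i j"
      proof (rule val_entry_exp[OF conjunct1[OF c2] conjunct1[OF J] v25 i j])
        show "s2 22 (int c) = syndrome c" if "c < d div 2 * l" for c using c2 syn[OF that] by simp
        show "s2 23 (int j) = hash_col j" if "j < C1" for j using c2 h[OF that] by simp
      qed
      then show "runs w (Write entry_exp) s2 xs2 r2 ys2 1
        (\<lambda>s' xs' r' ys'. s' 25 0 = int j \<and> ?J i (Suc j) (update s' 25 0 (int (Suc j))) xs' r' ys')"
        by (intro runs_Write) (use J v25 in simp_all)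
    next
      fix j s2 xs2 r2 ys2
      assume "?J i j s2 xs2 r2 ys2"
      then have "ctx k st s2" using ctx'[of s2] by blast
      then show "val (Var 32) s2 = int C" by (simp add: ctx_def)
    qed (use I v w in auto)
  next
    fix i s1 xs1 r1 ys1
    assume "?I i s1 xs1 r1 ys1"
    then have "ctx k st s1" using ctx'[of s1] by blast
    then show "val (Var 31) s1 = int M" by (simp add: ctx_def)
  next
    fix s1 xs1 r1 ys1
    assume "?I M s1 xs1 r1 ys1"
    then show "ys1 = encode_svp B k" unfolding encode_svp_B by simp
  qed (use w in auto)
  show ?thesis unfolding Output_def
    by (rule runs_Seq[where ?T1.0 = 1 and ?T2.0 = "M * (C * 4 + 6) + 7"], rule runs_Write,
        rule runs_Seq[where ?T1.0 = 1 and ?T2.0 = "M * (C * 4 + 6) + 5"], rule runs_Write,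
        rule runs_Seq[where ?T1.0 = 1 and ?T2.0 = "M * (C * 4 + 6) + 3"], rule runs_Write)
      (use loop s in simp_all)
qed

end

section \<open>The complete program and its running time\<close>

definition Reduce_instance :: "nat \<Rightarrow> nat \<Rightarrow> nat \<Rightarrow> com" where
  "Reduce_instance C A q = Seq (Read_array 4 (Mul (Var 0) (Var 1))) (Seq (Read_array 5 (Var 0)) (Seq Init_E (Seq (Init_stride C)
     (Seq Init_field (Seq Grow_field (Seq Pow_table (Seq Two_table (Seq (Params A q)
     (Seq (Sample 20 (Var 16) (Var 11)) (Seq (Sample 21 (Var 19) (Var 17)) (Seq Syndrome (Seq Hash_cols Output))))))))))))"

text \<open>If \<open>d \<ge> m\<close> then there are no NO instances, and the one-dimensional lattice of all integers is output.\<close>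

definition Write_trivial :: com where
  "Write_trivial = Seq (Write (Lit 1)) (Seq (Write (Lit 1)) (Seq (Write (Var 2)) (Write (Lit 1))))"

definition Reduction :: "nat \<Rightarrow> nat \<Rightarrow> nat \<Rightarrow> nat \<Rightarrow> com" where
  "Reduction \<gamma> C A q = Seq (Read 0 (Lit 0)) (Seq (Read 1 (Lit 0)) (Seq (Read 2 (Lit 0)) (Seq (Set_var 3 (Mul (Lit (int \<gamma>)) (Var 2)))
     (Cond (Less (Var 3) (Var 0)) (Reduce_instance C A q) Write_trivial))))"

lemma runs_Seq_chain:
  assumes "P s xs r ys" "\<And>s xs r ys. P s xs r ys \<Longrightarrow> runs w c1 s xs r ys T1 P'"
    "\<And>s xs r ys. P' s xs r ys \<Longrightarrow> runs w c2 s xs r ys T2 Q"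
  shows "runs w (Seq c1 c2) s xs r ys (1 + T1 + T2) Q"
  by (rule runs_SeqI, rule runs_mono[OF assms(2)[OF assms(1)]]) (use assms(3) in auto)

text \<open>Separated from the program so that the products from nested loops are plain variables
  and linear arithmetic suffices.\<close>

lemma time_sum_le:
  fixes mn m e C L N p1 l K p2 p3 p4 p5 p6 Y Y2 Y3 :: nat
  assumes "mn \<le> Y" "m \<le> Y" "e \<le> Y" "C \<le> Y" "L \<le> 21 * Y3" "N \<le> Y" "p1 \<le> 10 * Y2" "l \<le> Y" "K \<le> Y"
    "p2 \<le> 14 * Y2" "p3 \<le> 14 * Y2" "p4 \<le> 12 * Y2" "p5 \<le> 12 * Y2" "p6 \<le> 10 * Y2"
    "Y \<le> Y2" "Y2 \<le> Y3" "1 \<le> Y2"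
  shows "1 + (mn * 4 + 3) + (1 + (m * 4 + 3) + (1 + (e * 4 + 6) + (1 + (C * 4 + 10) + (1 + 50
     + (1 + (L + 1) + (1 + (N * 6 + p1 + 10) + (1 + (l * 4 + 6)
     + (1 + (K * 4 + 30) + (1 + (p2 + 3) + (1 + (p3 + 3) + (1 + (p4 + 3) + (1 + (p5 + 3) + (p6 + 9))))))))))))) \<le> 900 * Y3"
  using assms by linarith

text \<open>\<open>Y\<close> bounds all sizes at once. The word length \<open>2 * Y + 2\<close> is
  dictated by the column hashes, whose bound \<open>V * (4 * 2 ^ K)\<close> is at most
  \<open>2 ^ Y * (4 * 2 ^ Y)\<close>.\<close>

locale run_params =
  fixes C A q m n k d e N l h r K S V M Ct Y w :: nat and G :: "nat \<Rightarrow> nat \<Rightarrow> int" and t :: "nat \<Rightarrow> int" and \<rho> :: "bool list"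
  assumes e: "e = log_ceil m" and S: "S = (2 ^ e) ^ C * (2 ^ e) ^ C" and X2: "(2::nat) \<le> (2 ^ e) ^ C"
    and l: "l = 2 ^ level ((2 ^ e) ^ C)" and N: "N = 2 ^ l" and NS: "N \<le> S"
    and h: "h = d div 2" and r: "r = A * d div q" and K: "K = l * (r + 1 - h) - e * d"
    and hr: "h \<le> r + 1" "e * d \<le> l * (r + 1 - h)"
    and V: "V = m + N + 1" and M: "M = V + (h * l + 1) * d" and Ct: "Ct = n + 1 + m + N + (h * l + 1)"
    and len: "r * l + V * K \<le> length \<rho>" and m: "m \<ge> 1"
    and Y: "m * n \<le> Y" "2 * m \<le> Y" "S \<le> Y" "C \<le> Y" "r \<le> Y" "M \<le> Y" "Ct \<le> Y" "K \<le> Y" "d \<le> Y" "e \<le> Y" "1 \<le> Y"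
    and w: "w = 2 * Y + 2"
    and Gb: "\<And>i j. i < m \<Longrightarrow> j < n \<Longrightarrow> G i j \<in> {0, 1}" and tb: "\<And>i. i < m \<Longrightarrow> t i \<in> {0, 1}"
begin

definition g :: "nat \<Rightarrow> nat \<Rightarrow> int" where "g i j = (if j = n then t i else G i j)"

abbreviation "f \<equiv> draw r l \<rho>"
abbreviation "a \<equiv> draw V K (drop (r * l) \<rho>)"

sublocale red: reduction m n N l d r "2 ^ K" g f a .

lemma Y_less: "x \<le> Y \<Longrightarrow> int x \<le> 2 ^ w"
proof -
  assume "x \<le> Y"
  also have "Y < 2 ^ Y" by (rule less_exp)
  also have "\<dots> \<le> 2 ^ w" unfolding w by (intro power_increasing) auto
  finally show ?thesis by (metis less_imp_le of_nat_le_iff of_nat_numeral of_nat_power)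
qed

lemma Y_more: "V \<le> Y" "N \<le> Y" "l \<le> Y" "n + 1 + m + N \<le> Y" "h * l \<le> Y" "m \<le> Y"
proof -
  show "V \<le> Y" using Y(6) unfolding M by simp
  show NY: "N \<le> Y" using NS Y(3) by simp
  show "l \<le> Y" using NY less_exp[of l] unfolding N by linarith
  show "n + 1 + m + N \<le> Y" "h * l \<le> Y" using Y(7) unfolding Ct by simp_all
  show "m \<le> Y" using Y(2) by simp
qed

definition base :: "store \<Rightarrow> bool" where
  "base s \<longleftrightarrow> s 0 0 = int m \<and> s 1 0 = int n \<and> s 2 0 = int k \<and> s 3 0 = int d
     \<and> (\<forall>i<m. \<forall>j<n. s 4 (int i * int n + int j) = g i j) \<and> (\<forall>i<m. s 5 (int i) = g i n)"

lemma base_frame: "base s \<Longrightarrow> frame X s s' \<Longrightarrow> X \<inter> {0, 1, 2, 3, 4, 5} = {} \<Longrightarrow> base s'"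
proof -
  assume b: "base s" and fr: "frame X s s'" and X: "X \<inter> {0, 1, 2, 3, 4, 5} = {}"
  have "s' 0 = s 0" "s' 1 = s 1" "s' 2 = s 2" "s' 3 = s 3" "s' 4 = s 4" "s' 5 = s 5"
    using frameD[OF fr] X by auto
  then show ?thesis using b by (simp add: base_def)
qed

text \<open>The assertions between consecutive stages, each recording what the later stages
  read.\<close>

definition "after_input s xs r' ys \<longleftrightarrow> base s \<and> r' = \<rho> \<and> ys = ([] :: int list)" for xs :: "int list"
definition "after_E s xs r' ys \<longleftrightarrow> after_input s xs r' ys \<and> s 6 0 = 2 ^ e \<and> s 7 0 = int e"
definition "after_stride s xs r' ys \<longleftrightarrow> after_input s xs r' ys \<and> s 7 0 = int e \<and> s 8 0 = int ((2 ^ e) ^ C) \<and> s 9 0 = int S"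
definition "after_init s xs r' ys \<longleftrightarrow> after_stride s xs r' ys \<and> s 10 0 = 2 \<and> s 11 0 = 1
    \<and> tab S xor ({..<2} \<times> {..<2}) (s 12) \<and> tab S nmul ({..<2} \<times> {..<2}) (s 13)"
definition "after_field s xs r' ys \<longleftrightarrow> after_stride s xs r' ys \<and> s 10 0 = int N \<and> s 11 0 = int l \<and> tab S nmul ({..<N} \<times> {..<N}) (s 13)"
definition "after_powers s xs r' ys \<longleftrightarrow> after_stride s xs r' ys \<and> s 10 0 = int N \<and> s 11 0 = int l \<and> tab S pow_odd ({..<d div 2} \<times> {..<N}) (s 14)"
definition "after_twos s xs r' ys \<longleftrightarrow> after_powers s xs r' ys \<and> (\<forall>b \<le> l. s 15 (int b) = 2 ^ b)"
definition "params s \<longleftrightarrow> base s \<and> s 9 0 = int S \<and> s 10 0 = int N \<and> s 11 0 = int l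
    \<and> tab S pow_odd ({..<d div 2} \<times> {..<N}) (s 14) \<and> (\<forall>b \<le> l. s 15 (int b) = 2 ^ b)
    \<and> s 16 0 = int r \<and> s 17 0 = int K \<and> s 18 0 = int (2 ^ K) \<and> s 19 0 = int V \<and> s 29 0 = int (h * l)
    \<and> s 30 0 = int (n + 1 + m + N) \<and> s 31 0 = int M \<and> s 32 0 = int Ct"
definition "after_params s xs r' ys \<longleftrightarrow> params s \<and> r' = \<rho> \<and> ys = ([] :: int list)" for xs :: "int list"
definition "after_code_sample s xs r' ys \<longleftrightarrow> params s \<and> r' = drop (r * l) \<rho> \<and> ys = ([] :: int list)
    \<and> (\<forall>j<r. s 20 (int j) = int (f j))" for xs :: "int list"
definition "after_hash_sample s xs r' ys \<longleftrightarrow> red.ctx k S s \<and> ys = ([] :: int list)" for xs :: "int list" and r' :: "bool list"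
definition "after_syndrome s xs r' ys \<longleftrightarrow> red.ctx k S s \<and> ys = ([] :: int list)
    \<and> (\<forall>c < d div 2 * l. s 22 (int c) = red.syndrome c)" for xs :: "int list" and r' :: "bool list"
definition "after_hash s xs r' ys \<longleftrightarrow> after_syndrome s xs r' ys \<and> (\<forall>j < red.C1. s 23 (int j) = red.hash_col j)"

lemma red_dims: "red.V = V" "red.C1 = n + 1 + m + N" "red.M = M" "red.C = Ct"
  by (simp_all add: red.V_def red.C1_def red.M_def red.C_def red.NC_def V M Ct h)

lemma params_frame: "params s \<Longrightarrow> frame X s s' \<Longrightarrow> X \<inter> {0,1,2,3,4,5,9,10,11,14,15,16,17,18,19,29,30,31,32} = {} \<Longrightarrow> params s'"
proof -
  assume p: "params s" and fr: "frame X s s'" and X: "X \<inter> {0,1,2,3,4,5,9,10,11,14,15,16,17,18,19,29,30,31,32} = {}"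
  have bs: "base s" using p unfolding params_def by (elim conjE)
  have "base s'" by (rule base_frame[OF bs fr]) (use X in auto)
  moreover have "s' 9 = s 9" "s' 10 = s 10" "s' 11 = s 11" "s' 14 = s 14" "s' 15 = s 15" "s' 16 = s 16" "s' 17 = s 17"
    "s' 18 = s 18" "s' 19 = s 19" "s' 29 = s 29" "s' 30 = s 30" "s' 31 = s 31" "s' 32 = s 32"
    using frameD[OF fr] X by auto
  ultimately show ?thesis using p by (simp add: params_def)
qed

lemma step_Init_E: "after_input s xs r' ys \<Longrightarrow> runs w Init_E s xs r' ys (e * 4 + 6) after_E"
proof (rule runs_mono[OF runs_Init_E[of s m, folded e]])
  fix s' xs' r'' ys'
  assume P: "after_input s xs r' ys" and *: "xs' = xs \<and> r'' = r' \<and> ys' = ys \<and> frame {6, 7} s s' \<and> s' 6 0 = 2 ^ e \<and> s' 7 0 = int e"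
  then have fr: "frame {6, 7} s s'" by simp
  have "base s'" using P by (intro base_frame[OF _ fr]) (auto simp: after_input_def)
  then show "after_E s' xs' r'' ys'" using P * by (simp add: after_E_def after_input_def)
qed (use Y_less[OF Y(2)] m in \<open>auto simp: after_input_def base_def\<close>)

lemma step_Init_stride: "after_E s xs r' ys \<Longrightarrow> runs w (Init_stride C) s xs r' ys (C * 4 + 10) after_stride"
proof (rule runs_mono[OF runs_Init_stride[of s "2 ^ e"]])
  show "(int (2 ^ e) ^ C)\<^sup>2 \<le> 2 ^ w" using Y_less[OF Y(3)] by (simp add: S power2_eq_square)
  fix s' xs' r'' ys'
  assume P: "after_E s xs r' ys" and *: "xs' = xs \<and> r'' = r' \<and> ys' = ys \<and> frame {8, 9, 24} s s' \<and> s' 8 0 = int (2 ^ e) ^ C \<and> s' 9 0 = (int (2 ^ e) ^ C)\<^sup>2"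
  then have fr: "frame {8, 9, 24} s s'" by simp
  have "base s'" using P by (intro base_frame[OF _ fr]) (auto simp: after_E_def after_input_def)
  moreover have "s' 8 0 = int ((2 ^ e) ^ C)" "s' 9 0 = int S" using * by (simp_all add: S power2_eq_square)
  moreover have "s' 7 = s 7" by (rule frameD[OF fr]) simp
  ultimately show "after_stride s' xs' r'' ys'" using P * unfolding after_stride_def after_E_def after_input_def by metis
qed (use Y_less[OF Y(4)] in \<open>auto simp: after_E_def\<close>)

lemma after_stride_frame: "after_stride s xs r' ys \<Longrightarrow> frame X s s' \<Longrightarrow> X \<inter> {0,1,2,3,4,5,7,8,9} = {} \<Longrightarrow> after_stride s' xs r' ys"
proof -
  assume p: "after_stride s xs r' ys" and fr: "frame X s s'" and X: "X \<inter> {0,1,2,3,4,5,7,8,9} = {}"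
  have bs: "base s" using p unfolding after_stride_def after_input_def by (elim conjE)
  have "base s'" by (rule base_frame[OF bs fr]) (use X in auto)
  moreover have "s' 7 = s 7" "s' 8 = s 8" "s' 9 = s 9" using frameD[OF fr] X by auto
  ultimately show ?thesis using p by (simp add: after_stride_def after_input_def)
qed

lemma step_Init_field: "after_stride s xs r' ys \<Longrightarrow> runs w Init_field s xs r' ys 50 after_init"
proof (rule runs_mono[OF runs_Init_field[of s S]])
  have "2 * 1 \<le> ((2::nat) ^ e) ^ C * (2 ^ e) ^ C" using X2 by (intro mult_le_mono) auto
  then show "2 \<le> S" unfolding S by simp
  fix s' xs' r'' ys'
  assume P: "after_stride s xs r' ys" and *: "xs' = xs \<and> r'' = r' \<and> ys' = ys \<and> frame {10, 11, 12, 13, 26, 27} s s' \<and> s' 10 0 = 2 \<and> s' 11 0 = 1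
    \<and> tab S xor ({..<2} \<times> {..<2}) (s' 12) \<and> tab S nmul ({..<2} \<times> {..<2}) (s' 13)"
  then have fr: "frame {10, 11, 12, 13, 26, 27} s s'" by (elim conjE)
  have "after_stride s' xs r' ys" by (rule after_stride_frame[OF P fr]) simp
  then show "after_init s' xs' r'' ys'" using * by (simp add: after_init_def)
qed (auto simp: after_stride_def w)

lemma step_Grow_field: "after_init s xs r' ys \<Longrightarrow> runs w Grow_field s xs r' ys (level ((2 ^ e) ^ C) * (S * (S * 6 + 6) + 9) + 1) after_field"
proof (rule runs_mono[OF runs_Grow_field[of s "(2 ^ e) ^ C" S]])
  show "int S \<le> 2 ^ w" by (rule Y_less[OF Y(3)])
  fix s' xs' r'' ys'
  assume P: "after_init s xs r' ys" and *: "xs' = xs \<and> r'' = r' \<and> ys' = ys \<and> frame {10, 11, 12, 13, 26, 27} s s' \<and> s' 10 0 = int (2 ^ 2 ^ level ((2 ^ e) ^ C))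
    \<and> s' 11 0 = int (2 ^ level ((2 ^ e) ^ C))
    \<and> tab S nmul ({..<2 ^ 2 ^ level ((2 ^ e) ^ C)} \<times> {..<2 ^ 2 ^ level ((2 ^ e) ^ C)}) (s' 13)"
  from * have fr: "frame {10, 11, 12, 13, 26, 27} s s'" by (elim conjE)
  have after_stride: "after_stride s xs r' ys" using P unfolding after_init_def by (elim conjE)
  have "after_stride s' xs r' ys" by (rule after_stride_frame[OF after_stride fr]) simp
  then show "after_field s' xs' r'' ys'" using * unfolding after_field_def l[symmetric] N[symmetric] by blast
next
  assume "after_init s xs r' ys"
  then show "s 8 0 = int ((2 ^ e) ^ C)" "s 9 0 = int S" "s 10 0 = 2" "s 11 0 = 1"
    "tab S xor ({..<2} \<times> {..<2}) (s 12)" "tab S nmul ({..<2} \<times> {..<2}) (s 13)"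
    unfolding after_init_def after_stride_def by blast+
qed (rule S X2 order.refl)+

lemma step_Pow_table: "after_field s xs r' ys \<Longrightarrow> runs w Pow_table s xs r' ys (N * 6 + d * (N * 4 + 6) + 10) after_powers"
proof (rule runs_mono[OF runs_Pow_table[of s d S N "level ((2 ^ e) ^ C)"]])
  show "N = 2 ^ 2 ^ level ((2 ^ e) ^ C)" unfolding N l ..
  show "int N \<le> 2 ^ w" "int d \<le> 2 ^ w" by (intro Y_less Y_more Y)+
  fix s' xs' r'' ys'
  assume P: "after_field s xs r' ys" and *: "xs' = xs \<and> r'' = r' \<and> ys' = ys \<and> frame {14, 24, 25} s s' \<and> tab S pow_odd ({..<d div 2} \<times> {..<N}) (s' 14)"
  then have fr: "frame {14, 24, 25} s s'" by simp
  have after_stride: "after_stride s xs r' ys" using P unfolding after_field_def by (elim conjE)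
  have "after_stride s' xs r' ys" by (rule after_stride_frame[OF after_stride fr]) simp
  then show "after_powers s' xs' r'' ys'" using P * frameD[OF fr, of 10] frameD[OF fr, of 11] unfolding after_powers_def after_field_def by simp
qed (use NS in \<open>auto simp: after_field_def after_stride_def after_input_def base_def\<close>)

lemma step_Two_table: "after_powers s xs r' ys \<Longrightarrow> runs w Two_table s xs r' ys (l * 4 + 6) after_twos"
proof (rule runs_mono[OF runs_Two_table[of s l]])
  show "l \<le> w" using Y_more(3) w by simp
  fix s' xs' r'' ys'
  assume P: "after_powers s xs r' ys" and *: "xs' = xs \<and> r'' = r' \<and> ys' = ys \<and> frame {15, 24} s s' \<and> (\<forall>b \<le> l. s' 15 (int b) = 2 ^ b)"
  then have fr: "frame {15, 24} s s'" by simp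
  have after_stride: "after_stride s xs r' ys" using P unfolding after_powers_def by (elim conjE)
  have "after_stride s' xs r' ys" by (rule after_stride_frame[OF after_stride fr]) simp
  then show "after_twos s' xs' r'' ys'" using P * frameD[OF fr, of 10] frameD[OF fr, of 11] frameD[OF fr, of 14] unfolding after_twos_def after_powers_def by simp
qed (auto simp: after_powers_def)

lemma step_Params: "after_twos s xs r' ys \<Longrightarrow> runs w (Params A q) s xs r' ys (K * 4 + 30) after_params"
proof (rule runs_mono[OF runs_Params[of s m n d e N l A q w xs r' ys, folded r h, folded K]])
  show "h \<le> r + 1" "e * d \<le> l * (r + 1 - h)" by (fact hr)+
  show "int r \<le> 2 ^ w" by (intro Y_less Y)
  show "int (m + N + 1 + (h * l + 1) * d) \<le> 2 ^ w" "int (n + 1 + m + N + (h * l + 1)) \<le> 2 ^ w"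
    using Y_less[OF Y(6)] Y_less[OF Y(7)] unfolding M V Ct by auto
  show "K \<le> w" using Y(8) w by simp
  fix s' xs' r'' ys'
  assume P: "after_twos s xs r' ys" and *: "xs' = xs \<and> r'' = r' \<and> ys' = ys \<and> frame {16, 17, 18, 19, 24, 29, 30, 31, 32} s s'
    \<and> s' 16 0 = int r \<and> s' 17 0 = int K \<and> s' 18 0 = 2 ^ K \<and> s' 19 0 = int (m + N + 1) \<and> s' 29 0 = int (h * l)
    \<and> s' 30 0 = int (n + 1 + m + N) \<and> s' 31 0 = int (m + N + 1 + (h * l + 1) * d) \<and> s' 32 0 = int (n + 1 + m + N + (h * l + 1))"
  then have fr: "frame {16, 17, 18, 19, 24, 29, 30, 31, 32} s s'" by simp
  have "base s'" using P by (intro base_frame[OF _ fr]) (auto simp: after_twos_def after_powers_def after_stride_def after_input_def)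
  moreover have "s' 19 0 = int V" "s' 31 0 = int M" "s' 32 0 = int Ct" "s' 18 0 = int (2 ^ K)"
    using * by (simp_all add: V M Ct)
  ultimately show "after_params s' xs' r'' ys'"
    using P * frameD[OF fr, of 9] frameD[OF fr, of 10] frameD[OF fr, of 11] frameD[OF fr, of 14] frameD[OF fr, of 15]
    unfolding after_params_def params_def after_twos_def after_powers_def after_stride_def after_input_def by simp
qed (auto simp: after_twos_def after_powers_def after_stride_def after_input_def base_def)

lemma step_Sample_code: "after_params s xs r' ys \<Longrightarrow> runs w (Sample 20 (Var 16) (Var 11)) s xs r' ys (r * (l * 6 + 8) + 3) after_code_sample"
proof (rule runs_mono[OF runs_Sample[of 20 s _ r _ l]])
  assume P: "after_params s xs r' ys"
  show "val (Var 16) s' = int r \<and> val (Var 11) s' = int l" if fr: "frame {24, 25, 28, 20} s s'" for s'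
    using P frameD[OF fr, of 16] frameD[OF fr, of 11] by (simp add: after_params_def params_def)
  show "r * l \<le> length r'" using P len by (simp add: after_params_def)
  show "l \<le> w" "int r \<le> 2 ^ w" using Y_more(3) w Y_less[OF Y(5)] by simp_all
  fix s' xs' r'' ys'
  assume *: "xs' = xs \<and> r'' = drop (r * l) r' \<and> ys' = ys \<and> frame {24, 25, 28, 20} s s' \<and> (\<forall>j<r. s' 20 (int j) = int (draw r l r' j))"
  then have fr: "frame {24, 25, 28, 20} s s'" by (elim conjE)
  have ps: "params s" using P unfolding after_params_def by (elim conjE)
  have "params s'" by (rule params_frame[OF ps fr]) simp
  then show "after_code_sample s' xs' r'' ys'" using P * by (simp add: after_code_sample_def after_params_def)
qed auto

lemma step_Sample_hash: "after_code_sample s xs r' ys \<Longrightarrow> runs w (Sample 21 (Var 19) (Var 17)) s xs r' ys (V * (K * 6 + 8) + 3) after_hash_sample"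
proof (rule runs_mono[OF runs_Sample[of 21 s _ V _ K]])
  assume P: "after_code_sample s xs r' ys"
  show "val (Var 19) s' = int V \<and> val (Var 17) s' = int K" if fr: "frame {24, 25, 28, 21} s s'" for s'
    using P frameD[OF fr, of 19] frameD[OF fr, of 17] by (simp add: after_code_sample_def params_def)
  show "V * K \<le> length r'" using P len by (simp add: after_code_sample_def)
  show "K \<le> w" "int V \<le> 2 ^ w" using Y(8) w Y_less[OF Y_more(1)] by simp_all
  fix s' xs' r'' ys'
  assume *: "xs' = xs \<and> r'' = drop (V * K) r' \<and> ys' = ys \<and> frame {24, 25, 28, 21} s s' \<and> (\<forall>j<V. s' 21 (int j) = int (draw V K r' j))"
  then have fr: "frame {24, 25, 28, 21} s s'" by simp
  have ps: "params s" using P unfolding after_code_sample_def by (elim conjE)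
  have "params s'" by (rule params_frame[OF ps fr]) simp
  moreover have "h * l = d div 2 * l" by (simp only: h)
  ultimately show "after_hash_sample s' xs' r'' ys'" using P * frameD[OF fr, of 20]
    unfolding after_hash_sample_def red.ctx_def after_code_sample_def params_def base_def red_dims by simp
qed auto

lemma f_less: "j < r \<Longrightarrow> f j < N"
  using draw_PiE[of r l \<rho>] by (auto simp: N PiE_def)

lemma a_less: "i < V \<Longrightarrow> a i < 2 ^ K"
  using draw_PiE[of V K "drop (r * l) \<rho>"] by (auto simp: PiE_def)

lemma step_Syndrome: "after_hash_sample s xs r' ys \<Longrightarrow> runs w Syndrome s xs r' ys (h * l * (r * 4 + 8) + 3) after_syndrome"
  unfolding h
proof (rule runs_mono[OF red.runs_Syndrome[of k S s]])
  show "int (d div 2 * l) \<le> 2 ^ w" using Y_less[OF Y_more(5)] by (simp add: h)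
  show "int r \<le> 2 ^ w" by (intro Y_less Y)
  fix s' xs' r'' ys'
  assume P: "after_hash_sample s xs r' ys" and *: "xs' = xs \<and> r'' = r' \<and> ys' = ys \<and> frame {22, 24, 25} s s' \<and> (\<forall>c < d div 2 * l. s' 22 (int c) = red.syndrome c)"
  have c: "red.ctx k S s" using P unfolding after_hash_sample_def by (elim conjE)
  have "frame {22, 23, 24, 25} s s'" using * unfolding frame_def by blast
  then have "red.ctx k S s'" by (rule red.ctx_frame[OF c])
  then show "after_syndrome s' xs' r'' ys'" using P * by (simp add: after_syndrome_def after_hash_sample_def)
qed (use f_less in \<open>auto simp: after_hash_sample_def\<close>)

lemma step_Hash_cols: "after_syndrome s xs r' ys \<Longrightarrow> runs w Hash_cols s xs r' ys ((n + 1 + m + N) * (V * 4 + 8) + 3) after_hash"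
proof (rule runs_mono[OF red.runs_Hash_cols[of k S s, unfolded red_dims]])
  show "int (n + 1 + m + N) \<le> 2 ^ w" "int V \<le> 2 ^ w" by (intro Y_less Y_more)+
  show "int (V * (4 * 2 ^ K)) \<le> 2 ^ w"
  proof -
    have "V \<le> 2 ^ Y" using Y_more(1) less_exp[of Y] by linarith
    then have "V * (4 * 2 ^ K) \<le> 2 ^ Y * (4 * 2 ^ Y)" using Y(8) by (intro mult_le_mono power_increasing) auto
    also have "\<dots> = 2 ^ w" by (simp add: w power_add mult_2)
    finally show ?thesis by (metis of_nat_le_iff of_nat_numeral of_nat_power)
  qed
  show "\<bar>g i j\<bar> \<le> 1" if "i < m" "j \<le> n" for i j using Gb[of i j] tb[of i] that by (auto simp: g_def)
  fix s' xs' r'' ys'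
  assume P: "after_syndrome s xs r' ys" and *: "xs' = xs \<and> r'' = r' \<and> ys' = ys \<and> frame {23, 24, 25} s s' \<and> (\<forall>j < n + 1 + m + N. s' 23 (int j) = red.hash_col j)"
  have c: "red.ctx k S s" using P unfolding after_syndrome_def by (elim conjE)
  have "frame {22, 23, 24, 25} s s'" using * unfolding frame_def by blast
  then have "red.ctx k S s'" by (rule red.ctx_frame[OF c])
  moreover have fr: "frame {23, 24, 25} s s'" using * by (elim conjE)
  have "s' 22 = s 22" by (rule frameD[OF fr]) simp
  ultimately show "after_hash s' xs' r'' ys'" using P * by (simp add: after_hash_def after_syndrome_def red_dims)
qed (use a_less in \<open>auto simp: after_syndrome_def\<close>)

lemma step_Output: "after_hash s xs r' ys \<Longrightarrow> runs w Output s xs r' ys (M * (Ct * 4 + 6) + 9) (\<lambda>s' xs' r' ys'. ys' = encode_svp red.B k)"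
proof -
  assume P: "after_hash s xs r' ys"
  then have ys: "ys = []" by (simp add: after_hash_def after_syndrome_def)
  show ?thesis unfolding ys
    by (rule red.runs_Output[of k S s, unfolded red_dims])
      (use P Y_less[OF Y(6)] Y_less[OF Y(7)] in \<open>auto simp: after_hash_def after_syndrome_def red_dims\<close>)
qed

lemma runs_Reduce_instance:
  assumes s: "s 0 0 = int m" "s 1 0 = int n" "s 2 0 = int k" "s 3 0 = int d"
    and xs: "length xs = m * n + m" "\<And>i j. i < m \<Longrightarrow> j < n \<Longrightarrow> xs ! (i * n + j) = G i j" "\<And>i. i < m \<Longrightarrow> xs ! (m * n + i) = t i"
    and xs01: "set xs \<subseteq> {0, 1}"
  shows "runs w (Reduce_instance C A q) s xs \<rho> [] (900 * Y ^ 3) (\<lambda>s' xs' r' ys'. ys' = encode_svp red.B k)"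
proof -
  have le: "\<bar>x\<bar> \<le> 2 ^ w" if "x \<in> set xs" for x using that xs01 by auto
  let ?P1 = "\<lambda>s xs' r' ys. s 0 0 = int m \<and> s 1 0 = int n \<and> s 2 0 = int k \<and> s 3 0 = int d
     \<and> (\<forall>i<m. \<forall>j<n. s 4 (int i * int n + int j) = G i j) \<and> xs' = drop (m * n) xs \<and> r' = \<rho> \<and> ys = ([] :: int list)"
  let ?P0 = "\<lambda>s1 xs1 r1 ys1. s1 = s \<and> xs1 = xs \<and> r1 = \<rho> \<and> ys1 = ([] :: int list)"
  have read_G: "runs w (Read_array 4 (Mul (Var 0) (Var 1))) s1 xs1 r1 ys1 (m * n * 4 + 3) ?P1" if "?P0 s1 xs1 r1 ys1" for s1 xs1 r1 ys1
  proof (rule runs_mono[OF runs_Read_array[of 4 s1 _ "m * n"]])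
    show "val (Mul (Var 0) (Var 1)) s' = int (m * n)" if fr: "frame {24, 4} s1 s'" for s'
      using \<open>?P0 s1 xs1 r1 ys1\<close> s frameD[OF fr, of 0] frameD[OF fr, of 1] by simp
    show "\<And>x. x \<in> set xs1 \<Longrightarrow> \<bar>x\<bar> \<le> 2 ^ w" using le that by auto
    show "int (m * n) \<le> 2 ^ w" by (rule Y_less[OF Y(1)])
    fix s' xs' r' ys'
    assume *: "xs' = drop (m * n) xs1 \<and> r' = r1 \<and> ys' = ys1 \<and> frame {24, 4} s1 s' \<and> (\<forall>i<m * n. s' 4 (int i) = xs1 ! i)"
    then have fr: "frame {24, 4} s1 s'" by simp
    have "s' 4 (int i * int n + int j) = G i j" if "i < m" "j < n" for i j
    proof -
      have "i * n + j < Suc i * n" using that by simp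
      also have "\<dots> \<le> m * n" using that by (intro mult_le_mono1) simp
      finally have "s' 4 (int (i * n + j)) = xs1 ! (i * n + j)" using * by blast
      then show ?thesis using xs(2)[OF that] \<open>?P0 s1 xs1 r1 ys1\<close> by simp
    qed
    then show "?P1 s' xs' r' ys'" using that * s frameD[OF fr, of 0] frameD[OF fr, of 1] frameD[OF fr, of 2] frameD[OF fr, of 3] by simp
  qed (use that xs in auto)
  have read_t: "runs w (Read_array 5 (Var 0)) s1 xs1 r1 ys1 (m * 4 + 3) after_input" if "?P1 s1 xs1 r1 ys1" for s1 xs1 r1 ys1
  proof (rule runs_mono[OF runs_Read_array[of 5 s1 _ m]])
    show "val (Var 0) s' = int m" if fr: "frame {24, 5} s1 s'" for s'
      using \<open>?P1 s1 xs1 r1 ys1\<close> s frameD[OF fr, of 0] by simp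
    show "\<And>x. x \<in> set xs1 \<Longrightarrow> \<bar>x\<bar> \<le> 2 ^ w" using le that by (auto dest: in_set_dropD)
    show "int m \<le> 2 ^ w" by (intro Y_less Y_more)
    fix s' xs' r' ys'
    assume *: "xs' = drop m xs1 \<and> r' = r1 \<and> ys' = ys1 \<and> frame {24, 5} s1 s' \<and> (\<forall>i<m. s' 5 (int i) = xs1 ! i)"
    then have fr: "frame {24, 5} s1 s'" by simp
    show "after_input s' xs' r' ys'" using that * xs frameD[OF fr, of 0] frameD[OF fr, of 1] frameD[OF fr, of 2] frameD[OF fr, of 3] frameD[OF fr, of 4]
      by (auto simp: after_input_def base_def g_def)
  qed (use that xs in auto)
  have "runs w (Reduce_instance C A q) s xs \<rho> [] (1 + (m * n * 4 + 3) + (1 + (m * 4 + 3) + (1 + (e * 4 + 6) + (1 + (C * 4 + 10) + (1 + 50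
     + (1 + (level ((2 ^ e) ^ C) * (S * (S * 6 + 6) + 9) + 1) + (1 + (N * 6 + d * (N * 4 + 6) + 10) + (1 + (l * 4 + 6)
     + (1 + (K * 4 + 30) + (1 + (r * (l * 6 + 8) + 3) + (1 + (V * (K * 6 + 8) + 3) + (1 + (h * l * (r * 4 + 8) + 3)
     + (1 + ((n + 1 + m + N) * (V * 4 + 8) + 3) + (M * (Ct * 4 + 6) + 9)))))))))))))) (\<lambda>s' xs' r' ys'. ys' = encode_svp red.B k)"
    unfolding Reduce_instance_def
    by (rule runs_Seq_chain[of ?P0, OF _ read_G], simp, assumption, rule runs_Seq_chain[of ?P1, OF _ read_t], assumption+,
        rule runs_Seq_chain[of after_input, OF _ step_Init_E], assumption+, rule runs_Seq_chain[of after_E, OF _ step_Init_stride], assumption+,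
        rule runs_Seq_chain[of after_stride, OF _ step_Init_field], assumption+, rule runs_Seq_chain[of after_init, OF _ step_Grow_field], assumption+,
        rule runs_Seq_chain[of after_field, OF _ step_Pow_table], assumption+, rule runs_Seq_chain[of after_powers, OF _ step_Two_table], assumption+,
        rule runs_Seq_chain[of after_twos, OF _ step_Params], assumption+, rule runs_Seq_chain[of after_params, OF _ step_Sample_code], assumption+,
        rule runs_Seq_chain[of after_code_sample, OF _ step_Sample_hash], assumption+, rule runs_Seq_chain[of after_hash_sample, OF _ step_Syndrome], assumption+,
        rule runs_Seq_chain[of after_syndrome, OF _ step_Hash_cols], assumption+, rule step_Output)
  then show ?thesis
  proof (rule runs_mono)
    have lv: "level ((2 ^ e) ^ C) \<le> Y" using Y_more(3) less_exp[of "level ((2 ^ e) ^ C)"] unfolding l by linarith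
    have b: "x * (y * i + j) \<le> u * Y ^ 2" if "x \<le> Y" "y \<le> Y" "u = i + j" for x y i j u
    proof -
      have "x * (y * i + j) \<le> Y * (Y * i + Y * j)" using that(1,2) Y(11) by (intro mult_le_mono add_le_mono) auto
      then show ?thesis by (simp add: that(3) power2_eq_square algebra_simps)
    qed
    have Y2: "Y \<le> Y ^ 2" "1 \<le> Y ^ 2" using Y(11) by (auto simp: power2_eq_square)
    have "level ((2 ^ e) ^ C) * (S * (S * 6 + 6) + 9) \<le> Y * (12 * Y ^ 2 + 9 * Y ^ 2)"
    proof (rule mult_le_mono[OF lv])
      show "S * (S * 6 + 6) + 9 \<le> 12 * Y ^ 2 + 9 * Y ^ 2" using b[OF Y(3) Y(3), of 12 6 6] Y2 by linarith
    qed
    then have L: "level ((2 ^ e) ^ C) * (S * (S * 6 + 6) + 9) \<le> 21 * Y ^ 3" by (simp add: power3_eq_cube power2_eq_square)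
    have Y3: "Y ^ 2 \<le> Y ^ 3" using Y(11) by (intro power_increasing) auto
    have bs: "d * (N * 4 + 6) \<le> 10 * Y ^ 2" "r * (l * 6 + 8) \<le> 14 * Y ^ 2" "V * (K * 6 + 8) \<le> 14 * Y ^ 2"
      "h * l * (r * 4 + 8) \<le> 12 * Y ^ 2" "(n + 1 + m + N) * (V * 4 + 8) \<le> 12 * Y ^ 2" "M * (Ct * 4 + 6) \<le> 10 * Y ^ 2"
      by (rule b[OF Y(9) Y_more(2)] b[OF Y(5) Y_more(3)] b[OF Y_more(1) Y(8)] b[OF Y_more(5) Y(5)]
        b[OF Y_more(4) Y_more(1)] b[OF Y(6) Y(7)], simp)+
    show "1 + (m * n * 4 + 3) + (1 + (m * 4 + 3) + (1 + (e * 4 + 6) + (1 + (C * 4 + 10) + (1 + 50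
     + (1 + (level ((2 ^ e) ^ C) * (S * (S * 6 + 6) + 9) + 1) + (1 + (N * 6 + d * (N * 4 + 6) + 10) + (1 + (l * 4 + 6)
     + (1 + (K * 4 + 30) + (1 + (r * (l * 6 + 8) + 3) + (1 + (V * (K * 6 + 8) + 3) + (1 + (h * l * (r * 4 + 8) + 3)
     + (1 + ((n + 1 + m + N) * (V * 4 + 8) + 3) + (M * (Ct * 4 + 6) + 9)))))))))))))  \<le> 900 * Y ^ 3"
      by (rule time_sum_le[OF Y(1) Y_more(6) Y(10) Y(4) L Y_more(2) bs(1) Y_more(3) Y(8) bs(2-6) Y2(1) Y3 Y2(2)])
  qed
qed

end

section \<open>Choice of parameters and probability of failure\<close>

text \<open>A union bound on a product. The third event is counted separately for every
  \<open>f\<close> that has not failed already, because its bound is available only for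
  those.\<close>

lemma card_pairs_le:
  fixes B1 :: "'a \<Rightarrow> bool" and B3 :: "'b \<Rightarrow> bool"
  assumes fin: "finite F" "finite A"
    and b1: "card {f \<in> F. B1 f} \<le> c1" and b3: "card {a \<in> A. B3 a} \<le> c3"
    and b4: "\<And>f. f \<in> F \<Longrightarrow> \<not> B1 f \<Longrightarrow> card {a \<in> A. B4 f a} \<le> c4"
  shows "card {x \<in> F \<times> A. B1 (fst x) \<or> B3 (snd x) \<or> (\<not> B1 (fst x) \<and> B4 (fst x) (snd x))}
    \<le> c1 * card A + card F * c3 + card F * c4"
proof -
  let ?S = "{x \<in> F \<times> A. B1 (fst x) \<or> B3 (snd x) \<or> (\<not> B1 (fst x) \<and> B4 (fst x) (snd x))}"
  have "?S \<subseteq> ({f \<in> F. B1 f} \<times> A) \<union> (F \<times> {a \<in> A. B3 a}) \<union> (SIGMA f:{f \<in> F. \<not> B1 f}. {a \<in> A. B4 f a})"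
    by auto
  then have "card ?S \<le> card (({f \<in> F. B1 f} \<times> A) \<union> (F \<times> {a \<in> A. B3 a}) \<union> (SIGMA f:{f \<in> F. \<not> B1 f}. {a \<in> A. B4 f a}))"
    using fin by (intro card_mono) auto
  also have "\<dots> \<le> card ({f \<in> F. B1 f} \<times> A) + card (F \<times> {a \<in> A. B3 a}) + card (SIGMA f:{f \<in> F. \<not> B1 f}. {a \<in> A. B4 f a})"
    by (meson add_le_mono1 card_Un_le le_trans)
  also have "card (SIGMA f:{f \<in> F. \<not> B1 f}. {a \<in> A. B4 f a}) = (\<Sum>f\<in>{f \<in> F. \<not> B1 f}. card {a \<in> A. B4 f a})"
    using fin by simp
  also have "\<dots> \<le> (\<Sum>f\<in>{f \<in> F. \<not> B1 f}. c4)" using b4 by (intro sum_mono) auto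
  also have "\<dots> \<le> card F * c4" using card_mono[OF fin(1), of "{f \<in> F. \<not> B1 f}"] by simp
  also have "card ({f \<in> F. B1 f} \<times> A) \<le> c1 * card A" using b1 by (simp add: card_cartesian_product)
  also have "card (F \<times> {a \<in> A. B3 a}) \<le> card F * c3" using b3 by (simp add: card_cartesian_product)
  finally show ?thesis by simp
qed

context ncp_reduction
begin

text \<open>Of two distinct supports of equal size, each has a position missing from the other.
  There the two vectors have entries 1 and 0, while both end in 1, so
  \<open>card_hash_pair_le\<close> applies. As \<open>Z\<close> has more than
  \<open>100 * Q'\<close> elements, the second moment method leaves a failure probability of at most
  \<open>1 / 100\<close>.\<close>

lemma yes_bad_count:
  assumes Q: "Q' > 0" and Z: "finite Z" "\<And>z. z \<in> Z \<Longrightarrow> z \<subseteq> {..<N} \<and> card z = q" and big: "100 * Q' < card Z" and m: "m \<ge> 1"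
  shows "100 * card {a \<in> {..<V} \<rightarrow>\<^sub>E {..<Q'}. \<forall>z\<in>Z. \<not> int Q' dvd hash V (yes_vec u z) a} \<le> Q' ^ V"
proof -
  let ?A = "{..<V} \<rightarrow>\<^sub>E {..<Q'}"
  have cA: "card ?A = Q' ^ V" by (simp add: card_PiE_const)
  have V: "V \<ge> 2" "m + N < V" using m by (simp_all add: V_def)
  have j: "yes_vec u z (m + N) = 1" for z by (simp add: yes_vec_def)
  have one: "card {a \<in> ?A. int Q' dvd hash V (yes_vec u z) a} = Q' ^ (V - 1)" for z
    using card_hash_zero_le[OF Q V(2), of "yes_vec u z"] card_hash_zero_ge[OF Q V(2), of "yes_vec u z"] j by simp
  have Q0: "real Q' \<noteq> 0" using Q by simp
  obtain V' where V': "V = Suc (Suc V')" using V(1) by (metis Suc_le_D numeral_2_eq_2 Suc_le_mono)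
  have "real (card {a \<in> ?A. \<forall>z\<in>Z. \<not> int Q' dvd hash V (yes_vec u z) a}) * card Z \<le> card ?A * real Q'"
  proof (rule second_moment)
    show "finite ?A" by (simp add: finite_PiE)
    show "real (card {a \<in> ?A. int Q' dvd hash V (yes_vec u z) a}) = card ?A / real Q'" for z
      unfolding one cA using Q by (simp add: V')
    fix z z' assume z: "z \<in> Z" "z' \<in> Z" "z \<noteq> z'"
    have "finite z'" using Z(2)[OF z(2)] by (auto intro: finite_subset)
    then have "\<not> z \<subseteq> z'" using Z(2)[OF z(1)] Z(2)[OF z(2)] z(3) card_subset_eq[of z' z] by auto
    then obtain b where b: "b \<in> z" "b \<notin> z'" by auto
    then have bN: "b < N" using Z(2)[OF z(1)] by auto
    have "card {a \<in> ?A. int Q' dvd hash V (yes_vec u z) a \<and> int Q' dvd hash V (yes_vec u z') a} \<le> Q' ^ (V - 2)"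
      by (rule card_hash_pair_le[OF Q, of "m + b" V "m + N"]) (use b bN V in \<open>auto simp: yes_vec_def V_def\<close>)
    then have "real (card {a \<in> ?A. int Q' dvd hash V (yes_vec u z) a \<and> int Q' dvd hash V (yes_vec u z') a}) \<le> real (Q' ^ (V - 2))"
      by (rule of_nat_mono)
    also have "\<dots> = card ?A / (real Q')\<^sup>2" unfolding cA using Q by (simp add: V' power2_eq_square)
    finally show "real (card {a \<in> ?A. int Q' dvd hash V (yes_vec u z) a \<and> int Q' dvd hash V (yes_vec u z') a}) \<le> card ?A / (real Q')\<^sup>2" .
  qed (use Q Z in auto)
  then have "card {a \<in> ?A. \<forall>z\<in>Z. \<not> int Q' dvd hash V (yes_vec u z) a} * card Z \<le> Q' ^ V * Q'" (is "?b * _ \<le> _")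
    unfolding cA of_nat_mult[symmetric] of_nat_le_iff .
  moreover have "?b * (100 * Q') \<le> ?b * card Z" using big by (intro mult_le_mono) auto
  moreover have "(100 * ?b) * Q' = ?b * (100 * Q')" by simp
  ultimately have "(100 * ?b) * Q' \<le> Q' ^ V * Q'" by linarith
  then show ?thesis using Q by simp
qed

end

definition sparse :: "nat \<Rightarrow> nat \<Rightarrow> nat \<Rightarrow> (nat \<Rightarrow> int) set" where
  "sparse V R q = {w \<in> {..<V} \<rightarrow>\<^sub>E {-int R..int R}. card {i \<in> {..<V}. w i \<noteq> 0} \<le> q \<and> (\<exists>i<V. w i \<noteq> 0)}"

text \<open>A union bound over the sparse vectors: each has some nonzero entry of absolute value at
  most \<open>R\<close>, hence survives with probability at most \<open>R / Q\<close>.\<close>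

lemma no_bad_count:
  assumes Q: "Q > 0" and V: "V > 0"
  shows "card {a \<in> {..<V} \<rightarrow>\<^sub>E {..<Q}. \<exists>w\<in>sparse V R q. int Q dvd hash V w a} \<le> (V * (2 * R + 1)) ^ q * (R * Q ^ (V - 1))"
proof -
  let ?A = "{..<V} \<rightarrow>\<^sub>E {..<Q}"
  have "finite ({..<V} \<rightarrow>\<^sub>E {-int R..int R})" by (simp add: finite_PiE)
  then have fin: "finite (sparse V R q)" unfolding sparse_def by (rule rev_finite_subset) blast
  have "{a \<in> ?A. \<exists>w\<in>sparse V R q. int Q dvd hash V w a} = (\<Union>w\<in>sparse V R q. {a \<in> ?A. int Q dvd hash V w a})" by auto
  then have "card {a \<in> ?A. \<exists>w\<in>sparse V R q. int Q dvd hash V w a} \<le> (\<Sum>w\<in>sparse V R q. card {a \<in> ?A. int Q dvd hash V w a})"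
    using card_UN_le[OF fin] by simp
  also have "\<dots> \<le> (\<Sum>w\<in>sparse V R q. R * Q ^ (V - 1))"
  proof (rule sum_mono)
    fix w assume w: "w \<in> sparse V R q"
    then obtain i where i: "i < V" "w i \<noteq> 0" unfolding sparse_def by blast
    have "w \<in> {..<V} \<rightarrow>\<^sub>E {-int R..int R}" using w unfolding sparse_def by blast
    then have "w i \<in> {-int R..int R}" by (rule PiE_mem) (simp add: i)
    then have "nat \<bar>w i\<bar> \<le> R" by auto
    then show "card {a \<in> ?A. int Q dvd hash V w a} \<le> R * Q ^ (V - 1)"
      using card_hash_zero_le[of Q i V w, OF Q i] by (meson le_trans mult_le_mono1)
  qed
  also have "\<dots> = card (sparse V R q) * (R * Q ^ (V - 1))" by simp
  also have "card (sparse V R q) \<le> card {w \<in> {..<V} \<rightarrow>\<^sub>E {-int R..int R}. card {i \<in> {..<V}. w i \<noteq> 0} \<le> q}"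
  proof (rule card_mono)
    show "finite {w \<in> {..<V} \<rightarrow>\<^sub>E {-int R..int R}. card {i \<in> {..<V}. w i \<noteq> 0} \<le> q}"
      by (rule rev_finite_subset[of "{..<V} \<rightarrow>\<^sub>E {-int R..int R}"]) (simp add: finite_PiE, blast)
  qed (unfold sparse_def, blast)
  also have "\<dots> \<le> (V * (2 * R + 1)) ^ q" by (rule card_sparse_le[OF V])
  finally show ?thesis by (simp add: mult_le_mono1)
qed

text \<open>As \<open>r < d\<close>, one factor \<open>E\<close> is left over;
  \<open>parameter_bounds\<close> spends it on the constant 10000.\<close>

lemma power_self_less: "r < d \<Longrightarrow> r \<le> E \<Longrightarrow> 1 \<le> E \<Longrightarrow> E * r ^ r \<le> (E::nat) ^ d"
proof -
  assume *: "r < d" "r \<le> E" "1 \<le> E"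
  have "E * r ^ r \<le> E * E ^ r" using * by (intro mult_le_mono power_mono) auto
  also have "\<dots> = E ^ Suc r" by simp
  also have "\<dots> \<le> E ^ d" using * by (intro power_increasing) auto
  finally show ?thesis .
qed

text \<open>The parameters: a code of length \<open>N = 2\<^sup>l\<close> is hashed modulo \<open>2\<^sup>K\<close>, where \<open>2\<^sup>K\<close> is chosen smaller
  than the expected number of weight-\<open>r\<close> words in a coset by a factor \<open>E\<^sup>d\<close>.\<close>

lemma parameter_bounds:
  fixes A q d c C e l m :: nat and \<beta> \<epsilon> \<theta> :: real
  assumes \<beta>: "\<beta> = real A / real q" "q > 0" "\<beta> = 1 / 2 + \<theta> + \<epsilon>" "\<beta> < 1" and \<epsilon>: "\<epsilon> > 0" "\<theta> \<ge> 0"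
    and C: "C * \<epsilon> \<ge> 2 * c + 7" "C \<ge> 3" and d: "even d" "2 \<le> d" "d < m"
    and m: "10000 \<le> m" "m \<le> 2 ^ e" and l: "e * C \<le> l"
  defines "r \<equiv> A * d div q" and "h \<equiv> d div 2" and "s \<equiv> nat \<lfloor>\<theta> * d\<rfloor>"
  defines "K \<equiv> l * (r + 1 - h) - e * d" and "R \<equiv> d ^ (c + 2)" and "V \<equiv> m + 2 ^ l + 1"
  shows "r < d" "h \<le> r + 1" "e * d \<le> l * (r + 1 - h)"
    and "100 * (r * r) \<le> 2 ^ l"
    and "10000 * (2 ^ K * r ^ r) * (2 ^ l) ^ (h - 1) \<le> (2 ^ l) ^ r"
    and "100 * ((V * (2 * R + 1)) ^ s * R) \<le> 2 ^ K"
proof -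
  \<comment> \<open>\<open>N ^ ex\<close> is the size of an average coset up to lower order factors,
    as about \<open>N ^ r\<close> words share \<open>2 * N ^ (h - 1)\<close> syndromes.\<close>
  define ex where "ex = r + 1 - h"
  have hd: "2 * h = d" using d by (simp add: h_def)
  have "real (r * q) \<le> real (A * d)" unfolding r_def of_nat_le_iff by (rule div_times_less_eq_dividend)
  then have "real r \<le> \<beta> * d" unfolding \<beta>(1) using \<beta>(2) by (simp add: field_simps)
  moreover have "\<beta> * d < 1 * real d" using \<beta>(4) d by (intro mult_strict_right_mono) auto
  ultimately show r_less: "r < d" by simp
  have "real (A * d) / real q < real (A * d div q) + 1"
  proof -
    have "A * d < q + q * (A * d div q)" by (rule dividend_less_times_div) fact
    then have "real (A * d) < real (q + q * (A * d div q))" by (rule of_nat_less_iff[THEN iffD2])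
    then show ?thesis using \<open>q > 0\<close> by (simp add: field_simps)
  qed
  then have r_gt: "\<beta> * d < real r + 1" unfolding r_def \<beta>(1) by simp
  have hr: "real h = d / 2" using hd by simp
  have "(1 / 2 + \<theta> + \<epsilon>) * d = d / 2 + \<theta> * d + \<epsilon> * d" by (simp add: algebra_simps)
  then have gap0: "\<theta> * d + \<epsilon> * d < real r + 1 - real h" using r_gt hr unfolding \<beta>(3) by linarith
  have pos: "0 \<le> \<theta> * d" "0 < \<epsilon> * d" using \<epsilon> d by auto
  then have "real h < real r + 1" using gap0 by linarith
  then show h_le: "h \<le> r + 1" by linarith
  have s_le: "real s \<le> \<theta> * d" unfolding s_def using pos by (simp add: of_nat_nat)
  have ex_real: "real ex = real r + 1 - real h" using h_le by (simp add: ex_def of_nat_diff)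
  have s_ex: "s \<le> ex" using gap0 s_le pos ex_real by linarith
  have gap: "\<epsilon> * d < real (ex - s)" using gap0 s_le ex_real s_ex by (simp add: of_nat_diff)
  have sd: "s \<le> d"
  proof -
    have "\<theta> < 1" using \<beta>(3,4) \<epsilon> by linarith
    then have "\<theta> * d \<le> 1 * real d" by (intro mult_right_mono) auto
    then show ?thesis using s_le by linarith
  qed
  \<comment> \<open>In powers of two this reads
    \<open>E ^ (d * (2 * c + 7)) \<le> N ^ (ex - s)\<close>. The exponent by which a coset outweighs
    the sparse vectors exceeds \<open>\<epsilon> * d\<close>, and \<open>l \<ge> e * C\<close> turns
    this surplus into as many factors \<open>E\<close> as the estimates below consume.\<close>
  have key: "e * (d * (2 * c + 7)) \<le> l * (ex - s)"
  proof -
    have "real (d * (2 * c + 7)) \<le> C * \<epsilon> * d" using mult_right_mono[OF C(1), of "real d"] by (simp add: mult.commute)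
    also have "\<dots> \<le> C * real (ex - s)" using mult_left_mono[OF less_imp_le[OF gap], of "real C"] by (simp add: mult.assoc)
    finally have "d * (2 * c + 7) \<le> C * (ex - s)" by (metis of_nat_le_iff of_nat_mult)
    then have "e * (d * (2 * c + 7)) \<le> e * (C * (ex - s))" by (rule mult_le_mono2)
    also have "\<dots> \<le> l * (ex - s)" using l by (simp add: mult_le_mono1 flip: mult.assoc)
    finally show ?thesis .
  qed
  have "e * d \<le> e * (d * (2 * c + 7))" by simp
  also have "\<dots> \<le> l * ex" using key by (meson diff_le_self le_trans mult_le_mono2)
  finally show ed: "e * d \<le> l * (r + 1 - h)" by (simp add: ex_def)
  define E where "E = (2::nat) ^ e"
  define N where "N = (2::nat) ^ l"
  have E: "m \<le> E" "10000 \<le> E" "1 \<le> E" using m by (simp_all add: E_def)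
  have NE: "E ^ C \<le> N" unfolding E_def N_def power_mult[symmetric] using l by (intro power_increasing) auto
  have "E ^ 3 \<le> E ^ C" using C(2) E(3) by (intro power_increasing) auto
  then have E3: "E ^ 3 \<le> N" using NE by simp
  have rE: "r \<le> E" using r_less d E by linarith
  have "100 * (r * r) \<le> E * (E * E)" using rE E by (intro mult_le_mono) auto
  then show "100 * (r * r) \<le> 2 ^ l" using E3 by (simp add: power3_eq_cube N_def[symmetric])
  have QE: "2 ^ K * E ^ d = N ^ ex"
    unfolding E_def N_def power_mult[symmetric] power_add[symmetric] K_def ex_def[symmetric] using ed
    by (simp add: ex_def)
  have "10000 * r ^ r \<le> E ^ d" using power_self_less[OF r_less rE E(3)] E(2) by (meson le_trans mult_le_mono1)
  then have "(2 ^ K * N ^ (h - 1)) * (10000 * r ^ r) \<le> (2 ^ K * N ^ (h - 1)) * E ^ d" by (rule mult_le_mono2)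
  also have "\<dots> = N ^ ex * N ^ (h - 1)" unfolding QE[symmetric] by simp
  also have "\<dots> = N ^ r" unfolding power_add[symmetric] using h_le hd d(2) by (simp add: ex_def)
  finally show "10000 * (2 ^ K * r ^ r) * (2 ^ l) ^ (h - 1) \<le> (2 ^ l) ^ r"
    unfolding N_def[symmetric] by (simp add: mult_ac)
  have RE: "R \<le> E ^ (c + 2)" unfolding R_def using d E by (intro power_mono) auto
  have R1: "1 \<le> R" using d by (simp add: R_def)
  have EN: "E \<le> N" using E3 E(3) self_le_power[of E 3] by simp
  have "V \<le> 3 * N" unfolding V_def N_def[symmetric] using EN E by simp
  moreover have "2 * R + 1 \<le> 3 * E ^ (c + 2)" using RE R1 by simp
  ultimately have "V * (2 * R + 1) \<le> 3 * N * (3 * E ^ (c + 2))" by (rule mult_le_mono)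
  also have "\<dots> = N * (9 * E ^ (c + 2))" by simp
  also have "\<dots> \<le> N * (E * E ^ (c + 2))" using E(2) by (intro mult_le_mono) auto
  finally have "V * (2 * R + 1) \<le> N * E ^ (c + 3)" by (simp add: numeral_3_eq_3)
  then have "(V * (2 * R + 1)) ^ s \<le> (N * E ^ (c + 3)) ^ s" by (rule power_mono) simp
  also have "\<dots> = N ^ s * E ^ ((c + 3) * s)" by (simp add: power_mult_distrib power_mult[symmetric])
  finally have Vs: "(V * (2 * R + 1)) ^ s \<le> N ^ s * E ^ ((c + 3) * s)" .
  have "100 * ((V * (2 * R + 1)) ^ s * R) * E ^ d \<le> E * ((N ^ s * E ^ ((c + 3) * s)) * E ^ (c + 2)) * E ^ d"
    using E(2) by (intro mult_le_mono Vs RE order.refl) auto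
  also have "\<dots> = N ^ s * E ^ (1 + (c + 3) * s + (c + 2) + d)" by (simp add: power_add)
  also have "\<dots> \<le> N ^ s * E ^ (d * (2 * c + 7))"
  proof (intro mult_le_mono2 power_increasing E(3))
    \<comment> \<open>The origin of \<open>2 * c + 7\<close>: one factor \<open>E\<close> for the
      constant 100, \<open>c + 3\<close> for each of \<open>s\<close> sparse positions,
      \<open>c + 2\<close> for \<open>R\<close> and \<open>d\<close> for the slack in the modulus.
      With \<open>s \<le> d\<close> and \<open>1 \<le> d\<close> the sum is at most
      \<open>(c + 3) * d + (c + 3) * d + d\<close>.\<close>
    have "(c + 3) * s \<le> (c + 3) * d" "(c + 3) * 1 \<le> (c + 3) * d" using sd d by (intro mult_le_mono2; simp)+
    then show "1 + (c + 3) * s + (c + 2) + d \<le> d * (2 * c + 7)" by (simp add: algebra_simps)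
  qed
  also have "\<dots> \<le> N ^ s * N ^ (ex - s)"
    unfolding E_def N_def power_mult[symmetric] by (intro mult_le_mono2 power_increasing key) auto
  also have "\<dots> = 2 ^ K * E ^ d" unfolding QE power_add[symmetric] using s_ex by simp
  finally show "100 * ((V * (2 * R + 1)) ^ s * R) \<le> 2 ^ K" using E(3) by simp
qed

lemma hamming_le_lp_norm:
  assumes p: "p > 0"
  shows "real (hamming_wt w) \<le> lp_norm p w powr p"
    and "even_vec w \<Longrightarrow> 2 powr p * real (hamming_wt w) \<le> lp_norm p w powr p"
proof -
  have lp: "lp_norm p w powr p = (\<Sum>i<dim_vec w. \<bar>real_of_int (w $v i)\<bar> powr p)"
    unfolding lp_norm_def using p by (simp add: powr_powr sum_nonneg)
  have *: "b powr p * real (hamming_wt w) \<le> lp_norm p w powr p"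
    if b: "\<And>i. i < dim_vec w \<Longrightarrow> w $v i \<noteq> 0 \<Longrightarrow> b \<le> \<bar>real_of_int (w $v i)\<bar>" "b > 0" for b
  proof -
    have "b powr p * real (hamming_wt w) = (\<Sum>i\<in>{i. i < dim_vec w \<and> w $v i \<noteq> 0}. b powr p)"
      by (simp add: hamming_wt_def)
    also have "\<dots> \<le> (\<Sum>i\<in>{i. i < dim_vec w \<and> w $v i \<noteq> 0}. \<bar>real_of_int (w $v i)\<bar> powr p)"
      using b p by (intro sum_mono powr_mono2) auto
    also have "\<dots> \<le> (\<Sum>i<dim_vec w. \<bar>real_of_int (w $v i)\<bar> powr p)"
      by (intro sum_mono2) auto
    finally show ?thesis unfolding lp .
  qed
  have "1 \<le> \<bar>real_of_int (w $v i)\<bar>" if "w $v i \<noteq> 0" for i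
  proof -
    have "1 \<le> \<bar>w $v i\<bar>" using that by linarith
    then show ?thesis by linarith
  qed
  from *[of 1, OF this] show "real (hamming_wt w) \<le> lp_norm p w powr p" by simp
  assume ev: "even_vec w"
  have "2 \<le> \<bar>real_of_int (w $v i)\<bar>" if "i < dim_vec w" "w $v i \<noteq> 0" for i
  proof -
    have "even (w $v i)" using ev that(1) by (simp add: even_vec_def)
    then have "2 \<le> \<bar>w $v i\<bar>" using that(2) by presburger
    then show ?thesis by linarith
  qed
  from *[of 2, OF this] show "2 powr p * real (hamming_wt w) \<le> lp_norm p w powr p" by simp
qed

text \<open>The structural alternatives already imply the gap of SVP. Nonzero entries contribute at
  least 1 to the \<open>p\<close>-th power of the norm, and at least \<open>2 powr p\<close> if they
  are even; in the third case \<open>x \<ge> 1\<close> and the exponent is at least 1.\<close>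

lemma lp_norm_greater:
  assumes p: "p > 1" and x: "x \<ge> 1"
    and w: "real (hamming_wt w) > x powr p \<or> even_vec w \<and> real (hamming_wt w) > x powr p / 2 powr p
      \<or> even_vec w \<and> lp_norm p w > x powr (real c + 3 * p / 2)"
  shows "lp_norm p w > x"
proof -
  have nonneg: "0 \<le> lp_norm p w" by (simp add: lp_norm_def)
  have cancel: "x powr p < lp_norm p w powr p \<Longrightarrow> x < lp_norm p w"
    using p x nonneg by (meson not_le powr_mono2 less_le_trans less_imp_le zero_le_one order_trans less_trans zero_less_one)
  from w show ?thesis
  proof (elim disjE conjE)
    assume "real (hamming_wt w) > x powr p"
    then show ?thesis using hamming_le_lp_norm(1)[of p w] p by (intro cancel) auto
  next
    assume "even_vec w" "real (hamming_wt w) > x powr p / 2 powr p"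
    then have "x powr p < 2 powr p * real (hamming_wt w)" by (simp add: field_simps)
    also have "\<dots> \<le> lp_norm p w powr p" using hamming_le_lp_norm(2)[of p w] \<open>even_vec w\<close> p by simp
    finally show ?thesis by (rule cancel)
  next
    assume *: "lp_norm p w > x powr (real c + 3 * p / 2)"
    have "x powr 1 \<le> x powr (real c + 3 * p / 2)" using p x by (intro powr_mono) auto
    then show ?thesis using * x by simp
  qed
qed

context ncp_reduction
begin

text \<open>If all alternatives fail, then \<open>w\<close> is an even vector with at most
  \<open>2 powr (- p) * d\<close> nonzero entries, and its norm bounds its entries by
  \<open>d ^ (c + 2)\<close>. It is thus one of the sparse vectors that the hash is assumed to
  remove.\<close>

lemma no_case:
  assumes p: "p > 1" and x: "x \<ge> 1" "x powr p < d" and dist: "d \<le> code_dist t (lin_code G)"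
    and a: "\<not> (\<exists>u\<in>sparse V (d ^ (c + 2)) (nat \<lfloor>2 powr (- p) * d\<rfloor>). int Q dvd hash V u a)"
    and w: "w \<in> nonzero_lattice_vecs B"
  shows "real (hamming_wt w) > x powr p \<or> even_vec w \<and> real (hamming_wt w) > x powr p / 2 powr p
      \<or> even_vec w \<and> lp_norm p w > x powr (real c + 3 * p / 2)"
proof (rule ccontr)
  assume neg: "\<not> ?thesis"
  then have "\<not> d \<le> hamming_wt w" using x by auto
  then have w': "dim_vec w = M" "even_vec w" "int Q dvd hash V (\<lambda>i. w $v i) a" "\<exists>i<V. w $v i \<noteq> 0"
    using lattice_cases[OF w dist] by auto
  then have h: "real (hamming_wt w) \<le> x powr p / 2 powr p" and lp: "lp_norm p w \<le> x powr (real c + 3 * p / 2)"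
    using neg by auto
  have d1: "1 \<le> real d" using d by simp
  have VM: "V \<le> M" by (simp add: M_def)
  have xp: "0 < x" using x by simp
  have "x powr 1 \<le> x powr p" using p x by (intro powr_mono) auto
  then have xd: "x \<le> d" using x by simp
  \<comment> \<open>The exponent splits into \<open>x ^ c\<close>, with \<open>x \<le> d\<close>,
    and the power \<open>3 / 2\<close> of \<open>x powr p\<close>, which is below \<open>d\<close>.
    Rounding \<open>3 / 2\<close> up to 2 gives \<open>d ^ (c + 2)\<close>.\<close>
  have "x powr (real c + 3 * p / 2) = x ^ c * (x powr p) powr (3 / 2)"
    using xp by (simp add: powr_add powr_realpow powr_powr mult.commute)
  also have "\<dots> \<le> real d ^ c * real d powr 2"
  proof (intro mult_mono)
    show "x ^ c \<le> real d ^ c" using xd xp by (intro power_mono) auto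
    have "(x powr p) powr (3 / 2) \<le> real d powr (3 / 2)" using x by (intro powr_mono2) auto
    also have "\<dots> \<le> real d powr 2" using d1 by (intro powr_mono) auto
    finally show "(x powr p) powr (3 / 2) \<le> real d powr 2" .
  qed auto
  also have "\<dots> = real (d ^ (c + 2))" using d1 by (simp add: power_add powr_numeral power2_eq_square)
  finally have R: "lp_norm p w \<le> real (d ^ (c + 2))" using lp by simp
  define u where "u = restrict (\<lambda>i. w $v i) {..<V}"
  have le: "\<bar>w $v i\<bar> \<le> int (d ^ (c + 2))" if "i < V" for i
  proof -
    have "\<bar>real_of_int (w $v i)\<bar> \<le> lp_norm p w" using p that VM w'(1) by (intro abs_le_lp_norm) auto
    then have "real_of_int \<bar>w $v i\<bar> \<le> real_of_int (int (d ^ (c + 2)))" using R by simp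
    then show ?thesis by (simp only: of_int_le_iff)
  qed
  have "u \<in> {..<V} \<rightarrow>\<^sub>E {-int (d ^ (c + 2))..int (d ^ (c + 2))}" unfolding u_def
    by (rule PiE_I) (use le in \<open>auto simp: abs_le_iff minus_le_iff\<close>)
  moreover have "card {i \<in> {..<V}. u i \<noteq> 0} \<le> nat \<lfloor>2 powr (- p) * d\<rfloor>"
  proof -
    have "card {i \<in> {..<V}. u i \<noteq> 0} \<le> hamming_wt w"
      by (rule hamming_wt_ge[where h = id]) (use VM w'(1) in \<open>auto simp: u_def\<close>)
    then have "real (card {i \<in> {..<V}. u i \<noteq> 0}) \<le> x powr p / 2 powr p" using h by linarith
    also have "\<dots> \<le> d / 2 powr p" using x by (intro divide_right_mono) auto
    also have "\<dots> = 2 powr (- p) * d" by (simp add: powr_minus field_simps)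
    finally show ?thesis by (simp add: le_nat_floor)
  qed
  moreover have "\<exists>i<V. u i \<noteq> 0" using w'(4) by (auto simp: u_def)
  moreover have "hash V u a = hash V (\<lambda>i. w $v i) a" unfolding hash_def u_def by (intro sum.cong) auto
  ultimately show False using a w'(3) by (auto simp: sparse_def)
qed

end

section \<open>Runs of the complete program on encoded inputs\<close>

lemma nth_concat_grid: "i < m \<Longrightarrow> j < n \<Longrightarrow> concat (map (\<lambda>i. map (F i) [0..<n]) [0..<m]) ! (i * n + j) = F i j"
proof (induction m)
  case (Suc m)
  have len: "length (concat (map (\<lambda>i. map (F i) [0..<n]) [0..<k])) = k * n" for k
    by (induction k) auto
  show ?case
  proof (cases "i < m")
    case True
    have "i * n + j < Suc i * n" using Suc.prems by simp
    also have "\<dots> \<le> m * n" using True by (intro mult_le_mono1) simp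
    finally show ?thesis using Suc True by (simp add: nth_append len)
  next
    case False
    then have "i = m" using Suc.prems by simp
    then show ?thesis using Suc.prems by (simp add: nth_append len)
  qed
qed simp

lemma length_concat_grid: "length (concat (map (\<lambda>i. map (F i) [0..<n]) [0..<m])) = m * n"
  by (induction m) auto

lemma runs_outputs_within:
  assumes "runs w c (\<lambda>_ _. 0) xs \<rho> [] T0 (\<lambda>s' xs' r' ys'. ys' = ys)" "w \<ge> 1" "T0 * unit_time w (com_size c) \<le> T"
  shows "outputs_within c T xs \<rho> ys"
proof -
  obtain n s' xs' r' where 1: "n \<le> T0" "steps w c (\<lambda>_ _. 0, xs, \<rho>, []) n (s', xs', r', ys)"
    using assms(1) unfolding runs_def by blast
  obtain t where t: "t \<le> n * unit_time w (com_size c)" "exec c (\<lambda>_ _. 0, xs, \<rho>, []) t (s', xs', r', ys)"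
    using steps_imp_exec[OF 1(2) assms(2), of "com_size c"] by auto
  have "n * unit_time w (com_size c) \<le> T0 * unit_time w (com_size c)" using 1(1) by (rule mult_le_mono1)
  then have "t \<le> T" using t(1) assms(3) by linarith
  then show ?thesis unfolding outputs_within_def using t(2) by blast
qed

lemma runs_ReadI:
  "Q (update s a (val e s) x) xs r ys \<Longrightarrow> \<bar>x\<bar> \<le> 2 ^ w \<Longrightarrow> runs w (Read a e) s (x # xs) r ys 1 Q"
  by (rule runs_Read) auto

lemma runs_Reduction:
  fixes m n k d \<gamma> Y :: nat
  assumes d: "d = \<gamma> * k" and w: "int m \<le> 2 ^ w" "int n \<le> 2 ^ w" "int k \<le> 2 ^ w" "int d \<le> 2 ^ w"
    and big: "\<And>s. d < m \<Longrightarrow> s 0 0 = int m \<Longrightarrow> s 1 0 = int n \<Longrightarrow> s 2 0 = int k \<Longrightarrow> s 3 0 = int d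
      \<Longrightarrow> runs w (Reduce_instance C A q) s xs \<rho> [] T Q"
    and small: "\<And>s. \<not> d < m \<Longrightarrow> s 2 0 = int k \<Longrightarrow> runs w Write_trivial s xs \<rho> [] T Q"
  shows "runs w (Reduction \<gamma> C A q) (\<lambda>_ _. 0) (int m # int n # int k # xs) \<rho> [] (T + 10) Q"
proof -
  let ?s = "update (update (update (update (\<lambda>_ _. 0) 0 0 (int m)) 1 0 (int n)) 2 0 (int k)) 3 0 (int d)"
  have s: "?s 0 0 = int m" "?s 1 0 = int n" "?s 2 0 = int k" "?s 3 0 = int d" by simp_all
  have c: "runs w (Cond (Less (Var 3) (Var 0)) (Reduce_instance C A q) Write_trivial) ?s xs \<rho> [] (1 + T) Q"
  proof (rule runs_Cond[where ?T1.0 = T])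
    assume "val (Less (Var 3) (Var 0)) ?s \<noteq> 0"
    then have "d < m" by (simp split: if_splits)
    then show "runs w (Reduce_instance C A q) ?s xs \<rho> [] T Q" using s by (rule big)
  next
    assume "val (Less (Var 3) (Var 0)) ?s = 0"
    then have "\<not> d < m" by (simp split: if_splits)
    then show "runs w Write_trivial ?s xs \<rho> [] T Q" using s(3) by (rule small)
  qed simp
  have "runs w (Reduction \<gamma> C A q) (\<lambda>_ _. 0) (int m # int n # int k # xs) \<rho> [] (1 + 1 + (1 + 1 + (1 + 1 + (1 + 1 + (1 + T))))) Q"
    unfolding Reduction_def
    apply (rule runs_SeqI, rule runs_ReadI)
     apply (rule runs_SeqI, rule runs_ReadI)
      apply (rule runs_SeqI, rule runs_ReadI)
       apply (rule runs_SeqI, rule runs_Set_varI)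
        apply (use c in \<open>simp add: d\<close>)
    using w by (simp_all add: d)
  then show ?thesis by (rule runs_mono) auto
qed

text \<open>The power \<open>(2 * x) ^ (2 * C)\<close> bounds the stride, because
  \<open>2 ^ e \<le> 2 * x\<close>. The factor \<open>x ^ 2\<close> covers products with the
  dimensions, 8 the sums of such terms, and the summands cover the constants of the program.\<close>

definition size_bound :: "nat \<Rightarrow> nat \<Rightarrow> nat \<Rightarrow> nat" where
  "size_bound \<gamma> C x = \<gamma> + C + 8 * (x\<^sup>2 * (2 * x) ^ (2 * C))"

locale instance_params =
  fixes \<gamma> C A q m n k x d e l N h r K S V M Ct Y w :: nat
  assumes d: "d = \<gamma> * k" and e: "e = log_ceil m" and l: "l = 2 ^ level ((2 ^ e) ^ C)" and N: "N = 2 ^ l"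
    and h: "h = d div 2" and r: "r = A * d div q" and K: "K = l * (r + 1 - h) - e * d"
    and S: "S = (2 ^ e) ^ C * (2 ^ e) ^ C" and V: "V = m + N + 1" and M: "M = V + (h * l + 1) * d" and Ct: "Ct = n + 1 + m + N + (h * l + 1)"
    and x: "m \<le> x" "n \<le> x" "bit_len (int k) \<le> x" and Y: "Y = size_bound \<gamma> C x" and w: "w = 2 * Y + 2"
    and m: "2 \<le> m" and C: "1 \<le> C"
begin

definition "W = (2 * x) ^ (2 * C)"

lemma W1: "1 \<le> W" using m x(1) by (simp add: W_def)

lemma x1: "1 \<le> x" using m x(1) by simp

lemma Y_ge: "\<gamma> \<le> Y" "C \<le> Y" "x\<^sup>2 * W * 8 \<le> Y" "x \<le> x\<^sup>2 * W" "W \<le> x\<^sup>2 * W" "x\<^sup>2 \<le> x\<^sup>2 * W" "x * W \<le> x\<^sup>2 * W" "1 \<le> x\<^sup>2 * W"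
proof -
  show "\<gamma> \<le> Y" "C \<le> Y" "x\<^sup>2 * W * 8 \<le> Y" unfolding Y size_bound_def W_def[symmetric] by simp_all
  have xx: "1 \<le> x\<^sup>2" "x \<le> x\<^sup>2" using x1 by (simp_all add: power2_eq_square)
  show "x\<^sup>2 \<le> x\<^sup>2 * W" "W \<le> x\<^sup>2 * W" using W1 xx by simp_all
  then show "x \<le> x\<^sup>2 * W" "1 \<le> x\<^sup>2 * W" using xx by linarith+
  show "x * W \<le> x\<^sup>2 * W" using xx(2) by (rule mult_le_mono1)
qed

lemma two_Y: "2 ^ x \<le> (2::nat) ^ Y" "Y < 2 ^ Y" "(2::nat) ^ Y * 2 ^ Y \<le> 2 ^ w"
proof -
  have "x \<le> Y" using Y_ge by linarith
  then show "2 ^ x \<le> (2::nat) ^ Y" by (intro power_increasing) auto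
  show "Y < 2 ^ Y" by (rule less_exp)
  show "(2::nat) ^ Y * 2 ^ Y \<le> 2 ^ w" unfolding w power_add[symmetric] by (intro power_increasing) auto
qed

text \<open>Only the bit length of \<open>k\<close> is bounded by \<open>x\<close>, so
  \<open>k\<close> and \<open>d\<close> may be exponentially large; they are compared with powers of
  two instead of \<open>Y\<close>.\<close>

lemma input_le: "int m \<le> 2 ^ w" "int n \<le> 2 ^ w" "int k \<le> 2 ^ w" "int d \<le> 2 ^ w"
proof -
  have le: "int u \<le> 2 ^ w" if "u \<le> 2 ^ Y * 2 ^ Y" for u
  proof -
    have "u \<le> 2 ^ w" using that two_Y(3) by linarith
    then show ?thesis by (metis of_nat_le_iff of_nat_numeral of_nat_power)
  qed
  have one: "2 ^ Y * 1 \<le> (2::nat) ^ Y * 2 ^ Y" by (intro mult_le_mono2) simp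
  have mY: "m \<le> Y" "n \<le> Y" using Y_ge x by linarith+
  have "k \<le> 2 ^ x"
  proof -
    have "\<bar>int k\<bar> \<le> 2 ^ bit_len (int k)" by (rule abs_le_bit_len)
    then have "k \<le> 2 ^ bit_len (int k)" by simp
    also have "\<dots> \<le> 2 ^ x" using x(3) by (intro power_increasing) auto
    finally show ?thesis .
  qed
  then have kY: "k \<le> 2 ^ Y" using two_Y(1) by linarith
  moreover have "\<gamma> \<le> 2 ^ Y" using Y_ge(1) two_Y(2) by linarith
  ultimately have "d \<le> 2 ^ Y * 2 ^ Y" unfolding d by (intro mult_le_mono)
  then show "int d \<le> 2 ^ w" by (rule le)
  show "int m \<le> 2 ^ w" "int n \<le> 2 ^ w" "int k \<le> 2 ^ w" by (rule le, use mY kY two_Y(2) one in linarith)+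
qed

lemma e_le: "2 ^ e \<le> 2 * x" "e \<le> 2 * x" "m \<le> 2 ^ e" "e * C \<le> l"
proof -
  show me: "m \<le> 2 ^ e" unfolding e by (rule log_ceil_le)
  show e2: "2 ^ e \<le> 2 * x"
  proof (cases e)
    case (Suc e')
    then have "2 ^ e' < m" using less_log_ceil[of e' m] e by simp
    then show ?thesis using Suc x(1) by simp
  qed (use x1 in simp)
  show "e \<le> 2 * x" using e2 less_exp[of e] by linarith
  have "(2::nat) ^ (e * C) \<le> 2 ^ l" unfolding l power_mult by (rule level_le)
  then show "e * C \<le> l" by simp
qed

lemma E_ge: "(2::nat) \<le> (2 ^ e) ^ C"
proof -
  have "2 \<le> (2::nat) ^ e" using m e_le(3) by linarith
  also have "\<dots> \<le> (2 ^ e) ^ C" using C by (intro self_le_power) auto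
  finally show ?thesis .
qed

text \<open>Unless the order is still 2, it is the square of an order below \<open>E ^ C\<close>,
  hence at most the stride.\<close>

lemma S_le: "S \<le> W" "N \<le> S"
proof -
  have "S = (2 ^ e) ^ (2 * C)" unfolding S by (simp add: power_add[symmetric] mult_2)
  also have "\<dots> \<le> W" unfolding W_def by (intro power_mono e_le) auto
  finally show "S \<le> W" .
  show "N \<le> S"
  proof (cases "level ((2 ^ e) ^ C)")
    case 0
    then have "N = 2 * 1" unfolding N l by simp
    also have "\<dots> \<le> S" unfolding S using E_ge by (intro mult_le_mono) auto
    finally show ?thesis .
  next
    case (Suc i)
    then have lt: "2 ^ 2 ^ i < ((2::nat) ^ e) ^ C" using less_level[of i "(2 ^ e) ^ C"] by simp
    have "N = 2 ^ 2 ^ i * 2 ^ 2 ^ i" unfolding N l Suc by (simp add: mult_2 power_add)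
    also have "\<dots> \<le> S" unfolding S using lt by (intro mult_le_mono) auto
    finally show ?thesis .
  qed
qed

lemma all_le_Y:
  assumes dm: "d < m" and rd: "r < d"
  shows "m * n \<le> Y" "2 * m \<le> Y" "S \<le> Y" "C \<le> Y" "r \<le> Y" "M \<le> Y" "Ct \<le> Y" "K \<le> Y" "d \<le> Y" "e \<le> Y" "1 \<le> Y"
    "l \<le> Y" "V \<le> Y"
proof -
  let ?U = "x\<^sup>2 * W"
  have NW: "N \<le> W" using S_le by linarith
  have lW: "l \<le> W" using NW less_exp[of l] unfolding N by linarith
  have dx: "d \<le> x" "h \<le> x" "r \<le> x" using dm rd x(1) by (simp_all add: h)
  have hl: "h * l \<le> x * W" by (intro mult_le_mono dx lW)
  have "m * n \<le> x\<^sup>2" unfolding power2_eq_square using x by (intro mult_le_mono)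
  then show "m * n \<le> Y" using Y_ge(3,6) by linarith
  show "2 * m \<le> Y" "S \<le> Y" "C \<le> Y" "r \<le> Y" "d \<le> Y" "e \<le> Y" "1 \<le> Y"
    using Y_ge x dx S_le e_le(2) by linarith+
  show "l \<le> Y" using lW Y_ge by linarith
  show "V \<le> Y" unfolding V using NW x Y_ge by linarith
  have "(h * l + 1) * d \<le> (x * W + 1) * x" by (rule mult_le_mono[OF add_le_mono1[OF hl] dx(1)])
  also have "\<dots> = ?U + x" by (simp add: power2_eq_square algebra_simps)
  finally show "M \<le> Y" unfolding M V using NW x Y_ge by linarith
  show "Ct \<le> Y" unfolding Ct using NW x hl Y_ge by linarith
  have "K \<le> l * (r + 1 - h)" unfolding K by simp
  also have "\<dots> \<le> W * (x + 1)" using lW dx by (intro mult_le_mono) auto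
  also have "\<dots> = x * W + W" by simp
  finally show "K \<le> Y" using Y_ge by linarith
qed

text \<open>The time bound is also the number of coins supplied, and it covers the flips that the
  two samples consume.\<close>

lemma time_ge: 
  assumes "d < m" "r < d"
  shows "r * l + V * K \<le> 1000 * Y ^ 3 * unit_time w z"
proof -
  have "r * l \<le> Y * Y" "V * K \<le> Y * Y" using all_le_Y[OF assms] by (simp_all add: mult_le_mono)
  then have "r * l + V * K \<le> 2 * (Y * Y)" by simp
  also have "\<dots> \<le> 1000 * Y ^ 3" using all_le_Y(11)[OF assms] by (simp add: power3_eq_cube)
  also have "\<dots> \<le> 1000 * Y ^ 3 * unit_time w z" by (simp add: unit_time_def)
  finally show ?thesis .
qed

lemma outputs_small:
  assumes dm: "\<not> d < m"
  shows "outputs_within (Reduction \<gamma> C A q) (1000 * Y ^ 3 * unit_time w (com_size (Reduction \<gamma> C A q)))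
     (int m # int n # int k # xs) \<rho> [1, 1, int k, 1]"
proof (rule runs_outputs_within)
  have Y1: "1 \<le> Y" using Y_ge by linarith
  show "runs w (Reduction \<gamma> C A q) (\<lambda>_ _. 0) (int m # int n # int k # xs) \<rho> [] (1000 * Y ^ 3) (\<lambda>s' xs' r' ys'. ys' = [1, 1, int k, 1])"
  proof (rule runs_mono[OF runs_Reduction[OF d input_le, of C A q xs \<rho> 7 "\<lambda>s' xs' r' ys'. ys' = [1, 1, int k, 1]"]])
    fix s :: store assume "s 2 0 = int k"
    then have "runs w Write_trivial s xs \<rho> [] (1 + 1 + (1 + 1 + (1 + 1 + 1))) (\<lambda>s' xs' r' ys'. ys' = [1, 1, int k, 1])"
      unfolding Write_trivial_def
      by (intro runs_SeqI runs_Write[OF _ order.refl]) simp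
    then show "runs w Write_trivial s xs \<rho> [] 7 (\<lambda>s' xs' r' ys'. ys' = [1, 1, int k, 1])" by (rule runs_mono) auto
  next
    have "1 ^ 3 \<le> Y ^ 3" using Y1 by (rule power_mono) simp
    then show "7 + 10 \<le> 1000 * Y ^ 3" by simp
  qed (use dm in auto)
qed (simp_all add: w)

lemma outputs_big:
  fixes G :: "bit mat" and t :: "bit vec" and \<rho> :: "bool list"
  assumes dm: "d < m" and rd: "r < d" and hr: "h \<le> r + 1" "e * d \<le> l * (r + 1 - h)" and G: "G \<in> carrier_mat m n" and t: "t \<in> carrier_vec m"
    and len: "r * l + V * K \<le> length \<rho>"
  defines "g' \<equiv> \<lambda>i j. if j = n then of_bool (t $v i = 1) else of_bool (G $$ (i, j) = 1) :: int"
  shows "outputs_within (Reduction \<gamma> C A q) (1000 * Y ^ 3 * unit_time w (com_size (Reduction \<gamma> C A q))) (encode_ncp G t k) \<rho>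
    (encode_svp (reduction.B m n N l d r (2 ^ K) g' (draw r l \<rho>) (draw V K (drop (r * l) \<rho>))) k)"
proof (rule runs_outputs_within)
  let ?G = "\<lambda>i j. of_bool (G $$ (i, j) = 1) :: int" and ?t = "\<lambda>i. of_bool (t $v i = 1) :: int"
  interpret rp: run_params C A q m n k d e N l h r K S V M Ct Y w ?G ?t \<rho>
    by (unfold_locales; (rule e S E_ge l N S_le(2) h r K hr V M Ct len all_le_Y[OF dm rd] w)?; (use m in auto)?)
  have g: "g' = rp.g" unfolding g'_def rp.g_def fun_eq_iff by simp
  let ?xs = "map (\<lambda>b. of_bool (b = 1)) (concat (mat_to_list G) @ list_of_vec t) :: int list"
  have ml: "mat_to_list G = map (\<lambda>i. map (\<lambda>j. G $$ (i, j)) [0..<n]) [0..<m]" using G by (simp add: mat_to_list_def)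
  have len1: "length (concat (mat_to_list G)) = m * n" unfolding ml by (rule length_concat_grid)
  have len2: "length (list_of_vec t) = m" using t by simp
  have enc: "encode_ncp G t k = int m # int n # int k # ?xs" using G by (simp add: encode_ncp_def)
  have lt: "i * n + j < m * n" if "i < m" "j < n" for i j
  proof -
    have "i * n + j < Suc i * n" using that by simp
    also have "\<dots> \<le> m * n" using that by (intro mult_le_mono1) simp
    finally show ?thesis .
  qed
  have Y1: "1 \<le> Y" by (rule all_le_Y(11)[OF dm rd])
  let ?Q = "\<lambda>s' xs' r' ys'. ys' = encode_svp rp.red.B k"
  have "runs w (Reduction \<gamma> C A q) (\<lambda>_ _. 0) (encode_ncp G t k) \<rho> [] (900 * Y ^ 3 + 10) ?Q"
    unfolding enc
  proof (rule runs_Reduction[OF d input_le])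
    fix s :: store
    assume s: "s 0 0 = int m" "s 1 0 = int n" "s 2 0 = int k" "s 3 0 = int d"
    show "runs w (Reduce_instance C A q) s ?xs \<rho> [] (900 * Y ^ 3) ?Q"
    proof (rule rp.runs_Reduce_instance[of s ?xs, OF s])
      show "length ?xs = m * n + m" using t by (simp add: len1)
      show "?xs ! (i * n + j) = of_bool (G $$ (i, j) = 1)" if "i < m" "j < n" for i j
        using lt[OF that] nth_concat_grid[OF that, of "\<lambda>i j. G $$ (i, j)"] by (simp add: nth_append len1 len2 flip: ml)
      show "?xs ! (m * n + i) = of_bool (t $v i = 1)" if "i < m" for i
        using that t by (simp add: nth_append len1 len2)
    qed auto
  qed (use dm in simp)
  then show "runs w (Reduction \<gamma> C A q) (\<lambda>_ _. 0) (encode_ncp G t k) \<rho> [] (1000 * Y ^ 3)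
    (\<lambda>s' xs' r' ys'. ys' = encode_svp (reduction.B m n N l d r (2 ^ K) g' (draw r l \<rho>) (draw V K (drop (r * l) \<rho>))) k)"
    unfolding g
  proof (rule runs_mono)
    have "1 ^ 3 \<le> Y ^ 3" using Y1 by (rule power_mono) simp
    then show "900 * Y ^ 3 + 10 \<le> 1000 * Y ^ 3" by simp
  qed
qed (simp_all add: w)

end

section \<open>The total probability of failure\<close>

lemma lin_comb_le:
  fixes F A :: nat
  assumes "100 * c1 \<le> 3 * F" "100 * c3 \<le> A" "100 * c4 \<le> A"
  shows "10 * (c1 * A + F * c3 + F * c4) \<le> F * A"
proof -
  have "100 * (c1 * A) \<le> 3 * (F * A)" using mult_le_mono1[OF assms(1), of A] by (simp only: mult.assoc)
  moreover have "100 * (F * c3) \<le> F * A" "100 * (F * c4) \<le> F * A"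
    using mult_le_mono2[OF assms(2), of F] mult_le_mono2[OF assms(3), of F] by (simp_all only: mult.left_commute)
  moreover have "10 * (x + y + z) \<le> u" if "100 * x \<le> 3 * u" "100 * y \<le> u" "100 * z \<le> u" for x y z u :: nat
  proof -
    have "100 * (x + y + z) \<le> 5 * u" using that unfolding add_mult_distrib2 by linarith
    also have "\<dots> \<le> 10 * u" by simp
    finally show ?thesis by simp
  qed
  ultimately show ?thesis by blast
qed

context ncp_reduction
begin

definition coset :: "(nat \<Rightarrow> nat) \<Rightarrow> nat set set" where
  "coset f' = {z. z \<subseteq> {..<N} \<and> card z = r \<and> \<sigma> z = \<sigma> (f' ` {..<r})}"

text \<open>Collisions among the positions have probability at most \<open>1 / 100\<close>, a small
  coset \<open>2 / 100\<close>, a surviving sparse vector \<open>1 / 100\<close>, and a large coset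
  without a vector that satisfies the hash condition \<open>1 / 100\<close>. The sum is below the
  permitted \<open>1 / 10\<close>.\<close>

lemma bad_count:
  fixes u :: "nat \<Rightarrow> int"
  assumes Q: "Q > 0" and m: "m \<ge> 1" and n1: "100 * (r * r) \<le> N" and n2: "10000 * (Q * r ^ r) * N ^ (d div 2 - 1) \<le> N ^ r"
    and n3: "100 * ((V * (2 * R + 1)) ^ s * R) \<le> Q"
  defines "bad \<equiv> \<lambda>f' a'. (\<not> inj_on f' {..<r} \<or> card (coset f') \<le> 100 * Q)
    \<or> (\<exists>u\<in>sparse V R s. int Q dvd hash V u a')
    \<or> (\<not> (\<not> inj_on f' {..<r} \<or> card (coset f') \<le> 100 * Q) \<and> (\<forall>z\<in>coset f'. \<not> int Q dvd hash V (yes_vec u z) a'))"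
  shows "10 * card {x \<in> ({..<r} \<rightarrow>\<^sub>E {..<N}) \<times> ({..<V} \<rightarrow>\<^sub>E {..<Q}). bad (fst x) (snd x)} \<le> N ^ r * Q ^ V"
proof -
  let ?F = "{..<r} \<rightarrow>\<^sub>E {..<N}" and ?A = "{..<V} \<rightarrow>\<^sub>E {..<Q}"
  let ?c1 = "r * r * N ^ (r - 1) + 2 * N ^ (d div 2 - 1) * (100 * Q * r ^ r)"
  let ?c3 = "(V * (2 * R + 1)) ^ s * (R * Q ^ (V - 1))"
  let ?c4 = "Q ^ V div 100"
  have V: "V = Suc (V - 1)" by (simp add: V_def)
  have "card {x \<in> ?F \<times> ?A. bad (fst x) (snd x)} \<le> ?c1 * card ?A + card ?F * ?c3 + card ?F * ?c4"
    unfolding bad_def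
  proof (rule card_pairs_le)
    show "finite ?F" "finite ?A" by (simp_all add: finite_PiE)
    have "{f \<in> ?F. \<not> inj_on f {..<r} \<or> card (coset f) \<le> 100 * Q}
      \<subseteq> {f \<in> ?F. \<not> inj_on f {..<r}} \<union> {f \<in> ?F. inj_on f {..<r} \<and> card (coset f) \<le> 100 * Q}" by blast
    then have "card {f \<in> ?F. \<not> inj_on f {..<r} \<or> card (coset f) \<le> 100 * Q}
      \<le> card ({f \<in> ?F. \<not> inj_on f {..<r}} \<union> {f \<in> ?F. inj_on f {..<r} \<and> card (coset f) \<le> 100 * Q})"
      by (intro card_mono) (simp_all add: finite_PiE)
    also have "\<dots> \<le> card {f \<in> ?F. \<not> inj_on f {..<r}} + card {f \<in> ?F. inj_on f {..<r} \<and> card (coset f) \<le> 100 * Q}"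
      by (rule card_Un_le)
    also have "\<dots> \<le> ?c1"
      using card_not_inj_le[of r N] card_small_class_le[OF card_\<sigma>_image, of r "100 * Q"]
      unfolding coset_def by (intro add_le_mono)
    finally show "card {f \<in> ?F. \<not> inj_on f {..<r} \<or> card (coset f) \<le> 100 * Q} \<le> ?c1" .
    show "card {a \<in> ?A. \<exists>u\<in>sparse V R s. int Q dvd hash V u a} \<le> ?c3"
      by (rule no_bad_count[OF Q]) (simp add: V_def)
    fix f' assume "\<not> (\<not> inj_on f' {..<r} \<or> card (coset f') \<le> 100 * Q)"
    then have "100 * card {a \<in> ?A. \<forall>z\<in>coset f'. \<not> int Q dvd hash V (yes_vec u z) a} \<le> Q ^ V"
      using Q m by (intro yes_bad_count[of Q "coset f'" r]) (auto simp: coset_def intro!: finite_subset[of _ "Pow {..<N}"])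
    then show "card {a \<in> ?A. \<forall>z\<in>coset f'. \<not> int Q dvd hash V (yes_vec u z) a} \<le> ?c4" by simp
  qed
  also have "card ?F = N ^ r" by (simp add: card_PiE_const)
  also have "card ?A = Q ^ V" by (simp add: card_PiE_const)
  finally have "10 * card {x \<in> ?F \<times> ?A. bad (fst x) (snd x)} \<le> 10 * (?c1 * Q ^ V + N ^ r * ?c3 + N ^ r * ?c4)" by simp
  also have "\<dots> \<le> N ^ r * Q ^ V"
  proof (rule lin_comb_le)
    have "100 * (r * r * N ^ (r - 1)) \<le> N ^ r"
    proof (cases r)
      case (Suc r')
      have "100 * (r * r) * N ^ r' \<le> N * N ^ r'" using n1 by (rule mult_le_mono1)
      then show ?thesis unfolding Suc by (simp only: diff_Suc_1 power_Suc mult.assoc)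
    qed simp
    note noninj = this
    have small: "100 * (2 * N ^ (d div 2 - 1) * (100 * Q * r ^ r)) \<le> 2 * N ^ r"
    proof -
      have "100 * (2 * N ^ (d div 2 - 1) * (100 * Q * r ^ r)) = 2 * (10000 * (Q * r ^ r) * N ^ (d div 2 - 1))" by simp
      also have "\<dots> \<le> 2 * N ^ r" by (rule mult_le_mono2[OF n2])
      finally show ?thesis .
    qed
    have "100 * ?c1 = 100 * (r * r * N ^ (r - 1)) + 100 * (2 * N ^ (d div 2 - 1) * (100 * Q * r ^ r))"
      by (rule add_mult_distrib2)
    also have "\<dots> \<le> N ^ r + 2 * N ^ r" by (rule add_le_mono[OF noninj small])
    also have "\<dots> = 3 * N ^ r" by simp
    finally show "100 * ?c1 \<le> 3 * N ^ r" .
    have "100 * ((V * (2 * R + 1)) ^ s * R) * Q ^ (V - 1) \<le> Q * Q ^ (V - 1)" using n3 by (rule mult_le_mono1)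
    also have "\<dots> = Q ^ V" by (subst (2) V) simp
    finally show "100 * ?c3 \<le> Q ^ V" by (simp add: mult_ac)
    show "100 * ?c4 \<le> Q ^ V" by simp
  qed
  finally show ?thesis .
qed

end

section \<open>The case of large distance bounds and the theorem\<close>

lemma code_dist_le_rows:
  fixes G :: "bit mat" and t :: "bit vec"
  assumes "G \<in> carrier_mat m n" "t \<in> carrier_vec m"
  shows "code_dist t (lin_code G) \<le> m"
proof -
  \<comment> \<open>Placeholder parameters that satisfy the locale; the aim is to use
    \<open>code_dist_le\<close> for \<open>G\<close> and \<open>t\<close>.\<close>
  interpret ncp_reduction m n 2 1 2 0 1 "\<lambda>i j. if j = n then of_bool (t $v i = 1) else of_bool (G $$ (i, j) = 1)" "\<lambda>_. 0" "\<lambda>_. 0" G t 0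
    by unfold_locales (use assms in auto)
  have "code_dist t (lin_code G) \<le> hamming_wt (t - G *\<^sub>v 0\<^sub>v n)" by (rule code_dist_le) simp
  also have "\<dots> = card {i. i < m \<and> (t - G *\<^sub>v 0\<^sub>v n) $v i \<noteq> 0}" using assms by (simp add: hamming_wt_def)
  also have "\<dots> \<le> card {..<m}" by (intro card_mono) auto
  finally show ?thesis by simp
qed

lemma svp_yesI:
  assumes "p > 0" "w \<in> nonzero_lattice_vecs B" "lp_norm p w \<le> k" "k > 0"
  shows "svp_yes p B k"
proof -
  have ne: "nonzero_lattice_vecs B \<noteq> {}" using assms(2) by auto
  have "lambda1 p B \<le> lp_norm p w" using lambda1_attained[OF assms(1) ne] assms(2) by fastforce
  then show ?thesis using assms ne by (simp add: svp_yes_def svp_instance_def)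
qed

lemma svp_noI:
  assumes "p > 0" "nonzero_lattice_vecs B \<noteq> {}" "k > 0" "\<And>w. w \<in> nonzero_lattice_vecs B \<Longrightarrow> lp_norm p w > \<gamma> * k"
  shows "svp_no p \<gamma> B k"
proof -
  obtain w where w: "w \<in> nonzero_lattice_vecs B" "lp_norm p w = lambda1 p B"
    using lambda1_attained[OF assms(1,2)] by blast
  then show ?thesis using assms(4)[OF w(1)] assms(2,3) by (simp add: svp_no_def svp_instance_def)
qed

lemma trivial_svp:
  assumes p: "p > 0" and k: "1 \<le> k"
  defines "B \<equiv> mat 1 1 (\<lambda>_. 1 :: int)"
  shows "svp_yes p B k" "encode_svp B \<kappa> = [1, 1, int \<kappa>, 1]"
proof -
  have B1: "B *\<^sub>v vec 1 (\<lambda>_. 1) = vec 1 (\<lambda>_. 1)" by (rule eq_vecI) (simp_all add: B_def scalar_prod_def)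
  have "vec 1 (\<lambda>_. 1 :: int) $v 0 \<noteq> 0\<^sub>v 1 $v 0" by simp
  then have "vec 1 (\<lambda>_. 1 :: int) \<noteq> 0\<^sub>v 1" by metis
  then have "vec 1 (\<lambda>_. 1) \<in> nonzero_lattice_vecs B"
    unfolding nonzero_lattice_vecs_def int_lattice_def using B1 by (auto simp: B_def intro!: exI[of _ "vec 1 (\<lambda>_. 1)"])
  moreover have "lp_norm p (vec 1 (\<lambda>_. 1)) = 1" by (simp add: lp_norm_def)
  ultimately show "svp_yes p B k" using p k by (intro svp_yesI[of p "vec 1 (\<lambda>_. 1)"]) auto
  show "encode_svp B \<kappa> = [1, 1, int \<kappa>, 1]" by (simp add: encode_svp_def mat_to_list_def B_def)
qed

theorem theorem5p2:
  fixes \<gamma> c :: nat and p \<gamma>' \<alpha> :: real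
  assumes "even \<gamma>" and "\<gamma> \<ge> 2" and "c \<ge> 1" and "p > 1" and "\<gamma>' \<ge> 1"
    and "1 / 2 + 2 powr (- p) < \<alpha>" and "\<alpha> < 1"
    and "\<gamma>' < (real \<gamma> / (2 powr p + 1 + \<alpha> * real \<gamma>)) powr (1 / p)"
  shows "\<exists>(alg :: com) (time :: nat poly) (m0 :: nat).
    \<forall>(m :: nat) (n :: nat) (G :: bit Matrix.mat) (t :: bit Matrix.vec) (k :: nat).
      m \<ge> m0 \<longrightarrow> G \<in> carrier_mat m n \<longrightarrow> t \<in> carrier_vec m \<longrightarrow> k \<ge> 1 \<longrightarrow>
      (let T = poly time (max m (max n (bit_len (int k))));
           k' = (2 powr p * real k + \<alpha> * real \<gamma> * real k + 1) powr (1 / p)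
       in k' < (real \<gamma> * real k) powr (1 / p) \<and>
          (\<forall>r\<in>coins T. \<exists>B. outputs_within alg T (encode_ncp G t k) r (encode_svp B k)
                             \<and> svp_instance B k') \<and>
          measure_pmf.prob (pmf_of_set (coins T))
            {r. \<exists>B. outputs_within alg T (encode_ncp G t k) r (encode_svp B k) \<and>
                    (ncp_yes G t k \<longrightarrow> svp_yes p B k') \<and>
                    (ncp_no (real \<gamma>) G t k \<longrightarrow>
                       svp_no p \<gamma>' B k' \<and>
                       (\<forall>w\<in>nonzero_lattice_vecs B.
                          real (hamming_wt w) > (\<gamma>' * k') powr p \<or>
                          even_vec w \<and> real (hamming_wt w) > (\<gamma>' * k') powr p / 2 powr p \<or>
                          even_vec w \<and> lp_norm p w > (\<gamma>' * k') powr (real c + 3 * p / 2)))}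
          \<ge> 0.9)"
proof -
  have p: "p > 1" "p > 0" using assms(4) by auto
  define \<theta> where "\<theta> = 2 powr (- p)"
  have \<theta>0: "\<theta> > 0" by (simp add: \<theta>_def)
  have \<alpha>0: "\<alpha> > 0" using assms(6) \<theta>0 unfolding \<theta>_def by linarith
  \<comment> \<open>The program computes the weight by integer arithmetic, so \<beta> has to be a
    fraction \<open>A / q\<close>. Staying below \<alpha> keeps the YES vectors within
    \<open>k'\<close>; staying above \<open>1 / 2 + \<theta>\<close> leaves the gap
    \<epsilon>.\<close>
  obtain \<beta> where \<beta>: "\<beta> \<in> \<rat>" "1 / 2 + \<theta> < \<beta>" "\<beta> < \<alpha>"
    using Rats_dense_in_real[of "1 / 2 + \<theta>" \<alpha>] assms(6) unfolding \<theta>_def by blast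
  have "\<beta> > 0" using \<beta>(2) \<theta>0 by linarith
  then obtain A q :: nat where q: "q > 0" "\<beta> = real A / real q"
    using Rats_abs_nat_div_natE[OF \<beta>(1)] by (metis abs_of_pos gr0I)
  define \<epsilon> where "\<epsilon> = \<beta> - 1 / 2 - \<theta>"
  have \<epsilon>: "\<epsilon> > 0" using \<beta>(2) by (simp add: \<epsilon>_def)
  \<comment> \<open>This makes \<open>C * \<epsilon>\<close> reach the \<open>2 * c + 7\<close> of
    \<open>parameter_bounds\<close>; the 3 added below ensures that \<open>N\<close> is at least the
    cube of \<open>2 ^ e\<close>.\<close>
  obtain C0 :: nat where C0: "(2 * c + 7) / \<epsilon> \<le> real C0" using real_arch_simple by blast
  define C where "C = C0 + 3"
  have C: "real C * \<epsilon> \<ge> 2 * c + 7" "C \<ge> 3" "1 \<le> C"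
  proof -
    have "real (2 * c + 7) \<le> real C0 * \<epsilon>" using C0 \<epsilon> by (simp add: field_simps)
    also have "\<dots> \<le> real C * \<epsilon>" using \<epsilon> by (simp add: C_def)
    finally show "real C * \<epsilon> \<ge> 2 * c + 7" .
  qed (simp_all add: C_def)
  define alg where "alg = Reduction \<gamma> C A q"
  define z where "z = com_size alg"
  define PY :: "nat poly" where "PY = [:\<gamma> + C:] + monom (8 * 2 ^ (2 * C)) (2 + 2 * C)"
  define time :: "nat poly" where "time = [:1000:] * PY ^ 3 * ([:2 * z:] * (([:2:] * PY + [:2:]) * [:z:] + [:2:]) + ([:2:] * PY + [:2:]) + [:3:])"
  have PY: "poly PY x = size_bound \<gamma> C x" for x
    by (simp add: PY_def size_bound_def poly_monom power_mult_distrib power_add power2_eq_square)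
  have time: "poly time x = 1000 * size_bound \<gamma> C x ^ 3 * unit_time (2 * size_bound \<gamma> C x + 2) z" for x
    by (simp add: time_def PY unit_time_def poly_power)
  show ?thesis
  \<comment> \<open>From 10000 on, a single factor \<open>2 ^ e \<ge> m\<close> absorbs each
    numerical constant in \<open>parameter_bounds\<close>.\<close>
  proof (intro exI[of _ alg] exI[of _ time] exI[of _ 10000] allI impI)
    fix m n :: nat and G :: "bit mat" and t :: "bit vec" and k :: nat
    assume m: "10000 \<le> m" and G: "G \<in> carrier_mat m n" and t: "t \<in> carrier_vec m" and k: "1 \<le> k"
    define x where "x = max m (max n (bit_len (int k)))"
    define T where "T = poly time x"
    define d where "d = \<gamma> * k"
    define k' where "k' = (2 powr p * real k + \<alpha> * real \<gamma> * real k + 1) powr (1 / p)"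
    define e where "e = log_ceil m"
    define l where "l = (2::nat) ^ level ((2 ^ e) ^ C)"
    define N where "N = (2::nat) ^ l"
    define h where "h = d div 2"
    define r where "r = A * d div q"
    define K where "K = l * (r + 1 - h) - e * d"
    define S where "S = ((2::nat) ^ e) ^ C * (2 ^ e) ^ C"
    define V where "V = m + N + 1"
    define M where "M = V + (h * l + 1) * d"
    define Ct where "Ct = n + 1 + m + N + (h * l + 1)"
    define Y where "Y = size_bound \<gamma> C x"
    define w where "w = 2 * Y + 2"
    interpret ip: instance_params \<gamma> C A q m n k x d e l N h r K S V M Ct Y w
      by unfold_locales
        (use m C(3) in \<open>simp_all add: d_def e_def l_def N_def h_def r_def K_def S_def V_def M_def Ct_def Y_def w_def x_def\<close>)
    have T: "T = 1000 * Y ^ 3 * unit_time w (com_size (Reduction \<gamma> C A q))"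
      unfolding T_def time z_def alg_def Y_def w_def ..
    have \<gamma>0: "real \<gamma> > 0" "real k \<ge> 1" using assms(2) k by auto
    have kp: "k' powr p = 2 powr p * real k + \<alpha> * real \<gamma> * real k + 1"
      unfolding k'_def using p \<alpha>0 by (simp add: powr_powr)
    have den: "2 powr p + 1 + \<alpha> * real \<gamma> > 0" using \<alpha>0 by (simp add: add_pos_nonneg)
    have g'p: "\<gamma>' powr p * (2 powr p + 1 + \<alpha> * real \<gamma>) < real \<gamma>"
    proof -
      have "\<gamma>' powr p < ((real \<gamma> / (2 powr p + 1 + \<alpha> * real \<gamma>)) powr (1 / p)) powr p"
        using assms(5,8) p by (intro powr_less_mono2) auto
      also have "\<dots> = real \<gamma> / (2 powr p + 1 + \<alpha> * real \<gamma>)" using p den by (simp add: powr_powr)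
      finally show ?thesis using den by (simp add: field_simps)
    qed
    \<comment> \<open>Since \<open>k \<ge> 1\<close>, the summand 1 in \<open>k'\<close> is at most
      \<open>k\<close>; this is the 1 in the denominator of the hypothesis on \<gamma>'.\<close>
    have kp_le: "k' powr p \<le> (2 powr p + 1 + \<alpha> * real \<gamma>) * real k"
      unfolding kp using \<gamma>0 by (simp add: algebra_simps)
    have D: "(\<gamma>' * k') powr p < real d"
    proof -
      have "(\<gamma>' * k') powr p = \<gamma>' powr p * k' powr p" using assms(5) by (simp add: powr_mult k'_def)
      also have "\<dots> \<le> \<gamma>' powr p * ((2 powr p + 1 + \<alpha> * real \<gamma>) * real k)" by (intro mult_left_mono kp_le) simp
      also have "\<dots> < real \<gamma> * real k" using g'p \<gamma>0 by (simp flip: mult.assoc)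
      finally show ?thesis by (simp add: d_def)
    qed
    have g1: "1 \<le> \<gamma>' powr p" using assms(5) p by (simp add: ge_one_powr_ge_zero)
    have k'_less: "k' < (real \<gamma> * real k) powr (1 / p)"
    proof -
      have "k' powr p * 1 \<le> k' powr p * \<gamma>' powr p" using g1 by (intro mult_left_mono) auto
      also have "\<dots> = (\<gamma>' * k') powr p" using assms(5) by (simp add: powr_mult k'_def mult.commute)
      finally have "2 powr p * real k + \<alpha> * real \<gamma> * real k + 1 < real \<gamma> * real k" using D kp by (simp add: d_def)
      then show ?thesis unfolding k'_def using p \<alpha>0 by (intro powr_less_mono2) (auto intro!: add_nonneg_nonneg)
    qed
    have k'1: "1 \<le> k'" unfolding k'_def using p \<alpha>0 by (intro ge_one_powr_ge_zero) (auto intro!: add_nonneg_nonneg)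
    have x1: "1 \<le> \<gamma>' * k'" using k'1 assms(5) by (metis mult_mono' mult_1 zero_le_one)
    have d2: "even d" "2 \<le> d" using assms(1,2) k unfolding d_def by (auto intro: order_trans[of _ "\<gamma> * 1"])
    have no_dist: "d < code_dist t (lin_code G)" if "ncp_no (real \<gamma>) G t k"
      using that unfolding ncp_no_def d_def by (metis of_nat_less_iff of_nat_mult)
    let ?good = "{r. \<exists>B. outputs_within alg T (encode_ncp G t k) r (encode_svp B k) \<and>
                    (ncp_yes G t k \<longrightarrow> svp_yes p B k') \<and>
                    (ncp_no (real \<gamma>) G t k \<longrightarrow>
                       svp_no p \<gamma>' B k' \<and>
                       (\<forall>w\<in>nonzero_lattice_vecs B.
                          real (hamming_wt w) > (\<gamma>' * k') powr p \<or>
                          even_vec w \<and> real (hamming_wt w) > (\<gamma>' * k') powr p / 2 powr p \<or>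
                          even_vec w \<and> lp_norm p w > (\<gamma>' * k') powr (real c + 3 * p / 2)))}"
    have main: "(\<forall>r\<in>coins T. \<exists>B. outputs_within alg T (encode_ncp G t k) r (encode_svp B k) \<and> svp_instance B k')
      \<and> measure_pmf.prob (pmf_of_set (coins T)) ?good \<ge> 0.9"
    proof (cases "d < m")
      case False
      let ?B = "mat 1 1 (\<lambda>_. 1 :: int)"
      have enc: "encode_ncp G t k = int m # int n # int k # map (\<lambda>b. of_bool (b = 1)) (concat (mat_to_list G) @ list_of_vec t)"
        using G by (simp add: encode_ncp_def)
      have out: "outputs_within alg T (encode_ncp G t k) \<rho> (encode_svp ?B k)" for \<rho>
        unfolding trivial_svp(2)[OF p(2) k'1] alg_def T enc by (rule ip.outputs_small[OF False])
      have no: "\<not> ncp_no (real \<gamma>) G t k" using no_dist code_dist_le_rows[OF G t] False by linarith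
      have yes: "svp_yes p ?B k'" by (rule trivial_svp(1)[OF p(2) k'1])
      have inst: "svp_instance ?B k'" using yes by (simp add: svp_yes_def)
      have "?good = UNIV" using out no yes by blast
      then show ?thesis using out inst by (auto simp: measure_pmf.prob_space)
    next
      case True
      have el: "e * C \<le> l" "m \<le> 2 ^ e" by (fact ip.e_le)+
      have \<beta>\<epsilon>: "\<beta> = 1 / 2 + \<theta> + \<epsilon>" "\<beta> < 1" using \<beta>(3) assms(7) by (simp_all add: \<epsilon>_def)
      define s where "s = nat \<lfloor>\<theta> * d\<rfloor>"
      define R where "R = d ^ (c + 2)"
      define Q where "Q = (2::nat) ^ K"
      note pb = parameter_bounds[OF q(2,1) \<beta>\<epsilon> \<epsilon> less_imp_le[OF \<theta>0] C(1,2) d2 True m el(2,1), folded r_def h_def s_def, folded K_def R_def N_def, folded V_def Q_def]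
      have len: "r * l + V * K \<le> T" unfolding T by (rule ip.time_ge[OF True pb(1)])
      define g where "g = (\<lambda>i j. if j = n then of_bool (t $v i = 1) else of_bool (G $$ (i, j) = 1) :: int)"
      let ?f = "draw r l" and ?a = "\<lambda>\<rho>. draw V K (drop (r * l) \<rho>)"
      let ?B = "\<lambda>\<rho>. reduction.B m n N l d r Q g (?f \<rho>) (?a \<rho>)"
      have out: "outputs_within alg T (encode_ncp G t k) \<rho> (encode_svp (?B \<rho>) k)" if "length \<rho> = T" for \<rho>
        unfolding alg_def T Q_def g_def
        by (rule ip.outputs_big[OF True pb(1-3) G t]) (use len that in simp)
      \<comment> \<open>The assumptions of the locale do not mention \<open>r\<close>,
        \<open>Q\<close> and the random choices, so this one fact provides the interpretations for
        all coin sequences.\<close>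
      have nr: "ncp_reduction m n N l d g G t (level ((2 ^ e) ^ C))"
        by unfold_locales (use G t d2 in \<open>auto simp: g_def l_def N_def\<close>)
      \<comment> \<open>A nearest codeword is fixed before the coins, so that the target vectors and
        with them the event \<open>bad\<close> depend on the instance only.\<close>
      obtain y where y: "y \<in> carrier_vec n" "code_dist t (lin_code G) = hamming_wt (t - G *\<^sub>v y)"
        using ncp_reduction.code_dist_attained[OF nr] by blast
      define u where "u = (\<lambda>i. of_bool ((t - G *\<^sub>v y) $v i \<noteq> 0) :: int)"
      \<comment> \<open>One event covers the failures for YES and for NO instances, so a single
        count serves both implications.\<close>
      define bad where "bad = (\<lambda>f' a'. (\<not> inj_on f' {..<r} \<or> card (ncp_reduction.coset N d r f') \<le> 100 * Q)
        \<or> (\<exists>u\<in>sparse V R s. int Q dvd hash V u a')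
        \<or> (\<not> (\<not> inj_on f' {..<r} \<or> card (ncp_reduction.coset N d r f') \<le> 100 * Q)
            \<and> (\<forall>z\<in>ncp_reduction.coset N d r f'. \<not> int Q dvd hash V (ncp_reduction.yes_vec m N u z) a')))"
      have inst: "svp_instance (?B \<rho>) k'" for \<rho>
        using reduction.nonzero_lattice_vecs_ne k'1 unfolding svp_instance_def by simp
      have "measure_pmf.prob (pmf_of_set (coins T)) ?good \<ge> 0.9"
      proof (rule prob_coins_ge[OF len])
        show "10 * card {x \<in> ({..<r} \<rightarrow>\<^sub>E {..<2 ^ l}) \<times> ({..<V} \<rightarrow>\<^sub>E {..<2 ^ K}). bad (fst x) (snd x)} \<le> (2 ^ l) ^ r * (2 ^ K) ^ V"
        proof -
          \<comment> \<open>The zero functions are placeholders: \<open>bad_count\<close> ranges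
            over all pairs of random choices itself.\<close>
          interpret nr0: ncp_reduction m n N l d r Q g "\<lambda>_. 0" "\<lambda>_. 0" G t "level ((2 ^ e) ^ C)" by (rule nr)
          have V0: "nr0.V = V" by (simp add: nr0.V_def V_def)
          have "0 < Q" "1 \<le> m" using m by (simp_all add: Q_def)
          from nr0.bad_count[OF this, unfolded V0, of R s u] pb(4-6) show ?thesis
            unfolding bad_def N_def[symmetric] Q_def[symmetric] h_def by blast
        qed
      next
        fix \<rho> :: "bool list"
        assume \<rho>: "length \<rho> = T" and nb: "\<not> bad (?f \<rho>) (?a \<rho>)"
        show "\<rho> \<in> ?good"
        proof -
          interpret r1: ncp_reduction m n N l d r Q g "?f \<rho>" "?a \<rho>" G t "level ((2 ^ e) ^ C)" by (rule nr)
          have V1: "r1.V = V" by (simp add: r1.V_def V_def)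
          have k'0: "k' > 0" using k'1 by simp
          have inj: "inj_on (?f \<rho>) {..<r}" and no_sparse: "\<not> (\<exists>u\<in>sparse V R s. int Q dvd hash V u (?a \<rho>))"
            using nb unfolding bad_def by blast+
          obtain z where z: "z \<in> r1.coset (?f \<rho>)" "int Q dvd hash V (r1.yes_vec u z) (?a \<rho>)"
            using nb unfolding bad_def by blast
          have "svp_yes p (?B \<rho>) k'" if "ncp_yes G t k"
          proof -
            obtain w where w: "w \<in> nonzero_lattice_vecs (?B \<rho>)"
              "lp_norm p w = (2 powr p * code_dist t (lin_code G) + card z + 1) powr (1 / p)"
              using r1.yes_case[OF y, of z p] z inj unfolding r1.coset_def V1 u_def by blast
            have "real (r * q) \<le> real (A * d)" unfolding r_def of_nat_le_iff by (rule div_times_less_eq_dividend)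
            then have "real r \<le> \<beta> * d" unfolding q(2) using q(1) by (simp add: field_simps)
            also have "\<dots> \<le> \<alpha> * d" using \<beta>(3) by (intro mult_right_mono) auto
            finally have "real r \<le> \<alpha> * real \<gamma> * real k" by (simp add: d_def)
            moreover have "card z = r" using z(1) unfolding r1.coset_def by blast
            ultimately have "real (card z) \<le> \<alpha> * real \<gamma> * real k" by simp
            moreover have "2 powr p * code_dist t (lin_code G) \<le> 2 powr p * real k"
              using that by (simp add: ncp_yes_def)
            ultimately have "2 powr p * code_dist t (lin_code G) + card z + 1 \<le> 2 powr p * real k + \<alpha> * real \<gamma> * real k + 1"
              by linarith
            then have "lp_norm p w \<le> k'" unfolding w(2) k'_def using p by (intro powr_mono2) auto
            then show ?thesis using w(1) p k'0 by (intro svp_yesI[of p w]) auto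
          qed
          moreover have "svp_no p \<gamma>' (?B \<rho>) k' \<and> (\<forall>w\<in>nonzero_lattice_vecs (?B \<rho>).
                          real (hamming_wt w) > (\<gamma>' * k') powr p \<or>
                          even_vec w \<and> real (hamming_wt w) > (\<gamma>' * k') powr p / 2 powr p \<or>
                          even_vec w \<and> lp_norm p w > (\<gamma>' * k') powr (real c + 3 * p / 2))" if "ncp_no (real \<gamma>) G t k"
          proof -
            have dist: "d \<le> code_dist t (lin_code G)" using no_dist[OF that] by simp
            note nc = r1.no_case[OF p(1) x1 D dist, of c, unfolded V1, OF no_sparse[unfolded R_def s_def \<theta>_def]]
            have "lp_norm p w > \<gamma>' * k'" if "w \<in> nonzero_lattice_vecs (?B \<rho>)" for w
              by (rule lp_norm_greater[OF p(1) x1 nc[OF that]])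
            then have "svp_no p \<gamma>' (?B \<rho>) k'" using r1.nonzero_lattice_vecs_ne p k'0 by (intro svp_noI) auto
            then show ?thesis using nc by blast
          qed
          ultimately show ?thesis using out[OF \<rho>] by blast
        qed
      qed
      then show ?thesis using out inst by (auto simp: coins_def)
    qed
    then show "let T = poly time (max m (max n (bit_len (int k))));
           k' = (2 powr p * real k + \<alpha> * real \<gamma> * real k + 1) powr (1 / p)
       in k' < (real \<gamma> * real k) powr (1 / p) \<and>
          (\<forall>r\<in>coins T. \<exists>B. outputs_within alg T (encode_ncp G t k) r (encode_svp B k)
                             \<and> svp_instance B k') \<and>
          measure_pmf.prob (pmf_of_set (coins T))
            {r. \<exists>B. outputs_within alg T (encode_ncp G t k) r (encode_svp B k) \<and>
                    (ncp_yes G t k \<longrightarrow> svp_yes p B k') \<and>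
                    (ncp_no (real \<gamma>) G t k \<longrightarrow>
                       svp_no p \<gamma>' B k' \<and>
                       (\<forall>w\<in>nonzero_lattice_vecs B.
                          real (hamming_wt w) > (\<gamma>' * k') powr p \<or>
                          even_vec w \<and> real (hamming_wt w) > (\<gamma>' * k') powr p / 2 powr p \<or>
                          even_vec w \<and> lp_norm p w > (\<gamma>' * k') powr (real c + 3 * p / 2)))}
          \<ge> 0.9"
      unfolding Let_def x_def[symmetric] T_def[symmetric] k'_def[symmetric] using k'_less by (intro conjI) auto
  qed
qed

end
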